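(* There exists a constant $C>0$ such that for every graph $H$ and every integer $n\geq C\,|H|\log^4\chi(H)$, the cycle $C_n$ is $H$-good, i.e. \[R(C_n,H)=(\chi(H)-1)(n-1)+\sigma(H).\]
   Context: For graphs $F,H$, the Ramsey number $R(F,H)$ is the minimum $N$ such that every $N$-vertex graph $G$ either contains a copy of $F$ or its complement $\overline{G}$ contains a copy of $H$. $C_n$ denotes the cycle on $n$ vertices, $|H|$ is the number of vertices of $H$, and $\chi(H)$ is its chromatic number. $\sigma(H)$ is the minimum possible size of a colour class in a proper colouring of $H$ with $\chi(H)$ colours. A connected graph $F$ is called $H$-good if $R(F,H)=(\chi(H)-1)(|F|-1)+\sigma(H)$. Logarithms are natural. *)

theory Defs
  imports Complex_Main
begin

definition graph :: "nat set \<Rightarrow> (nat \<Rightarrow> nat \<Rightarrow> bool) \<Rightarrow> bool" where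
  "graph V E \<longleftrightarrow> finite V \<and> (\<forall>u v. E u v \<longrightarrow> u \<in> V \<and> v \<in> V \<and> u \<noteq> v \<and> E v u)"

definition contains_copy ::
  "nat set \<Rightarrow> (nat \<Rightarrow> nat \<Rightarrow> bool) \<Rightarrow> nat set \<Rightarrow> (nat \<Rightarrow> nat \<Rightarrow> bool) \<Rightarrow> bool" where
  "contains_copy VG EG VF EF \<longleftrightarrow>
     (\<exists>f. inj_on f VF \<and> f ` VF \<subseteq> VG \<and> (\<forall>u v. EF u v \<longrightarrow> EG (f u) (f v)))"

definition compl_graph :: "nat set \<Rightarrow> (nat \<Rightarrow> nat \<Rightarrow> bool) \<Rightarrow> nat \<Rightarrow> nat \<Rightarrow> bool" where
  "compl_graph V E u v \<longleftrightarrow> u \<in> V \<and> v \<in> V \<and> u \<noteq> v \<and> \<not> E u v"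

definition ramsey_number ::
  "nat set \<Rightarrow> (nat \<Rightarrow> nat \<Rightarrow> bool) \<Rightarrow> nat set \<Rightarrow> (nat \<Rightarrow> nat \<Rightarrow> bool) \<Rightarrow> nat" where
  "ramsey_number VF EF VH EH = (LEAST N. \<forall>E. graph {0..<N} E \<longrightarrow>
      contains_copy {0..<N} E VF EF \<or> contains_copy {0..<N} (compl_graph {0..<N} E) VH EH)"

definition cycle_edges :: "nat \<Rightarrow> nat \<Rightarrow> nat \<Rightarrow> bool" where
  "cycle_edges n i j \<longleftrightarrow> i < n \<and> j < n \<and> i \<noteq> j \<and> (j = (i + 1) mod n \<or> i = (j + 1) mod n)"

definition proper_colouring :: "nat set \<Rightarrow> (nat \<Rightarrow> nat \<Rightarrow> bool) \<Rightarrow> nat \<Rightarrow> (nat \<Rightarrow> nat) \<Rightarrow> bool" where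
  "proper_colouring V E k c \<longleftrightarrow> (\<forall>v\<in>V. c v < k) \<and> (\<forall>u v. E u v \<longrightarrow> c u \<noteq> c v)"

definition chromatic_number :: "nat set \<Rightarrow> (nat \<Rightarrow> nat \<Rightarrow> bool) \<Rightarrow> nat" where
  "chromatic_number V E = (LEAST k. \<exists>c. proper_colouring V E k c)"

definition sigma :: "nat set \<Rightarrow> (nat \<Rightarrow> nat \<Rightarrow> bool) \<Rightarrow> nat" where
  "sigma V E = (LEAST s. \<exists>c. proper_colouring V E (chromatic_number V E) c \<and>
      (\<exists>i < chromatic_number V E. card {v\<in>V. c v = i} = s))"

end

theory Submission
  imports Defs
begin

text \<open>
  Upper bound. Let \<open>m\<^sub>1 \<le> m\<^sub>2 \<le> \<dots> \<le> m\<^sub>k\<close> be the class sizes of a colouring realising \<open>\<sigma>(H)\<close>, \<open>m\<close> their sum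
  and \<open>M = m\<^sub>2\<close>; it suffices to find a cycle of length \<open>n\<close> or pairwise disjoint, pairwise non-adjacent
  sets of these sizes. Induction on \<open>k\<close> lets us assume that every set of \<open>M\<close> vertices has a closed
  neighbourhood of size at least \<open>n\<close>: otherwise delete this neighbourhood. Passing at most
  \<open>log (2k)\<close> times to a subset of at most half the size with few new outer neighbours yields a
  cluster \<open>A\<close> with less than \<open>n / 1000\<close> outer neighbours in which any two sets of size \<open>M\<close> cannot be
  separated by \<open>s = 2000 m\<close> vertices.

  If \<open>A\<close> is larger than \<open>n + 2000 m\<close>, build inside \<open>A\<close> a chain of short cycles, each sharing one
  vertex with the next, such that the lengths of the paths through the chain contain all numbers of one parity
  from an interval of length \<open>4m\<close>. The short cycles exist because a vertex with \<open>k\<close> neighbours in a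
  part where small sets expand must have two neighbours at distance \<open>O(log M)\<close>: otherwise the balls
  around its neighbours would be separated sets. By the argument of Chvatal and Erdos a longest path
  joining the ends of the chain outside it misses at most \<open>3m\<close> vertices of \<open>A\<close>; it can be shortened by
  chords in odd steps of at most \<open>2m\<close>, and the chain then adjusts the length to \<open>n\<close>.

  Otherwise \<open>A\<close> has about \<open>n\<close> vertices. A maximal set \<open>R\<close> that expands badly into \<open>A\<close> is put aside; by the
  induction hypothesis the remaining vertices number \<open>n - 1 + x\<close>, where sets of size \<open>x\<close> see almost all of \<open>A\<close>
  and smaller sets expand. Posa rotations then give a path missing fewer than \<open>x\<close> vertices, whose
  length is brought down by deleting end vertices that do not spoil the expansion, and a reserved
  path with many possible ends closes it to a cycle of length \<open>n\<close>.
\<close>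

section \<open>Auxiliary facts on maxima, subsets and lists\<close>

lemma finite_arg_max_exists:
  fixes f :: "'b \<Rightarrow> nat"
  assumes "P x0" and "\<And>x. P x \<Longrightarrow> f x \<le> N"
  obtains x where "P x" "\<And>y. P y \<Longrightarrow> f y \<le> f x"
proof -
  have "\<exists>x. P x \<and> (\<forall>y. P y \<longrightarrow> f y \<le> f x)"
    using assms by (intro ex_has_greatest_nat[of P x0 f "Suc N"]) (auto simp: le_imp_less_Suc)
  then show thesis using that by blast
qed

lemma subset_with_card:
  assumes "finite S" "c \<le> card S"
  obtains T where "T \<subseteq> S" "card T = c" "finite T"
  using assms by (meson finite_subset obtain_subset_with_card_n)

lemma successively_take: "successively P xs \<Longrightarrow> successively P (take n xs)"
  and successively_drop: "successively P xs \<Longrightarrow> successively P (drop n xs)"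
  by (metis append_take_drop_id successively_append_iff)+

section \<open>Neighbourhoods and separated families\<close>

locale sgraph =
  fixes E :: "'a \<Rightarrow> 'a \<Rightarrow> bool"
  assumes E_sym: "E u v \<Longrightarrow> E v u" and E_irrefl: "\<not> E u u"
begin

definition nb :: "'a set \<Rightarrow> 'a set \<Rightarrow> 'a set" where
  "nb S X = {v \<in> S. v \<notin> X \<and> (\<exists>x\<in>X. E x v)}"

text \<open>\<open>X\<close> may reach outside \<open>S\<close>: the small cluster argument measures
  \<open>cnb A1 R\<close> for sets \<open>R\<close> of vertices that can lie outside
  \<open>A1\<close>.\<close>

definition cnb :: "'a set \<Rightarrow> 'a set \<Rightarrow> 'a set" where
  "cnb S X = {v \<in> S. v \<in> X \<or> (\<exists>x\<in>X. E x v)}"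

lemma nb_subset: "nb S X \<subseteq> S"
  and cnb_subset: "cnb S X \<subseteq> S"
  by (auto simp: nb_def cnb_def)

lemma finite_nb [simp]: "finite S \<Longrightarrow> finite (nb S X)"
  and finite_cnb [simp]: "finite S \<Longrightarrow> finite (cnb S X)"
  by (auto simp: nb_def cnb_def)

lemma cnb_Un: "cnb S (X \<union> Y) = cnb S X \<union> cnb S Y"
  by (auto simp: cnb_def)

lemma cnb_mono: "X \<subseteq> Y \<Longrightarrow> S \<subseteq> T \<Longrightarrow> cnb S X \<subseteq> cnb T Y"
  by (auto simp: cnb_def)

lemma cnb_eq: "X \<subseteq> S \<Longrightarrow> cnb S X = X \<union> nb S X"
  by (auto simp: nb_def cnb_def)

lemma card_cnb:
  assumes "finite S" "X \<subseteq> S" shows "card (cnb S X) = card X + card (nb S X)"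
  using assms unfolding cnb_eq[OF assms(2)]
  by (intro card_Un_disjoint) (auto simp: nb_def finite_subset)

text \<open>\<open>sep S L\<close>: the complement of the graph on \<open>S\<close> contains the complete multipartite graph
  with part sizes \<open>L\<close>.\<close>
fun sep :: "'a set \<Rightarrow> nat list \<Rightarrow> bool" where
  "sep S [] = True"
| "sep S (m # ms) = (\<exists>B \<subseteq> S. finite B \<and> card B = m \<and> sep (S - cnb S B) ms)"

lemma sep_mono: "sep S L \<Longrightarrow> S \<subseteq> T \<Longrightarrow> sep T L"
proof (induction L arbitrary: S T)
  case (Cons m L)
  then obtain B where B: "B \<subseteq> S" "finite B" "card B = m" "sep (S - cnb S B) L" by auto
  have "S - cnb S B \<subseteq> T - cnb T B" using Cons.prems(2) by (auto simp: cnb_def)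
  then show ?case using B Cons.IH Cons.prems(2) by (metis dual_order.trans sep.simps(2))
qed simp

text \<open>The form in which families are assembled: \<open>T \<inter> cnb T B = {}\<close>
  excludes overlaps and edges between \<open>B\<close> and \<open>T\<close>, and cutting
  \<open>B\<close> down to exactly \<open>m\<close> vertices preserves this.\<close>

lemma sep_Cons_I:
  assumes "B \<subseteq> S" "finite B" "m \<le> card B" "sep T L" "T \<subseteq> S" "T \<inter> cnb T B = {}"
  shows "sep S (m # L)"
proof -
  obtain C where C: "C \<subseteq> B" "card C = m" "finite C"
    using subset_with_card[OF assms(2,3)] by blast
  have "T \<subseteq> S - cnb S C" using assms(5,6) C(1) by (auto simp: cnb_def)
  then show ?thesis using C assms(1,4) sep_mono by (metis dual_order.trans sep.simps(2))
qed

lemma sep_disjoint_family: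
  assumes "\<And>i. i < length L \<Longrightarrow> B i \<subseteq> S \<and> finite (B i) \<and> L ! i \<le> card (B i)"
    and "\<And>i j. i < length L \<Longrightarrow> j < length L \<Longrightarrow> i \<noteq> j \<Longrightarrow> B j \<inter> cnb S (B i) = {}"
  shows "sep S L"
  using assms
proof (induction L arbitrary: S B)
  case (Cons m L)
  let ?T = "S - cnb S (B 0)"
  have 1: "sep ?T L"
  proof (rule Cons.IH[where B = "\<lambda>i. B (Suc i)"])
    fix i assume i: "i < length L"
    show "B (Suc i) \<subseteq> ?T \<and> finite (B (Suc i)) \<and> L ! i \<le> card (B (Suc i))"
      using Cons.prems(1)[of "Suc i"] Cons.prems(2)[of 0 "Suc i"] i by auto
  next
    fix i j assume "i < length L" "j < length L" "i \<noteq> j"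
    then show "B (Suc j) \<inter> cnb ?T (B (Suc i)) = {}"
      using Cons.prems(2)[of "Suc i" "Suc j"] by (auto simp: cnb_def)
  qed
  show ?case
    by (rule sep_Cons_I[OF _ _ _ 1, of "B 0"]) (use Cons.prems(1)[of 0] in \<open>auto simp: cnb_def\<close>)
qed simp

text \<open>Unfolds the recursion into an indexed family, from which a copy of \<open>H\<close> in
  the complement is read off later.\<close>

lemma sep_family:
  assumes "sep S L"
  shows "\<exists>B. (\<forall>i<length L. B i \<subseteq> S \<and> finite (B i) \<and> card (B i) = L ! i) \<and>
    (\<forall>i<length L. \<forall>j<length L. i \<noteq> j \<longrightarrow> B i \<inter> B j = {} \<and> (\<forall>u\<in>B i. \<forall>v\<in>B j. \<not> E u v))"
  using assms
proof (induction L arbitrary: S)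
  case (Cons m L)
  then obtain B0 where B0: "B0 \<subseteq> S" "finite B0" "card B0 = m" "sep (S - cnb S B0) L" by auto
  obtain B where Ba: "\<forall>i<length L. B i \<subseteq> S - cnb S B0 \<and> finite (B i) \<and> card (B i) = L ! i"
    and Bb: "\<forall>i<length L. \<forall>j<length L. i \<noteq> j \<longrightarrow>
          B i \<inter> B j = {} \<and> (\<forall>u\<in>B i. \<forall>v\<in>B j. \<not> E u v)"
    using Cons.IH[OF B0(4)] by (elim exE conjE)
  let ?B = "\<lambda>i. case i of 0 \<Rightarrow> B0 | Suc j \<Rightarrow> B j"
  have 1: "\<forall>i<length (m # L). ?B i \<subseteq> S \<and> finite (?B i) \<and> card (?B i) = (m # L) ! i"
    using B0 Ba by (auto split: nat.splits)
  have key: "B0 \<inter> B j = {}" "\<forall>u\<in>B0. \<forall>v\<in>B j. \<not> E u v" if "j < length L" for j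
    using Ba that B0(1) unfolding cnb_def by fastforce+
  have 2: "?B i \<inter> ?B j = {} \<and> (\<forall>u\<in>?B i. \<forall>v\<in>?B j. \<not> E u v)"
    if "i < length (m # L)" "j < length (m # L)" "i \<noteq> j" for i j
  proof (cases i; cases j)
    fix j' assume "i = 0" "j = Suc j'"
    then show ?thesis using key[of j'] that by simp
  next
    fix i' assume "i = Suc i'" "j = 0"
    then show ?thesis using key[of i'] that E_sym by simp blast
  next
    fix i' j' assume "i = Suc i'" "j = Suc j'"
    then show ?thesis using Bb that by simp
  qed (use that in auto)
  show ?case using 1 2 by (intro exI[of _ ?B]) blast
qed auto

lemma sep_independent:
  assumes "finite S" "\<forall>u\<in>S. \<forall>v\<in>S. \<not> E u v" "sum_list L \<le> card S"
  shows "sep S L"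
  using assms
proof (induction L arbitrary: S)
  case (Cons m L)
  obtain B where B: "B \<subseteq> S" "card B = m" "finite B"
    using subset_with_card[OF Cons.prems(1), of m] Cons.prems(3) by auto
  have e: "cnb S B = B" using B(1) Cons.prems(2) by (auto simp: cnb_def)
  have "sep (S - B) L"
    using Cons.prems B by (intro Cons.IH) (auto simp: card_Diff_subset)
  then show ?case using B e by auto
qed simp

section \<open>Paths, cycles and components\<close>

definition pth :: "'a set \<Rightarrow> 'a list \<Rightarrow> bool" where
  "pth S xs \<longleftrightarrow> xs \<noteq> [] \<and> distinct xs \<and> set xs \<subseteq> S \<and> successively E xs"

definition has_cycle :: "'a set \<Rightarrow> nat \<Rightarrow> bool" where
  "has_cycle S n \<longleftrightarrow> (\<exists>xs. length xs = n \<and> distinct xs \<and> set xs \<subseteq> S \<and> successively E xs \<and>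
     E (last xs) (hd xs))"

lemma has_cycle_mono: "has_cycle S n \<Longrightarrow> S \<subseteq> T \<Longrightarrow> has_cycle T n"
  unfolding has_cycle_def by blast

lemma pth_mono: "pth S xs \<Longrightarrow> S \<subseteq> T \<Longrightarrow> pth T xs"
  unfolding pth_def by blast

lemma successively_E_flip: "successively (\<lambda>x y. E y x) xs = successively E xs"
proof -
  have "(\<lambda>x y. E y x) = E" using E_sym by blast
  then show ?thesis by (rule arg_cong)
qed

lemma successively_E_rev [simp]: "successively E (rev xs) \<longleftrightarrow> successively E xs"
  unfolding successively_rev by (rule successively_E_flip)

lemma pth_rev: "pth S (rev xs) \<longleftrightarrow> pth S xs"
  unfolding pth_def successively_E_rev by simp

lemma pth_length_le: "pth S xs \<Longrightarrow> finite S \<Longrightarrow> length xs \<le> card S"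
  unfolding pth_def by (metis card_mono distinct_card)

lemma walk_to_path:
  assumes "xs \<noteq> []" "successively E xs"
  shows "\<exists>ys. pth (set xs) ys \<and> hd ys = hd xs \<and> last ys = last xs \<and> length ys \<le> length xs"
  using assms
proof (induction "length xs" arbitrary: xs rule: less_induct)
  case less
  show ?case
  proof (cases "distinct xs")
    case True
    then show ?thesis using less.prems by (intro exI[of _ xs]) (auto simp: pth_def)
  next
    case False
    then obtain as x bs cs where xs: "xs = as @ [x] @ bs @ [x] @ cs"
      using not_distinct_decomp by blast
    let ?zs = "as @ [x] @ cs"
    have s: "successively E ?zs"
      using less.prems(2) unfolding xs by (auto simp: successively_append_iff successively_Cons)
    obtain ys where ys: "pth (set ?zs) ys" "hd ys = hd ?zs" "last ys = last ?zs"
      "length ys \<le> length ?zs"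
      using less.hyps[of ?zs] s xs by auto
    have "set ?zs \<subseteq> set xs" by (auto simp: xs)
    moreover have "hd ?zs = hd xs" "last ?zs = last xs" by (auto simp: xs hd_append last_append)
    moreover have "length ?zs \<le> length xs" by (auto simp: xs)
    ultimately show ?thesis using ys pth_mono[OF ys(1)] by (intro exI[of _ ys]) auto
  qed
qed

text \<open>For \<open>v\<close> in \<open>S\<close> this is the vertex set of the component of
  \<open>v\<close> in the graph induced on \<open>S\<close>.\<close>

definition reach :: "'a set \<Rightarrow> 'a \<Rightarrow> 'a set" where
  "reach S v = {u. \<exists>xs. pth S xs \<and> hd xs = v \<and> last xs = u}"

lemma reach_subset: "reach S v \<subseteq> S"
  by (auto simp: reach_def pth_def)

lemma reach_self: "v \<in> S \<Longrightarrow> v \<in> reach S v"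
  unfolding reach_def by (intro CollectI exI[of _ "[v]"]) (auto simp: pth_def)

lemma pth_append:
  assumes "pth S xs" "pth S ys" "set xs \<inter> set ys = {}" "E (last xs) (hd ys)"
  shows "pth S (xs @ ys)"
  using assms by (auto simp: pth_def successively_append_iff)

lemma walk_join:
  assumes "pth S xs" "pth S ys" "last xs = hd ys \<or> E (last xs) (hd ys)"
  obtains zs where "pth S zs" "hd zs = hd xs" "last zs = last ys"
    "length zs \<le> length xs + length ys" "set zs \<subseteq> set xs \<union> set ys"
proof -
  let ?w = "if last xs = hd ys then xs @ tl ys else xs @ ys"
  have ne: "xs \<noteq> []" "ys \<noteq> []" using assms by (auto simp: pth_def)
  have s: "successively E ?w"
    using assms ne by (cases ys) (auto simp: pth_def successively_append_iff successively_Cons)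
  have w: "?w \<noteq> []" "set ?w \<subseteq> set xs \<union> set ys" "hd ?w = hd xs" "last ?w = last ys"
    "length ?w \<le> length xs + length ys"
    using ne by (cases ys; auto dest: list.set_sel(2))+
  obtain zs where zs: "pth (set ?w) zs" "hd zs = hd ?w" "last zs = last ?w" "length zs \<le> length ?w"
    using walk_to_path[OF w(1) s] by blast
  have "set ?w \<subseteq> S" using w(2) assms by (auto simp: pth_def)
  then have "pth S zs" using pth_mono[OF zs(1)] by blast
  moreover have "set zs \<subseteq> set xs \<union> set ys" using zs(1) w(2) unfolding pth_def by blast
  ultimately show thesis using that[of zs] zs(2,3,4) w(3,4,5) by simp
qed

lemma reach_trans_edge:
  assumes "u \<in> reach S v" "E u w" "w \<in> S" shows "w \<in> reach S v"
proof -
  obtain xs where xs: "pth S xs" "hd xs = v" "last xs = u" using assms(1) by (auto simp: reach_def)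
  have "pth S [w]" using assms(3) by (auto simp: pth_def)
  from walk_join[OF xs(1) this] xs assms(2) show ?thesis by (auto simp: reach_def)
qed

lemma pth_subset_reach:
  assumes "pth S xs" shows "set xs \<subseteq> reach S (hd xs)"
proof
  fix a assume "a \<in> set xs"
  then obtain as bs where ab: "xs = as @ a # bs" by (meson split_list)
  have "pth S (as @ [a])" using assms unfolding ab
    by (auto simp: pth_def successively_append_iff)
  moreover have "hd (as @ [a]) = hd xs" using ab by (cases as) auto
  ultimately show "a \<in> reach S (hd xs)" by (auto simp: reach_def intro!: exI[of _ "as @ [a]"])
qed

lemma reach_path:
  assumes "u \<in> reach S v" "w \<in> reach S v"
  obtains xs where "pth (reach S v) xs" "hd xs = u" "last xs = w"
proof -
  obtain xs where xs: "pth S xs" "hd xs = v" "last xs = u" using assms(1) by (auto simp: reach_def)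
  obtain ys where ys: "pth S ys" "hd ys = v" "last ys = w" using assms(2) by (auto simp: reach_def)
  have "pth (reach S v) (rev xs)" "pth (reach S v) ys"
    using pth_subset_reach[OF xs(1)] pth_subset_reach[OF ys(1)] xs ys unfolding pth_rev by (auto simp: pth_def)
  moreover have "last (rev xs) = hd ys" using xs ys by (simp add: pth_def last_rev)
  ultimately obtain zs where "pth (reach S v) zs" "hd zs = hd (rev xs)" "last zs = last ys"
    using walk_join by metis
  then show thesis using that xs ys by (simp add: pth_def hd_rev)
qed

end

section \<open>Rotations and longest paths\<close>

context sgraph begin

text \<open>Consecutiveness on a path, in either order. Stated as a failure of
  \<open>successively\<close>, it inherits the rules for append and reversal.\<close>

definition adj :: "'a list \<Rightarrow> 'a \<Rightarrow> 'a \<Rightarrow> bool" where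
  "adj Q a b \<longleftrightarrow> \<not> successively (\<lambda>x y. {x, y} \<noteq> {a, b}) Q"

lemma adj_append_Cons:
  "ys \<noteq> [] \<Longrightarrow> adj (xs @ c # ys) a b \<longleftrightarrow>
     adj (xs @ [c]) a b \<or> adj ys a b \<or> {c, hd ys} = {a, b}"
  by (auto simp: adj_def successively_append_iff successively_Cons)

lemma adj_rev: "adj (rev ys) a b \<longleftrightarrow> adj ys a b"
  unfolding adj_def successively_rev by (simp add: insert_commute)

lemma card_adj_le:
  assumes "distinct Q" shows "finite {v. adj Q v w} \<and> card {v. adj Q v w} \<le> 2"
proof -
  \<comment> \<open>The two values are the successor and the predecessor of \<open>w\<close>. At an
    end of \<open>Q\<close> one index is out of range or truncated to 0, which is harmless in an
    upper bound.\<close>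
  have "\<exists>j. {v. adj Q v w} \<subseteq> {Q ! Suc j, Q ! (j - 1)}"
  proof (cases "\<exists>j<length Q. Q ! j = w")
    case True
    then obtain j where j: "j < length Q" "Q ! j = w" by blast
    have "v \<in> {Q ! Suc j, Q ! (j - 1)}" if "adj Q v w" for v
    proof -
      from that obtain i where i: "Suc i < length Q" "{Q ! i, Q ! Suc i} = {v, w}"
        unfolding adj_def successively_conv_nth by blast
      then consider "Q ! i = w" "Q ! Suc i = v" | "Q ! i = v" "Q ! Suc i = w"
        by (metis doubleton_eq_iff)
      then show ?thesis
      proof cases
        case 1
        then have "i = j" using assms i j by (metis Suc_lessD nth_eq_iff_index_eq)
        then show ?thesis using 1 by auto
      next
        case 2
        then have "Suc i = j" using assms i j by (metis nth_eq_iff_index_eq)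
        then show ?thesis using 2 by auto
      qed
    qed
    then show ?thesis by blast
  next
    case False
    have "\<not> adj Q v w" for v
    proof
      assume "adj Q v w"
      then obtain i where i: "Suc i < length Q" "{Q ! i, Q ! Suc i} = {v, w}"
        unfolding adj_def successively_conv_nth by blast
      then have "w = Q ! i \<or> w = Q ! Suc i" by blast
      then show False using False i(1) Suc_lessD by metis
    qed
    then show ?thesis by blast
  qed
  then obtain j where j: "{v. adj Q v w} \<subseteq> {Q ! Suc j, Q ! (j - 1)}" by blast
  have "card {Q ! Suc j, Q ! (j - 1)} \<le> 2" by (simp add: card_insert_if)
  then show ?thesis using j by (meson card_mono finite.emptyI finite.insertI finite_subset le_trans)
qed

text \<open>Posa rotation: the end \<open>last ys\<close> is joined to \<open>c\<close>, the edge
  from \<open>c\<close> to \<open>hd ys\<close> is given up, and \<open>hd ys\<close> becomes the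
  new end. The first vertex never changes.\<close>

inductive rotc :: "'a list \<Rightarrow> 'a list \<Rightarrow> bool" for P where
  rot_base: "rotc P P"
| rot_step: "rotc P (xs @ c # ys) \<Longrightarrow> ys \<noteq> [] \<Longrightarrow> E (last ys) c \<Longrightarrow> rotc P (xs @ c # rev ys)"

lemma rotc_pth:
  assumes "rotc P Q" "pth S P"
  shows "pth S Q \<and> hd Q = hd P \<and> set Q = set P \<and> length Q = length P"
  using assms
proof (induction rule: rotc.induct)
  case (rot_step xs c ys)
  then have IH: "pth S (xs @ c # ys)" "hd (xs @ c # ys) = hd P" "set (xs @ c # ys) = set P"
    "length (xs @ c # ys) = length P" by auto
  have "successively E (xs @ c # rev ys)"
    using IH(1) rot_step.hyps(2) E_sym[OF rot_step.hyps(3)]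
    by (auto simp: pth_def successively_append_iff successively_Cons hd_rev simp del: successively_rev)
  then have "pth S (xs @ c # rev ys)" using IH(1) by (auto simp: pth_def)
  moreover have "hd (xs @ c # rev ys) = hd P" using IH(2) by (cases xs) auto
  ultimately show ?case using IH by auto
qed auto

text \<open>\<open>X\<close> collects the ends of all rotations of \<open>P\<close>. A neighbour
  \<open>v\<close> of an end lies on the path by maximality, and rotating there turns the successor
  of \<open>v\<close> into an end. If \<open>v\<close> is not an end itself, this forces an end next
  to \<open>v\<close> already on \<open>P\<close>, and each end has at most two neighbours on
  \<open>P\<close>.\<close>

lemma posa:
  assumes P: "pth S P" and longest: "\<And>Q. pth S Q \<Longrightarrow> hd Q = hd P \<Longrightarrow> length Q \<le> length P"
  obtains X where "X \<subseteq> set P" "X \<noteq> {}" "nb S X \<subseteq> set P" "card (nb S X) \<le> 2 * card X"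
    "\<And>e. e \<in> X \<Longrightarrow> \<exists>Q. pth S Q \<and> hd Q = hd P \<and> last Q = e \<and> set Q = set P \<and> length Q = length P"
proof -
  define X where "X = {last Q |Q. rotc P Q}"
  have paths: "\<exists>Q. pth S Q \<and> hd Q = hd P \<and> last Q = e \<and> set Q = set P \<and> length Q = length P"
    if "e \<in> X" for e using that rotc_pth[OF _ P] unfolding X_def by blast
  have XP: "X \<subseteq> set P"
  proof
    fix e assume "e \<in> X"
    then obtain Q where "pth S Q" "last Q = e" "set Q = set P" using paths by blast
    then show "e \<in> set P" unfolding pth_def by (metis last_in_set)
  qed
  have nbP: "nb S X \<subseteq> set P"
  proof
    fix v assume "v \<in> nb S X"
    then obtain e where e: "e \<in> X" "E e v" "v \<in> S" by (auto simp: nb_def)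
    obtain Q where Q: "pth S Q" "hd Q = hd P" "last Q = e" "set Q = set P" "length Q = length P"
      using paths[OF e(1)] by blast
    show "v \<in> set P"
    proof (rule ccontr)
      assume "v \<notin> set P"
      then have "pth S (Q @ [v])" using Q e by (intro pth_append) (auto simp: pth_def)
      moreover have "hd (Q @ [v]) = hd P" using Q by (auto simp: pth_def)
      ultimately show False using longest[of "Q @ [v]"] Q by simp
    qed
  qed
  \<comment> \<open>If neither \<open>v\<close> nor any neighbour of \<open>v\<close> on
    \<open>P\<close> is ever an end, no rotation gives \<open>v\<close> a new path edge: the new
    edge joins \<open>c\<close> to the old end, and \<open>v = c\<close> would make
    \<open>hd ys\<close>, a neighbour of \<open>v\<close> on \<open>P\<close>, an end.\<close>
  have edge: "adj P v w" if "rotc P Q" "adj Q v w" "v \<notin> X" "\<And>u. adj P v u \<Longrightarrow> u \<notin> X" for Q v w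
    using that
  proof (induction arbitrary: w rule: rotc.induct)
    case (rot_step xs c ys)
    have "last (xs @ c # ys) \<in> X" using rot_step.hyps(1) unfolding X_def by blast
    then have l: "last ys \<in> X" using rot_step.hyps(2) by simp
    have "last (xs @ c # rev ys) \<in> X"
      using rotc.rot_step[OF rot_step.hyps] unfolding X_def by blast
    then have h: "hd ys \<in> X" using rot_step.hyps(2) by (simp add: last_rev)
    have IH: "adj P v w" if "adj (xs @ c # ys) v w" for w
      using rot_step.IH[OF that] rot_step.prems by blast
    from rot_step.prems(1) have "adj (xs @ [c]) v w \<or> adj ys v w \<or> {c, last ys} = {v, w}"
      using rot_step.hyps(2) by (simp add: adj_append_Cons adj_rev hd_rev)
    moreover have "{c, last ys} \<noteq> {v, w}"
    proof
      assume "{c, last ys} = {v, w}"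
      then have "v = c" using l rot_step.prems(2) by (metis doubleton_eq_iff)
      then have "adj (xs @ c # ys) v (hd ys)" using rot_step.hyps(2) by (simp add: adj_append_Cons)
      from IH[OF this] show False using h rot_step.prems(3) by blast
    qed
    ultimately show ?case using IH[of w] rot_step.hyps(2) by (auto simp: adj_append_Cons)
  qed
  have "nb S X \<subseteq> (\<Union>w\<in>X. {v. adj P v w})"
  proof
    fix v assume v: "v \<in> nb S X"
    then obtain Q where Q: "rotc P Q" "E (last Q) v" "v \<notin> X" by (auto simp: nb_def X_def)
    have "v \<in> set Q" using v nbP rotc_pth[OF Q(1) P] by blast
    then obtain xs ys where xy: "Q = xs @ v # ys" by (meson split_list)
    have "last Q \<in> X" using Q(1) unfolding X_def by blast
    then have ys: "ys \<noteq> []" using Q(3) xy by auto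
    have "rotc P (xs @ v # rev ys)" using rotc.rot_step[of P xs v ys] Q xy ys by simp
    then have h: "hd ys \<in> X" using ys unfolding X_def
      by (intro CollectI exI[of _ "xs @ v # rev ys"]) (simp add: last_rev)
    have "adj Q v (hd ys)" unfolding xy using ys by (simp add: adj_append_Cons)
    then have "\<exists>u. adj P v u \<and> u \<in> X" using edge[OF Q(1) _ Q(3)] h by blast
    then show "v \<in> (\<Union>w\<in>X. {v. adj P v w})" by blast
  qed
  moreover have fX: "finite X" using XP finite_subset by blast
  moreover have "distinct P" using P by (simp add: pth_def)
  ultimately have "card (nb S X) \<le> card (\<Union>w\<in>X. {v. adj P v w})"
    by (intro card_mono finite_UN_I) (auto simp: card_adj_le)
  also have "\<dots> \<le> (\<Sum>w\<in>X. card {v. adj P v w})" by (rule card_UN_le[OF fX])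
  also have "\<dots> \<le> (\<Sum>w\<in>X. 2)" using card_adj_le[OF \<open>distinct P\<close>] by (intro sum_mono) blast
  finally have "card (nb S X) \<le> 2 * card X" by simp
  moreover have "X \<noteq> {}" unfolding X_def using rot_base by blast
  ultimately show thesis using that XP nbP paths by blast
qed

section \<open>Extremal choices: longest paths, expanding subsets, small components, chords\<close>

lemma longest_path_from:
  assumes "finite S" "s \<in> S"
  obtains P where "pth S P" "hd P = s" "\<And>Q. pth S Q \<Longrightarrow> hd Q = s \<Longrightarrow> length Q \<le> length P"
proof -
  have "pth S [s] \<and> hd [s] = s" using assms by (auto simp: pth_def)
  then obtain P where P: "pth S P \<and> hd P = s" "\<And>Q. pth S Q \<and> hd Q = s \<Longrightarrow> length Q \<le> length P"
    using finite_arg_max_exists[of "\<lambda>Q. pth S Q \<and> hd Q = s" "[s]" length "card S"]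
      pth_length_le[OF _ assms(1)] by metis
  show thesis by (rule that[of P]) (use P in blast)+
qed

text \<open>Let \<open>B\<close> be a largest set of at most \<open>2 * M'\<close> vertices with few
  outer neighbours; by assumption it has fewer than \<open>M\<close>. A non-expanding
  \<open>X\<close> in the rest with at most \<open>M'\<close> vertices could be added to
  \<open>B\<close> without exceeding \<open>2 * M'\<close>, contradicting the choice of
  \<open>B\<close>.\<close>

lemma clean:
  assumes fin: "finite U" and "M \<le> M'"
    and ex: "\<forall>X. X \<subseteq> U \<longrightarrow> M \<le> card X \<longrightarrow> card X \<le> 2 * M' \<longrightarrow> D * card X < card (nb U X)"
  shows "\<exists>B. B \<subseteq> U \<and> card B < M \<and> card (nb U B) \<le> D * card B \<and>
    (\<forall>X. X \<subseteq> U - B \<longrightarrow> X \<noteq> {} \<longrightarrow> card X \<le> M' \<longrightarrow> D * card X < card (nb (U - B) X))"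
proof -
  let ?P = "\<lambda>B. B \<subseteq> U \<and> card B \<le> 2 * M' \<and> card (nb U B) \<le> D * card B"
  have "?P {}" by (simp add: nb_def)
  then obtain B where B: "?P B" and max: "\<And>C. ?P C \<Longrightarrow> card C \<le> card B"
    using finite_arg_max_exists[of ?P "{}" card "2 * M'"] by blast
  have small: "card B < M" using ex B by (meson linorder_not_le)
  have "D * card X < card (nb (U - B) X)" if X: "X \<subseteq> U - B" "X \<noteq> {}" "card X \<le> M'" for X
  proof (rule ccontr)
    assume c: "\<not> ?thesis"
    have fs: "finite B" "finite X" using fin B X(1) finite_subset by auto
    have c1: "card (B \<union> X) = card B + card X" using fs X(1) by (intro card_Un_disjoint) auto
    have "nb U (B \<union> X) \<subseteq> nb U B \<union> nb (U - B) X" by (auto simp: nb_def)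
    then have "card (nb U (B \<union> X)) \<le> card (nb U B) + card (nb (U - B) X)"
      using fin by (meson card_Un_le card_mono finite_Diff finite_UnI finite_nb le_trans)
    also have "\<dots> \<le> D * card (B \<union> X)" using c B unfolding c1 by (auto simp: algebra_simps)
    finally have "?P (B \<union> X)" using B X small assms(2) c1 by auto
    from max[OF this] have "card X = 0" using c1 by simp
    then show False using X(2) fs by simp
  qed
  then show ?thesis using B small by (intro exI[of _ B]) simp
qed

text \<open>Greedy packing: whole components are collected until a part is full. The last one
  overshoots by at most \<open>M\<close>, so each part wastes at most \<open>M\<close>
  vertices.\<close>

lemma sep_small_components:
  assumes "finite Y" "\<And>v. v \<in> Y \<Longrightarrow> card (reach Y v) \<le> M" "sum_list L + length L * M \<le> card Y"
  shows "sep Y L"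
  using assms
proof (induction L arbitrary: Y)
  case (Cons m L)
  \<comment> \<open>\<open>?cl Z\<close> says that \<open>Z\<close> is a union of components of
    \<open>Y\<close>.\<close>
  let ?cl = "\<lambda>Z. Z \<subseteq> Y \<and> cnb Y Z \<subseteq> Z"
  let ?P = "\<lambda>Z. ?cl Z \<and> card Z \<le> m + M"
  have "?P {}" by (auto simp: cnb_def)
  then obtain Z where Z: "?P Z" and max: "\<And>C. ?P C \<Longrightarrow> card C \<le> card Z"
    using finite_arg_max_exists[of ?P "{}" card "m + M"] by blast
  have fZ: "finite Z" using Z Cons.prems(1) finite_subset by blast
  have mZ: "m \<le> card Z"
  proof (rule ccontr)
    assume lt: "\<not> m \<le> card Z"
    have "Z \<noteq> Y" using lt Cons.prems(3) by auto
    then obtain v where v: "v \<in> Y" "v \<notin> Z" using Z by blast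
    let ?C = "reach Y v"
    have cl: "cnb Y ?C \<subseteq> ?C" by (auto simp: cnb_def intro: reach_trans_edge)
    have "?cl (Z \<union> ?C)" using Z cl reach_subset[of Y v] unfolding cnb_Un by blast
    moreover have "card (Z \<union> ?C) \<le> m + M"
      using card_Un_le[of Z ?C] lt Cons.prems(2)[OF v(1)] by linarith
    ultimately have le: "card (Z \<union> ?C) \<le> card Z" using max by blast
    have "finite ?C" using reach_subset Cons.prems(1) finite_subset by metis
    then have "Z \<union> ?C = Z" using le fZ by (metis card_seteq finite_UnI Un_upper1)
    then show False using v reach_self by blast
  qed
  have sub: "reach (Y - Z) v \<subseteq> reach Y v" for v
    unfolding reach_def using pth_mono[of "Y - Z" _ Y] by blast
  have "sep (Y - Z) L"
  proof (rule Cons.IH)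
    fix v assume v: "v \<in> Y - Z"
    have "finite (reach Y v)" using reach_subset Cons.prems(1) finite_subset by metis
    then show "card (reach (Y - Z) v) \<le> M"
      using card_mono[OF _ sub[of v]] Cons.prems(2)[of v] v by fastforce
  next
    show "sum_list L + length L * M \<le> card (Y - Z)"
      using Z fZ Cons.prems(3) by (auto simp: card_Diff_subset)
  qed (use Cons.prems in auto)
  then show ?case
    by (rule sep_Cons_I[of Z, rotated 3]) (use Z fZ mZ in \<open>auto simp: cnb_def\<close>)
qed simp

lemma edge_in_large_set:
  assumes "\<not> sep V L" "S \<subseteq> V" "finite S" "sum_list L \<le> card S"
  obtains u v where "u \<in> S" "v \<in> S" "E u v"
  using sep_independent[OF assms(3) _ assms(4)] assms(1,2) sep_mono by blast

text \<open>The first \<open>sum_list L\<close> vertices at even positions span an edge, since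
  otherwise they could be split into separated parts. The chord skips an odd number of vertices
  because both its ends sit at even positions.\<close>

lemma shorten_path:
  assumes nosep: "\<not> sep V L" and R: "pth V R" and len: "2 * sum_list L \<le> length R"
  obtains R' where "pth (set R) R'" "hd R' = hd R" "last R' = last R" "length R' < length R"
    "length R \<le> length R' + 2 * sum_list L" "odd (length R - length R')"
proof -
  let ?m = "sum_list L"
  have dist: "distinct R" using R by (simp add: pth_def)
  let ?S = "(\<lambda>i. R ! (2 * i)) ` {..<?m}"
  have inj: "inj_on (\<lambda>i. R ! (2 * i)) {..<?m}"
    using dist len by (auto simp: inj_on_def nth_eq_iff_index_eq)
  have "?S \<subseteq> V" using R len by (auto simp: pth_def)
  moreover have "?m \<le> card ?S" using inj by (simp add: card_image)
  ultimately obtain u v where uv: "u \<in> ?S" "v \<in> ?S" "E u v"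
    using edge_in_large_set[OF nosep, of ?S] by blast
  then obtain a b where ab: "a < ?m" "b < ?m" "u = R ! (2 * a)" "v = R ! (2 * b)" by auto
  obtain i j where ij: "i < j" "j < ?m" "E (R ! (2 * i)) (R ! (2 * j))"
  proof (cases "a < b")
    case False
    then have "b < a" using uv(3) ab E_irrefl by (metis linorder_neqE_nat)
    then show thesis using that ab uv(3) E_sym by blast
  qed (use that ab uv in blast)
  let ?R' = "take (Suc (2 * i)) R @ drop (2 * j) R"
  have l: "2 * j < length R" using ij len by simp
  have s: "successively E R" using R by (simp add: pth_def)
  have "successively E (take (Suc (2 * i)) R)" "successively E (drop (2 * j) R)"
    using s by (auto simp: successively_conv_nth)
  moreover have "last (take (Suc (2 * i)) R) = R ! (2 * i)"
    using l ij(1) by (subst last_conv_nth) (auto simp: min_def)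
  moreover have "hd (drop (2 * j) R) = R ! (2 * j)" using l by (simp add: hd_drop_conv_nth)
  ultimately have "successively E ?R'" using ij(3) by (auto simp: successively_append_iff)
  moreover have "distinct ?R'"
    using dist ij(1) set_take_disj_set_drop_if_distinct[OF dist, of "Suc (2 * i)" "2 * j"] by auto
  ultimately have "pth (set R) ?R'"
    using l by (auto simp: pth_def dest: in_set_takeD in_set_dropD)
  moreover have "hd ?R' = hd R" using l by (cases R) auto
  moreover have "last ?R' = last R" using l by simp
  moreover have "length R - length ?R' = 2 * (j - i - 1) + 1" "length ?R' < length R"
    using l ij(1) by auto
  ultimately show thesis using that[of ?R'] ij by (auto simp del: length_append)
qed

text \<open>Chords are applied until the length is at most \<open>q\<close>. If it then differs from
  \<open>q\<close> by an odd number, one more odd step repairs the parity; hence the loss of at most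
  two steps of \<open>2 * sum_list L\<close>. Parity matters because the chain corrects lengths only
  by even amounts.\<close>

lemma shorten_path_even:
  assumes nosep: "\<not> sep V L" and R: "pth V R" and len: "4 * sum_list L \<le> q" "q \<le> length R"
  obtains R' where "pth (set R) R'" "hd R' = hd R" "last R' = last R" "length R' \<le> q"
    "q \<le> length R' + 4 * sum_list L" "even (q - length R')"
proof -
  let ?m = "sum_list L"
  have "\<exists>R'. pth (set R) R' \<and> hd R' = hd R \<and> last R' = last R \<and> length R' \<le> q \<and>
      q \<le> length R' + 4 * ?m \<and> even (q - length R')"
    using R len(2)
  proof (induction "length R" arbitrary: R rule: less_induct)
    case less
    show ?case
    proof (cases "length R = q")
      case True
      then show ?thesis using less.prems by (intro exI[of _ R]) (auto simp: pth_def)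
    next
      case False
      obtain R1 where R1: "pth (set R) R1" "hd R1 = hd R" "last R1 = last R" "length R1 < length R"
        "length R \<le> length R1 + 2 * ?m" "odd (length R - length R1)"
        using shorten_path[OF nosep less.prems(1)] less.prems(2) len(1) by auto
      have R1V: "pth V R1" using R1(1) less.prems(1) pth_mono unfolding pth_def by blast
      have sub: "set R1 \<subseteq> set R" using R1(1) by (simp add: pth_def)
      consider "q \<le> length R1" | "length R1 < q" "even (q - length R1)"
        | "length R1 < q" "odd (q - length R1)" by linarith
      then show ?thesis
      proof cases
        case 1
        from less.hyps[OF R1(4) R1V 1] show ?thesis
          using R1(2,3) pth_mono[OF _ sub] by metis
      next
        case 2
        then show ?thesis using R1 less.prems by (intro exI[of _ R1]) auto
      next
        case 3
        have "2 * ?m \<le> length R1" using R1(5) less.prems(2) len(1) by linarith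
        then obtain R2 where R2: "pth (set R1) R2" "hd R2 = hd R1" "last R2 = last R1"
          "length R2 < length R1" "length R1 \<le> length R2 + 2 * ?m" "odd (length R1 - length R2)"
          using shorten_path[OF nosep R1V] by metis
        have "q - length R2 = (q - length R1) + (length R1 - length R2)" using 3 R2 by simp
        then have "even (q - length R2)" using 3 R2(6) by simp
        then show ?thesis using R1 R2 3 less.prems pth_mono[OF R2(1) sub]
          by (intro exI[of _ R2]) auto
      qed
    qed
  qed
  then show thesis using that by blast
qed

end

lemma distinct_insert_rev:
  assumes "distinct (as @ bs @ cs)" "distinct zs" "set zs \<inter> (set as \<union> (set bs \<union> set cs)) = {}"
  shows "distinct (as @ zs @ rev bs @ cs)"
  using assms by auto

context sgraph begin

text \<open>The argument of Chvatal and Erdos: the successors, along a longest path, of the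
  neighbours of a component of the rest form an independent set.\<close>
lemma longest_path_component_nb:
  assumes nosep: "\<not> sep V L" and "A \<subseteq> V"
    and R: "pth A R" and longest: "\<And>Q. pth A Q \<Longrightarrow> hd Q = hd R \<Longrightarrow> last Q = last R \<Longrightarrow> length Q \<le> length R"
  shows "card (nb (set R) (reach (A - set R) v)) \<le> sum_list L"
proof -
  let ?Y = "A - set R"
  let ?Z = "reach ?Y v"
  let ?N = "nb (set R) ?Z"
  define I where "I = {i. Suc i < length R \<and> R ! i \<in> ?N}"
  have dist: "distinct R" and ne: "R \<noteq> []" and sE: "successively E R" using R by (auto simp: pth_def)
  let ?S = "(\<lambda>i. R ! Suc i) ` I"
  have finI: "finite I" unfolding I_def by (rule finite_subset[of _ "{..<length R}"]) auto
  have noedge: "\<not> E (R ! Suc i) (R ! Suc j)" if "i \<in> I" "j \<in> I" "i < j" for i j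
  proof
    assume e: "E (R ! Suc i) (R ! Suc j)"
    let ?as = "take (Suc i) R" and ?bs = "drop (Suc i) (take (Suc j) R)" and ?cs = "drop (Suc j) R"
    note iI = that(1,2)
    have j: "Suc j < length R" using that by (auto simp: I_def)
    have R3: "R = ?as @ ?bs @ ?cs"
    proof -
      have "take (Suc i) (take (Suc j) R) @ ?bs = take (Suc j) R" by (rule append_take_drop_id)
      then have "?as @ ?bs = take (Suc j) R" using that(3) by (simp add: min_def)
      then show ?thesis using append_take_drop_id[of "Suc j" R] by (metis append.assoc)
    qed
    have nes: "?as \<noteq> []" "?bs \<noteq> []" "?cs \<noteq> []" using j that(3) by auto
    have ends: "last ?as = R ! i" "hd ?bs = R ! Suc i" "last ?bs = R ! j" "hd ?cs = R ! Suc j"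
      using j that(3) nes by (auto simp: last_conv_nth hd_conv_nth min_def)
    obtain z1 z2 where z: "z1 \<in> ?Z" "E z1 (R ! i)" "z2 \<in> ?Z" "E z2 (R ! j)"
      using iI by (auto simp: I_def nb_def)
    obtain zs where zs: "pth ?Z zs" "hd zs = z1" "last zs = z2" using reach_path[OF z(1,3)] by blast
    have zsY: "set zs \<subseteq> ?Y" using zs(1) reach_subset[of ?Y v] by (auto simp: pth_def)
    \<comment> \<open>Leave \<open>R\<close> at \<open>R ! i\<close>, pass through the component to
      \<open>R ! j\<close>, run backwards along \<open>?bs\<close>, and take the assumed edge
      between the two successors. Both ends are kept and \<open>length zs\<close> vertices are
      gained.\<close>
    let ?Q = "?as @ zs @ rev ?bs @ ?cs"
    have sas: "successively E ?as" "successively E ?bs" "successively E ?cs"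
      using sE by (auto intro: successively_take successively_drop)
    have "successively E ?Q"
      using sas zs nes ends z e E_sym
      by (auto simp: successively_append_iff pth_def hd_append hd_rev last_rev simp del: successively_rev)
    moreover have "distinct ?Q"
    proof (rule distinct_insert_rev)
      show "distinct (?as @ ?bs @ ?cs)" using dist R3 by metis
      have "set ?as \<union> (set ?bs \<union> set ?cs) = set R" using R3 by (metis set_append)
      then show "set zs \<inter> (set ?as \<union> (set ?bs \<union> set ?cs)) = {}" using zsY by blast
    qed (use zs(1) in \<open>simp add: pth_def\<close>)
    moreover have "set ?Q \<subseteq> A" using R zsY by (auto simp: pth_def dest: in_set_takeD in_set_dropD)
    moreover have "hd ?Q = hd R" using nes ne by (cases R) auto
    moreover have "last ?Q = last R" using nes(3) j by simp
    ultimately have "length ?Q \<le> length R" using nes by (intro longest) (auto simp: pth_def)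
    moreover have "length ?Q = length R + length zs" using arg_cong[OF R3, of length] by simp
    ultimately have "length zs = 0" by linarith
    then show False using zs(1) by (simp add: pth_def)
  qed
  have ind: "\<not> E u w" if "u \<in> ?S" "w \<in> ?S" for u w
  proof -
    from that obtain i j where ij: "i \<in> I" "j \<in> I" "u = R ! Suc i" "w = R ! Suc j" by blast
    then show ?thesis using noedge[of i j] noedge[of j i] E_sym E_irrefl by (metis linorder_neqE_nat)
  qed
  have "?S \<subseteq> set R" by (auto simp: I_def)
  then have "?S \<subseteq> V" using R assms(2) by (auto simp: pth_def)
  then have "card ?S < sum_list L"
  proof (rule_tac ccontr)
    assume "?S \<subseteq> V" "\<not> card ?S < sum_list L"
    then obtain u w where "u \<in> ?S" "w \<in> ?S" "E u w"
      using edge_in_large_set[OF nosep, of ?S] finI by (metis finite_imageI linorder_not_le)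
    then show False using ind by blast
  qed
  moreover have "card ?S = card I"
    by (intro card_image) (use dist in \<open>auto simp: inj_on_def I_def nth_eq_iff_index_eq\<close>)
  \<comment> \<open>Only \<open>last R\<close> has no successor; the strict bound on
    \<open>card ?S\<close> absorbs this one extra neighbour.\<close>
  moreover have "?N \<subseteq> (!) R ` I \<union> {last R}"
  proof
    fix u assume u: "u \<in> ?N"
    then obtain i where i: "i < length R" "R ! i = u" using nb_subset by (metis in_set_conv_nth subsetD)
    show "u \<in> (!) R ` I \<union> {last R}"
    proof (cases "Suc i < length R")
      case True
      then show ?thesis using i u by (auto simp: I_def)
    next
      case False
      then have "i = length R - 1" using i by simp
      then show ?thesis using i ne by (simp add: last_conv_nth)
    qed
  qed
  then have "card ?N \<le> card ((!) R ` I \<union> {last R})" using finI by (intro card_mono) auto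
  moreover have "card ((!) R ` I \<union> {last R}) \<le> card I + 1"
    using card_Un_le[of "(!) R ` I" "{last R}"] card_image_le[OF finI, of "(!) R"] by simp
  ultimately show ?thesis by linarith
qed

section \<open>Linking vertices by growing balls\<close>

fun ball :: "'a set \<Rightarrow> 'a \<Rightarrow> nat \<Rightarrow> 'a set" where
  "ball U u 0 = {u}"
| "ball U u (Suc j) = cnb U (ball U u j)"

lemma ball_subset: "u \<in> U \<Longrightarrow> ball U u j \<subseteq> U"
  by (induction j) (auto simp: cnb_def)

lemma ball_path:
  assumes "u \<in> U" "v \<in> ball U u j"
  shows "\<exists>xs. pth U xs \<and> hd xs = u \<and> last xs = v \<and> length xs \<le> Suc j"
  using assms(2)
proof (induction j arbitrary: v)
  case 0
  then show ?case using assms(1) by (intro exI[of _ "[u]"]) (auto simp: pth_def)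
next
  case (Suc j)
  then consider "v \<in> ball U u j" | w where "w \<in> ball U u j" "E w v" "v \<in> U" by (auto simp: cnb_def)
  then show ?case
  proof cases
    case 1
    then show ?thesis using Suc.IH le_SucI by blast
  next
    case 2
    then obtain xs where xs: "pth U xs" "hd xs = u" "last xs = w" "length xs \<le> Suc j"
      using Suc.IH by blast
    have "pth U [v]" using 2 by (simp add: pth_def)
    from walk_join[OF xs(1) this] obtain zs where "pth U zs" "hd zs = hd xs" "last zs = v"
      "length zs \<le> length xs + 1" using 2 xs by auto
    then show ?thesis using xs by (intro exI[of _ zs]) auto
  qed
qed

text \<open>Below the threshold \<open>M\<close> every step at least doubles the ball, because the
  new vertices are at least as many as the old ones.\<close>

lemma card_ball:
  assumes "finite U" "u \<in> U"
    and ex: "\<And>X. X \<subseteq> U \<Longrightarrow> X \<noteq> {} \<Longrightarrow> card X < M \<Longrightarrow> card X \<le> card (nb U X)"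
  shows "min (2 ^ j) M \<le> card (ball U u j)"
proof (induction j)
  case (Suc j)
  let ?B = "ball U u j"
  have sub: "?B \<subseteq> U" using ball_subset assms(2) .
  have c: "card (cnb U ?B) = card ?B + card (nb U ?B)" by (rule card_cnb[OF assms(1) sub])
  have ne: "?B \<noteq> {}"
  proof (induction j)
    case (Suc j)
    then show ?case using ball_subset[OF assms(2), of j] by (auto simp: cnb_def)
  qed simp
  show ?case
  proof (cases "card ?B < M")
    case True
    then have "card ?B \<le> card (nb U ?B)" using ex[OF sub ne] by blast
    moreover have "2 ^ j \<le> card ?B" using Suc True by simp
    ultimately have "2 ^ Suc j \<le> card (ball U u (Suc j))" using c by simp
    then show ?thesis by linarith
  next
    case False
    then show ?thesis using c by simp
  qed
qed simp

text \<open>Balls of radius \<open>r\<close> around vertices of \<open>K\<close> have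
  \<open>M\<close> vertices, and one further step brings them to \<open>sum_list L\<close>. If
  \<open>length L\<close> such balls were pairwise disjoint and non-adjacent they would be separated
  parts of the forbidden sizes; so two of them touch, which yields the short path.\<close>

lemma short_link:
  assumes nosep: "\<not> sep V L" and "U \<subseteq> V" "finite V" and K: "K \<subseteq> U" "length L \<le> card K"
    and ex: "\<And>X. X \<subseteq> U \<Longrightarrow> X \<noteq> {} \<Longrightarrow> card X < M \<Longrightarrow> card X \<le> card (nb U X)"
    and big: "\<And>X. X \<subseteq> U \<Longrightarrow> M \<le> card X \<Longrightarrow> sum_list L \<le> card (cnb U X)"
    and "M \<le> 2 ^ r"
  obtains xs where "pth U xs" "hd xs \<in> K" "last xs \<in> K" "hd xs \<noteq> last xs" "length xs \<le> 2 * r + 4"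
proof -
  have fU: "finite U" using assms finite_subset by blast
  obtain ks where ks: "set ks = K" "distinct ks"
    using K(1) fU finite_distinct_list finite_subset by metis
  have lks: "length L \<le> length ks" using ks K(2) by (metis distinct_card)
  define B where "B i = ball U (ks ! i) (Suc r)" for i
  have kU: "ks ! i \<in> U" if "i < length L" for i
    using ks(1) K(1) lks that by (metis nth_mem order_less_le_trans subsetD)
  have size: "L ! i \<le> card (B i)" if "i < length L" for i
  proof -
    have "M \<le> card (ball U (ks ! i) r)" using card_ball[OF fU kU[OF that] ex, of M r] assms(8) by simp
    then have "sum_list L \<le> card (B i)" unfolding B_def using big ball_subset[OF kU[OF that]] by simp
    moreover have "L ! i \<le> sum_list L" using that by (simp add: elem_le_sum_list)
    ultimately show ?thesis by simp
  qed
  have subB: "B i \<subseteq> U" if "i < length L" for i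
    unfolding B_def using ball_subset kU[OF that] .
  have "\<not> (\<forall>i j. i < length L \<longrightarrow> j < length L \<longrightarrow> i \<noteq> j \<longrightarrow> B j \<inter> cnb U (B i) = {})"
  proof
    assume *: "\<forall>i j. i < length L \<longrightarrow> j < length L \<longrightarrow> i \<noteq> j \<longrightarrow> B j \<inter> cnb U (B i) = {}"
    have "sep U L"
    proof (rule sep_disjoint_family[where B = B])
      fix i assume "i < length L"
      then show "B i \<subseteq> U \<and> finite (B i) \<and> L ! i \<le> card (B i)"
        using subB[of i] size[of i] finite_subset[OF _ fU] by simp
    qed (simp add: *)
    then show False using nosep sep_mono assms(2) by blast
  qed
  then obtain i j where ij: "i < length L" "j < length L" "i \<noteq> j" "B j \<inter> cnb U (B i) \<noteq> {}" by blast
  then obtain w where w: "w \<in> B j" "w \<in> cnb U (B i)" by blast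
  then obtain w' where w': "w' \<in> B i" "w' = w \<or> E w' w" by (auto simp: cnb_def)
  obtain xs where xs: "pth U xs" "hd xs = ks ! i" "last xs = w'" "length xs \<le> Suc (Suc r)"
    using ball_path[OF kU[OF ij(1)]] w'(1) unfolding B_def by blast
  obtain ys where ys: "pth U ys" "hd ys = ks ! j" "last ys = w" "length ys \<le> Suc (Suc r)"
    using ball_path[OF kU[OF ij(2)]] w(1) unfolding B_def by blast
  have ry: "pth U (rev ys)" "hd (rev ys) = w" "last (rev ys) = ks ! j"
    using ys unfolding pth_rev by (auto simp: pth_def hd_rev last_rev)
  obtain zs where zs: "pth U zs" "hd zs = hd xs" "last zs = last (rev ys)"
    "length zs \<le> length xs + length (rev ys)"
    using walk_join[OF xs(1) ry(1)] w'(2) xs(3) ry(2) by metis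
  have "ks ! i \<in> K" "ks ! j \<in> K" "ks ! i \<noteq> ks ! j"
    using ij lks ks by (auto simp: nth_eq_iff_index_eq)
  then show thesis using that[of zs] zs xs ys ry by simp
qed

end

section \<open>Adjusting path lengths\<close>

fun subset_sums :: "nat list \<Rightarrow> nat set" where
  "subset_sums [] = {0}"
| "subset_sums (d # ds) = subset_sums ds \<union> (+) d ` subset_sums ds"

lemma subset_sums_two:
  assumes "a \<noteq> b" "i \<le> count_list ds a" "j \<le> count_list ds b"
  shows "i * a + j * b \<in> subset_sums ds"
  using assms(2,3)
proof (induction ds arbitrary: i j)
  case (Cons d ds)
  show ?case
  proof (cases "d = a \<and> 0 < i")
    case True
    then obtain i' where i': "i = Suc i'" using gr0_conv_Suc by blast
    have "i' * a + j * b \<in> subset_sums ds" using Cons True assms(1) i' by auto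
    then have "d + (i' * a + j * b) \<in> subset_sums (d # ds)" by auto
    then show ?thesis using True i' by (simp add: algebra_simps)
  next
    case F: False
    show ?thesis
    proof (cases "d = b \<and> 0 < j")
      case True
      then obtain j' where j': "j = Suc j'" using gr0_conv_Suc by blast
      have "i * a + j' * b \<in> subset_sums ds" using Cons True assms(1) j' by auto
      then have "d + (i * a + j' * b) \<in> subset_sums (d # ds)" by auto
      then show ?thesis using True j' by (simp add: algebra_simps)
    next
      case False
      then have "i \<le> count_list ds a" "j \<le> count_list ds b"
        using F Cons.prems by (auto split: if_splits)
      then show ?thesis using Cons.IH by auto
    qed
  qed
qed auto

text \<open>An arithmetic progression of difference \<open>c\<close> and span \<open>l\<close>
  inside \<open>S\<close>, with unspecified start. Differences 1 and 2 are the ones that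
  occur.\<close>

definition has_ap :: "nat set \<Rightarrow> nat \<Rightarrow> nat \<Rightarrow> bool" where
  "has_ap S c l \<longleftrightarrow> (\<exists>a. \<forall>t\<le>l. c dvd t \<longrightarrow> a + t \<in> S)"

lemma has_ap_mono: "has_ap S c l \<Longrightarrow> l' \<le> l \<Longrightarrow> c dvd c' \<Longrightarrow> has_ap S c' l'"
  unfolding has_ap_def by (meson dvd_trans le_trans)

text \<open>A progression and its translate by \<open>d\<close> merge into a longer one;
  \<open>d \<le> l + 1\<close> guarantees that no gap opens between them.\<close>

lemma has_ap_shift:
  assumes "has_ap S c l" "\<And>v. v \<in> S \<Longrightarrow> v + e \<in> S' \<and> v + e + d \<in> S'" "c dvd d" "d \<le> l + 1"
  shows "has_ap S' c (l + d)"
proof -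
  obtain a where a: "\<And>t. t \<le> l \<Longrightarrow> c dvd t \<Longrightarrow> a + t \<in> S" using assms(1) by (auto simp: has_ap_def)
  have "a + e + t \<in> S'" if "t \<le> l + d" "c dvd t" for t
  proof (cases "t \<le> l")
    case True
    then show ?thesis using a[OF True that(2)] assms(2)[of "a + t"] by (simp add: add_ac)
  next
    case False
    then have "d \<le> t" using assms(4) by simp
    then have "a + (t - d) \<in> S" using a[of "t - d"] that assms(3) by (auto simp: dvd_diff_nat)
    then have "a + (t - d) + e + d \<in> S'" using assms(2) by blast
    then show ?thesis using \<open>d \<le> t\<close> by (simp add: add_ac)
  qed
  then show ?thesis unfolding has_ap_def by blast
qed

text \<open>A translate by an odd amount supplies the missing parity on the overlap, at the price of
  \<open>d\<close> in span. For \<open>d > l\<close> the span truncates to 0 and one element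
  suffices.\<close>

lemma has_ap_shift_odd:
  assumes "has_ap S 2 l" "\<And>v. v \<in> S \<Longrightarrow> v + e \<in> S' \<and> v + e + d \<in> S'" "odd d"
  shows "has_ap S' 1 (l - d)"
proof (cases "d \<le> l")
  case False
  obtain a where "a \<in> S" using assms(1) unfolding has_ap_def by (metis dvd_0_right zero_le)
  then show ?thesis using False assms(2)[of a] by (auto simp: has_ap_def)
next
  case True
  obtain a where a: "\<And>t. t \<le> l \<Longrightarrow> even t \<Longrightarrow> a + t \<in> S" using assms(1) by (auto simp: has_ap_def)
  have "a + e + d + t \<in> S'" if "t \<le> l - d" for t
  proof (cases "even t")
    case T: True
    then have "a + t + e + d \<in> S'" using assms(2) a[of t] that by auto
    then show ?thesis by (simp add: add_ac)
  next
    case F: False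
    then have "a + (d + t) + e \<in> S'" using assms(2,3) a[of "d + t"] that True by auto
    then show ?thesis by (simp add: add_ac)
  qed
  then show ?thesis unfolding has_ap_def by blast
qed

text \<open>Used with \<open>J\<close> the bad exits of a short cycle, which \<open>gadget\<close>
  keeps below one in 18.\<close>

lemma small_index_not_in:
  fixes J :: "nat set"
  assumes "finite J" "18 * card J < p"
  obtains i where "i \<notin> J" "18 * i \<le> p"
proof -
  have "\<not> {..p div 18} \<subseteq> J"
  proof
    assume "{..p div 18} \<subseteq> J"
    then have "card {..p div 18} \<le> card J" by (rule card_mono[OF assms(1)])
    then have "p div 18 + 1 \<le> card J" by simp
    then show False using assms(2) by linarith
  qed
  then obtain i where "i \<notin> J" "i \<le> p div 18" by auto
  then show thesis using that[of i] by linarith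
qed

text \<open>Halving the indices groups them into pairs \<open>2 * j\<close>,
  \<open>2 * j + 1\<close>; a half-index not hit by \<open>J\<close> gives two consecutive free
  indices.\<close>

lemma small_pair_not_in:
  fixes J :: "nat set"
  assumes "finite J" "18 * card J < p"
  obtains i where "i \<notin> J" "Suc i \<notin> J" "9 * i \<le> p"
proof -
  let ?J = "(\<lambda>x. x div 2) ` J"
  have "card ?J \<le> card J" using assms(1) by (rule card_image_le)
  then obtain j where j: "j \<notin> ?J" "18 * j \<le> p"
    using small_index_not_in[of ?J p] assms by auto
  have "2 * j \<notin> J" using j(1) by (metis image_eqI nonzero_mult_div_cancel_left zero_neq_numeral)
  moreover have "Suc (2 * j) \<notin> J" using j(1) by (force simp: image_iff)
  ultimately show thesis using that[of "2 * j"] j(2) by simp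
qed

text \<open>\<open>L\<close> lists the part sizes that cannot be separated, and sets of at least
  \<open>M\<close> vertices have closed neighbourhoods of at least \<open>g\<close> vertices.
  \<open>b\<close> bounds how many vertices the construction may use up, and \<open>r\<close> is a
  binary logarithm of \<open>M\<close> from above.\<close>

locale cluster = sgraph E for E :: "'a \<Rightarrow> 'a \<Rightarrow> bool" +
  fixes A :: "'a set" and L :: "nat list" and M r b g :: nat
  assumes finA: "finite A" and nosep: "\<not> sep A L"
    and M1: "1 \<le> M" and k2: "2 \<le> length L" and Mr: "M \<le> 2 ^ r"
    and expand: "\<And>X. X \<subseteq> A \<Longrightarrow> M \<le> card X \<Longrightarrow> g \<le> card (cnb A X)"
    and budget: "b + 4 * (10 * length L) * (2 * M + (2 * r + 4)) < g"
    and budget2: "sum_list L + b + M \<le> g"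
    and gA: "g \<le> card A"
begin

text \<open>\<open>lam\<close> is the length bound of \<open>short_link\<close>. \<open>Mp\<close>
  leaves room for one such path together with a poorly expanding set of fewer than \<open>M\<close>
  vertices. The factor 10 in \<open>D\<close> leaves \<open>9 * k\<close> after \<open>k\<close> is
  lost to vertices of low degree in \<open>inv_remove\<close>.\<close>

definition "lam = 2 * r + 4"
definition "Mp = 2 * M + lam"
abbreviation "k \<equiv> length L"
abbreviation "D \<equiv> 10 * length L"

lemma budget': "b + 4 * D * Mp < g"
  using budget by (simp add: Mp_def lam_def)

text \<open>\<open>W\<close> is used up, \<open>U\<close> is the clean part where small sets expand,
  and the discarded rest \<open>A - W - U\<close> is recorded as expanding badly. That record is
  what keeps the rest below \<open>M\<close> vertices through repeated cleaning.\<close>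

definition inv :: "'a set \<Rightarrow> 'a set \<Rightarrow> bool" where
  "inv W U \<longleftrightarrow> W \<subseteq> A \<and> U \<subseteq> A - W \<and> card (A - W - U) < M \<and>
     card (nb (A - W) (A - W - U)) \<le> D * card (A - W - U) \<and>
     (\<forall>X\<subseteq>U. X \<noteq> {} \<longrightarrow> card X \<le> Mp \<longrightarrow> D * card X < card (nb U X))"

lemma inv_finite: "inv W U \<Longrightarrow> finite W \<and> finite U"
  unfolding inv_def by (meson finA finite_Diff finite_subset)

lemma nb_lower:
  assumes "X \<subseteq> U" "U \<subseteq> A" "M \<le> card X" "card (A - U) \<le> c"
  shows "g \<le> card (cnb U X) + c"
proof -
  have "cnb A X \<subseteq> cnb U X \<union> (A - U)" by (auto simp: cnb_def)
  then have "card (cnb A X) \<le> card (cnb U X) + card (A - U)"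
    using finA assms(2) by (meson card_Un_le card_mono finite_Diff finite_UnI finite_cnb finite_subset le_trans)
  moreover have "g \<le> card (cnb A X)" using assms by (intro expand) auto
  ultimately show ?thesis using assms(4) by linarith
qed

lemma DM: "D * M + D * M \<le> D * Mp" "20 * Mp \<le> D * Mp" "M \<le> Mp"
proof -
  show "D * M + D * M \<le> D * Mp" unfolding Mp_def by (simp add: algebra_simps)
  show "20 * Mp \<le> D * Mp" using k2 by (intro mult_le_mono1) simp
  show "M \<le> Mp" by (simp add: Mp_def)
qed

lemma inv_init: obtains U where "inv {} U"
proof -
  have small: "D * card X < card (nb A X)" if X: "X \<subseteq> A" "M \<le> card X" "card X \<le> 2 * Mp" for X
  proof -
    have "D * card X \<le> D * (2 * Mp)" using X(3) by (rule mult_le_mono2)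
    moreover have "g \<le> card X + card (nb A X)" using expand[OF X(1,2)] card_cnb[OF finA X(1)] by simp
    ultimately show ?thesis using budget' DM(2) X(3) by linarith
  qed
  obtain B where
    B: "B \<subseteq> A" "card B < M" "card (nb A B) \<le> D * card B"
    "\<forall>X. X \<subseteq> A - B \<longrightarrow> X \<noteq> {} \<longrightarrow> card X \<le> Mp \<longrightarrow> D * card X < card (nb (A - B) X)"
    using clean[OF finA DM(3), of D] small by auto
  have "A - (A - B) = B" using B(1) by blast
  then have "inv {} (A - B)" using B M1 unfolding inv_def by auto
  then show thesis using that by blast
qed

definition deg :: "'a set \<Rightarrow> 'a \<Rightarrow> nat" where
  "deg U z = card {u \<in> U. E z u}"

text \<open>After using \<open>Z\<close>, the rest of \<open>U\<close> is cleaned again and a set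
  \<open>B\<close> is discarded. If too many vertices of \<open>Z\<close> had few neighbours in
  \<open>U'\<close>, these vertices together with \<open>B\<close> would violate the expansion that
  held in \<open>U\<close>.\<close>

lemma inv_remove:
  assumes inv: "inv W U" and Z: "Z \<subseteq> U" "Z \<noteq> {}" "card Z + M \<le> Mp" and "card (W \<union> Z) \<le> b"
  obtains U' where "U' \<subseteq> U - Z" "inv (W \<union> Z) U'" "9 * k * card {z \<in> Z. deg U' z < k} < card Z"
proof -
  have U: "W \<subseteq> A" "U \<subseteq> A - W" "card (A - W - U) < M"
     "card (nb (A - W) (A - W - U)) \<le> D * card (A - W - U)"
     "\<And>X. X \<subseteq> U \<Longrightarrow> X \<noteq> {} \<Longrightarrow> card X \<le> Mp \<Longrightarrow> D * card X < card (nb U X)"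
    using inv unfolding inv_def by auto
  let ?B0 = "A - W - U"
  have fin: "finite U" "finite W" "finite Z" using inv_finite[OF inv] Z finite_subset by auto
  have fZ0: "0 < card Z" using Z(2) fin by (simp add: card_gt_0_iff)
  have small: "D * card X < card (nb (U - Z) X)" if X: "X \<subseteq> U - Z" "M \<le> card X" "card X \<le> 2 * Mp" for X
  proof -
    have "A - (U - Z) = (W \<union> Z) \<union> ?B0" using U Z by blast
    then have "card (A - (U - Z)) \<le> b + M"
      using card_Un_le[of "W \<union> Z" ?B0] assms(5) U(3) by simp
    from nb_lower[OF X(1) _ X(2) this] have "g \<le> card (cnb (U - Z) X) + (b + M)" using U by blast
    moreover have "card (cnb (U - Z) X) = card X + card (nb (U - Z) X)"
      using card_cnb[OF _ X(1)] fin by simp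
    moreover have "D * card X \<le> D * (2 * Mp)" using X(3) by (rule mult_le_mono2)
    ultimately show ?thesis using budget' DM X(3) by linarith
  qed
  have fUZ: "finite (U - Z)" using fin by simp
  obtain B where
    B: "B \<subseteq> U - Z" "card B < M" "card (nb (U - Z) B) \<le> D * card B"
    "\<forall>X. X \<subseteq> U - Z - B \<longrightarrow> X \<noteq> {} \<longrightarrow> card X \<le> Mp \<longrightarrow> D * card X < card (nb (U - Z - B) X)"
    using clean[OF fUZ DM(3), of D] small by auto
  note cB = B(2)
  have fB: "finite B" using B(1) fin finite_subset by blast
  let ?U' = "U - Z - B"
  have eq: "A - (W \<union> Z) - ?U' = ?B0 \<union> B" using U B(1) Z by blast
  have cU: "card (?B0 \<union> B) = card ?B0 + card B"
    using finA fB B(1) by (intro card_Un_disjoint) auto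
  have "nb (A - (W \<union> Z)) (?B0 \<union> B) \<subseteq> nb (A - W) ?B0 \<union> nb (U - Z) B" by (auto simp: nb_def)
  then have "card (nb (A - (W \<union> Z)) (?B0 \<union> B)) \<le> card (nb (A - W) ?B0 \<union> nb (U - Z) B)"
    using finA fin by (intro card_mono) auto
  also have "\<dots> \<le> card (nb (A - W) ?B0) + card (nb (U - Z) B)" by (rule card_Un_le)
  finally have nbB: "card (nb (A - (W \<union> Z)) (?B0 \<union> B)) \<le> D * card (?B0 \<union> B)"
    using U(4) B(3) cU by (simp add: distrib_left)
  \<comment> \<open>Both discarded sets have fewer than \<open>M\<close> vertices, so their union
    has fewer than \<open>2 * M\<close>. If it reached \<open>M\<close> it would need almost
    \<open>g\<close> closed neighbours, far more than its bad expansion permits.\<close>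
  have "card (?B0 \<union> B) < M"
  proof (rule ccontr)
    assume "\<not> ?thesis"
    then have "g \<le> card (cnb (A - (W \<union> Z)) (?B0 \<union> B)) + b"
      using U B(1) Z assms(5) finA fin
      by (intro nb_lower) (auto intro!: order_trans[OF card_mono assms(5)])
    moreover have "card (cnb (A - (W \<union> Z)) (?B0 \<union> B)) =
        card (?B0 \<union> B) + card (nb (A - (W \<union> Z)) (?B0 \<union> B))"
      using finA U B(1) Z by (intro card_cnb) auto
    moreover have "card (?B0 \<union> B) \<le> 2 * M" using cU U(3) cB by linarith
    moreover from this have "D * card (?B0 \<union> B) \<le> D * (2 * M)" by (rule mult_le_mono2)
    ultimately show False using nbB budget' DM M1 Mp_def by linarith
  qed
  then have inv': "inv (W \<union> Z) ?U'"
    unfolding inv_def eq using U Z B nbB by (auto simp: Diff_Diff_Int)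
  let ?Z' = "{z \<in> Z. deg ?U' z < k}"
  have "9 * k * card ?Z' < card Z"
  proof (cases "?Z' = {}")
    case False
    have fZ': "finite ?Z'" using fin by simp
    have cX: "card (B \<union> ?Z') = card B + card ?Z'"
      using fB fZ' B(1) by (intro card_Un_disjoint) auto
    have "card ?Z' \<le> card Z" using fin by (intro card_mono) auto
    then have lt: "D * card (B \<union> ?Z') < card (nb U (B \<union> ?Z'))"
      using False cX cB Z B(1) by (intro U(5)) auto
    \<comment> \<open>Every outer neighbour of \<open>B \<union> ?Z'\<close> lies in
      \<open>Z\<close>, is a neighbour of \<open>B\<close>, or is one of the fewer than
      \<open>k\<close> neighbours in \<open>?U'\<close> of some vertex of
      \<open>?Z'\<close>.\<close>
    have "nb U (B \<union> ?Z') \<subseteq> Z \<union> nb (U - Z) B \<union> (\<Union>z\<in>?Z'. {u \<in> ?U'. E z u})"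
      by (auto simp: nb_def)
    then have "card (nb U (B \<union> ?Z')) \<le> card (Z \<union> nb (U - Z) B \<union> (\<Union>z\<in>?Z'. {u \<in> ?U'. E z u}))"
      using fin fZ' by (intro card_mono) auto
    also have "\<dots> \<le> card Z + card (nb (U - Z) B) + card (\<Union>z\<in>?Z'. {u \<in> ?U'. E z u})"
      by (meson add_mono card_Un_le le_refl le_trans)
    also have "card (\<Union>z\<in>?Z'. {u \<in> ?U'. E z u}) \<le> (\<Sum>z\<in>?Z'. card {u \<in> ?U'. E z u})"
      by (rule card_UN_le[OF fZ'])
    also have "\<dots> \<le> (\<Sum>z\<in>?Z'. k)" by (intro sum_mono) (auto simp: deg_def)
    finally have "card (nb U (B \<union> ?Z')) \<le> card Z + card (nb (U - Z) B) + k * card ?Z'"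
      by (simp add: mult.commute)
    then have "D * card B + D * card ?Z' < card Z + D * card B + k * card ?Z'"
      using lt B(3) unfolding cX distrib_left by linarith
    then show ?thesis by (simp add: algebra_simps)
  next
    case True
    show ?thesis unfolding True using fZ0 by simp
  qed
  then show thesis using that[of ?U'] inv' by blast
qed

section \<open>The chain of short cycles\<close>

definition Len :: "'a \<Rightarrow> 'a \<Rightarrow> 'a set \<Rightarrow> nat set" where
  "Len x y Q = {l. \<exists>xs. pth Q xs \<and> hd xs = x \<and> last xs = y \<and> length xs = Suc l}"

text \<open>State of the growing chain: \<open>Q\<close> holds the chain from \<open>x\<close> to
  its current end \<open>y\<close>, \<open>T\<close> is a set kept in reserve to join
  \<open>x\<close> to the rest of \<open>A\<close>, and \<open>y\<close> still has enough neighbours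
  in \<open>U\<close> for another short cycle.\<close>

definition st :: "'a set \<Rightarrow> 'a \<Rightarrow> 'a set \<Rightarrow> 'a set \<Rightarrow> 'a \<Rightarrow> bool" where
  "st T x Q U y \<longleftrightarrow> inv (Q \<union> T) U \<and> Q \<inter> T = {} \<and> x \<in> Q \<and> y \<in> Q \<and> k \<le> deg U y"

lemma cnb_clean_large:
  assumes "inv W U" "card W \<le> b" "X \<subseteq> U" "M \<le> card X"
  shows "g \<le> card (cnb U X) + b + M"
proof -
  have U: "W \<subseteq> A" "U \<subseteq> A - W" "card (A - W - U) < M" using assms(1) unfolding inv_def by auto
  have "A - U = W \<union> (A - W - U)" using U by blast
  then have "card (A - U) \<le> b + M" using card_Un_le[of W "A - W - U"] U(3) assms(2) by simp
  from nb_lower[OF assms(3) _ assms(4) this] U have "g \<le> card (cnb U X) + (b + M)" by blast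
  then show ?thesis by simp
qed

text \<open>Two neighbours of \<open>y\<close> are joined by a short path \<open>zs\<close> in
  \<open>U\<close>, which closes a cycle through \<open>y\<close>. The vertex \<open>zs ! i\<close>
  is reached from \<open>y\<close> in \<open>Suc i\<close> or \<open>length zs - i\<close> steps,
  depending on the direction; all but few of these vertices can continue the chain.\<close>

lemma gadget:
  assumes st: "st T x Q U y" and size: "card (Q \<union> T) + lam \<le> b"
  obtains zs U' where "2 \<le> length zs" "length zs \<le> lam" "distinct zs" "set zs \<subseteq> U"
    "18 * card {i. i < length zs \<and> deg U' (zs ! i) < k} < length zs"
    "\<And>i. i < length zs \<Longrightarrow> k \<le> deg U' (zs ! i) \<Longrightarrow> st T x (Q \<union> set zs) U' (zs ! i)"
    "\<And>i l. i < length zs \<Longrightarrow> l \<in> Len x y Q \<Longrightarrow> l + Suc i \<in> Len x (zs ! i) (Q \<union> set zs)"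
    "\<And>i l. i < length zs \<Longrightarrow> l \<in> Len x y Q \<Longrightarrow> l + (length zs - i) \<in> Len x (zs ! i) (Q \<union> set zs)"
proof -
  have s: "inv (Q \<union> T) U" "Q \<inter> T = {}" "x \<in> Q" "y \<in> Q" "k \<le> deg U y" using st unfolding st_def by auto
  have U: "Q \<union> T \<subseteq> A" "U \<subseteq> A - (Q \<union> T)"
     "\<And>X. X \<subseteq> U \<Longrightarrow> X \<noteq> {} \<Longrightarrow> card X \<le> Mp \<Longrightarrow> D * card X < card (nb U X)"
    using s(1) unfolding inv_def by auto
  let ?K = "{u \<in> U. E y u}"
  obtain zs where zs: "pth U zs" "hd zs \<in> ?K" "last zs \<in> ?K" "hd zs \<noteq> last zs" "length zs \<le> 2 * r + 4"
  proof (rule short_link[OF nosep _ finA, of U ?K M r])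
    show "length L \<le> card ?K" using s(5) by (simp add: deg_def)
    fix X assume X: "X \<subseteq> U"
    show "card X \<le> card (nb U X)" if "X \<noteq> {}" "card X < M"
    proof -
      have "D * card X < card (nb U X)" using U(3)[OF X that(1)] that(2) DM(3) by simp
      moreover have "card X \<le> D * card X" using k2 by simp
      ultimately show ?thesis by linarith
    qed
    show "sum_list L \<le> card (cnb U X)" if "M \<le> card X"
      using cnb_clean_large[OF s(1) _ X that] size budget2 by linarith
  qed (use U Mr that in auto)
  let ?Z = "set zs"
  have d: "distinct zs" and Zs: "?Z \<subseteq> U" and sE: "successively E zs" and zne: "zs \<noteq> []"
    using zs(1) by (auto simp: pth_def)
  have len: "card ?Z = length zs" using d by (rule distinct_card)
  have l2: "2 \<le> length zs"
  proof (rule ccontr)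
    assume "\<not> ?thesis"
    then obtain a where "zs = [a]" using zne by (cases zs; cases "tl zs") auto
    then show False using zs(4) by simp
  qed
  have llam: "length zs \<le> lam" using zs(5) by (simp add: lam_def)
  obtain U' where U': "U' \<subseteq> U - ?Z" "inv (Q \<union> T \<union> ?Z) U'"
    "9 * k * card {z \<in> ?Z. deg U' z < k} < card ?Z"
  proof (rule inv_remove[OF s(1) Zs])
    show "card ?Z + M \<le> Mp" using len llam by (simp add: Mp_def)
    show "card (Q \<union> T \<union> ?Z) \<le> b" using card_Un_le[of "Q \<union> T" ?Z] len llam size by linarith
  qed (use zne in auto)
  have img: "{z \<in> ?Z. deg U' z < k} = (!) zs ` {i. i < length zs \<and> deg U' (zs ! i) < k}"
    by (auto simp: in_set_conv_nth)
  have "card {z \<in> ?Z. deg U' z < k} = card {i. i < length zs \<and> deg U' (zs ! i) < k}"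
    unfolding img using d by (intro card_image) (auto simp: inj_on_def nth_eq_iff_index_eq)
  moreover have "18 * c \<le> 9 * k * c" for c using k2 by (simp add: mult_le_mono)
  ultimately have bad: "18 * card {i. i < length zs \<and> deg U' (zs ! i) < k} < length zs"
    using U'(3) len by (metis le_less_trans)
  have QT: "Q \<union> T \<union> ?Z = (Q \<union> ?Z) \<union> T" by blast
  have A1: "st T x (Q \<union> ?Z) U' (zs ! i)" if "i < length zs" "k \<le> deg U' (zs ! i)" for i
    using U'(2) s Zs U(2) that unfolding st_def QT by auto
  have L1: "l + length ws \<in> Len x w (Q \<union> ?Z)"
    if ls: "l \<in> Len x y Q" "ws \<noteq> []" "distinct ws" "set ws \<subseteq> ?Z" "successively E ws" "E y (hd ws)" "last ws = w"
    for l ws w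
  proof -
    obtain xs where xs: "pth Q xs" "hd xs = x" "last xs = y" "length xs = Suc l"
      using ls(1) by (auto simp: Len_def)
    have "pth (Q \<union> ?Z) (xs @ ws)"
      using xs that Zs U(2) by (intro pth_append) (auto simp: pth_def)
    then show ?thesis using xs that unfolding Len_def
      by (intro CollectI exI[of _ "xs @ ws"]) (auto simp: pth_def)
  qed
  have A2: "l + Suc i \<in> Len x (zs ! i) (Q \<union> ?Z)" if "i < length zs" "l \<in> Len x y Q" for i l
  proof -
    let ?ws = "take (Suc i) zs"
    have "?ws \<noteq> []" "distinct ?ws" "set ?ws \<subseteq> ?Z" "successively E ?ws"
      using zne d sE by (auto dest: in_set_takeD intro: successively_take)
    moreover have "hd ?ws = hd zs" using zne by (cases zs) auto
    moreover have "last ?ws = zs ! i" using that(1) by (simp add: take_Suc_conv_app_nth)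
    ultimately have "l + length ?ws \<in> Len x (zs ! i) (Q \<union> ?Z)" using zs(2) that(2) by (intro L1) auto
    then show ?thesis using that by simp
  qed
  have A3: "l + (length zs - i) \<in> Len x (zs ! i) (Q \<union> ?Z)" if "i < length zs" "l \<in> Len x y Q" for i l
  proof -
    let ?ws = "rev (drop i zs)"
    have "?ws \<noteq> []" "distinct ?ws" "set ?ws \<subseteq> ?Z"
      using that(1) d by (auto dest: in_set_dropD)
    moreover have "successively E ?ws" unfolding successively_E_rev using sE by (rule successively_drop)
    moreover have "hd ?ws = last zs" "last ?ws = zs ! i"
      using that(1) by (auto simp: hd_rev last_rev hd_drop_conv_nth)
    ultimately have "l + length ?ws \<in> Len x (zs ! i) (Q \<union> ?Z)" using zs(3) that(2) by (intro L1) auto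
    then show ?thesis by simp
  qed
  show thesis by (rule that[OF l2 llam d Zs bad A1 A2 A3])
qed


text \<open>\<open>d\<close> is the optional increment gained by choosing the other way round the
  new cycle, and \<open>p\<close> bounds the number of vertices spent.\<close>

definition step :: "'a set \<Rightarrow> 'a \<Rightarrow> 'a set \<Rightarrow> 'a \<Rightarrow> nat \<Rightarrow> nat \<Rightarrow> 'a set \<Rightarrow> 'a set \<Rightarrow> 'a \<Rightarrow> bool" where
  "step T x Q y d p Q' U' y' \<longleftrightarrow> st T x Q' U' y' \<and> card Q' \<le> card Q + p \<and>
     (\<exists>e. \<forall>l\<in>Len x y Q. l + e \<in> Len x y' Q' \<and> l + e + d \<in> Len x y' Q')"

text \<open>The two ways to exit \<open>i\<close> differ by
  \<open>(p - i) - (i + 1) = p - 1 - 2 * i\<close>.\<close>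

lemma gadget_exits:
  assumes st: "st T x Q U y" and size: "card (Q \<union> T) + lam \<le> b"
  obtains p J Q' U' where "2 \<le> p" "p \<le> lam" "finite J" "18 * card J < p"
    "\<And>i. i < p \<Longrightarrow> i \<notin> J \<Longrightarrow> 2 * i + 1 \<le> p \<Longrightarrow> \<exists>y'. step T x Q y (p - 1 - 2 * i) p Q' U' y'"
proof -
  obtain zs U' where zs: "2 \<le> length zs" "length zs \<le> lam" "distinct zs" "set zs \<subseteq> U"
    "18 * card {i. i < length zs \<and> deg U' (zs ! i) < k} < length zs"
    and A1: "\<And>i. i < length zs \<Longrightarrow> k \<le> deg U' (zs ! i) \<Longrightarrow> st T x (Q \<union> set zs) U' (zs ! i)"
    and A2: "\<And>i l. i < length zs \<Longrightarrow> l \<in> Len x y Q \<Longrightarrow> l + Suc i \<in> Len x (zs ! i) (Q \<union> set zs)"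
    and A3: "\<And>i l. i < length zs \<Longrightarrow> l \<in> Len x y Q \<Longrightarrow> l + (length zs - i) \<in> Len x (zs ! i) (Q \<union> set zs)"
    by (rule gadget[OF st size]) blast
  let ?J = "{i. i < length zs \<and> deg U' (zs ! i) < k}"
  have "\<exists>y'. step T x Q y (length zs - 1 - 2 * i) (length zs) (Q \<union> set zs) U' y'"
    if i: "i < length zs" "i \<notin> ?J" "2 * i + 1 \<le> length zs" for i
  proof -
    have "st T x (Q \<union> set zs) U' (zs ! i)" using A1 i by auto
    moreover have "card (Q \<union> set zs) \<le> card Q + length zs"
      using card_Un_le[of Q "set zs"] zs(3) by (simp add: distinct_card)
    moreover have "l + Suc i \<in> Len x (zs ! i) (Q \<union> set zs) \<and>
        l + Suc i + (length zs - 1 - 2 * i) \<in> Len x (zs ! i) (Q \<union> set zs)" if "l \<in> Len x y Q" for l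
    proof -
      have "l + Suc i + (length zs - 1 - 2 * i) = l + (length zs - i)" using i by linarith
      then show ?thesis using A2[OF i(1) that] A3[OF i(1) that] by metis
    qed
    ultimately show ?thesis unfolding step_def by blast
  qed
  then show thesis using that[of "length zs" ?J "Q \<union> set zs" U'] zs(1,2,5) by simp
qed

text \<open>An early exit makes the increment a fixed fraction of the cycle, so the cost in vertices
  is linear in the span gained.\<close>

lemma step_single:
  assumes st: "st T x Q U y" and size: "card (Q \<union> T) + lam \<le> b"
  obtains d p Q' U' y' where "step T x Q y d p Q' U' y'" "1 \<le> d" "d \<le> lam" "p \<le> 3 * d" "p \<le> lam"
proof -
  obtain p J Q' U' where p: "2 \<le> p" "p \<le> lam" "finite J" "18 * card J < p"
    and S: "\<And>i. i < p \<Longrightarrow> i \<notin> J \<Longrightarrow> 2 * i + 1 \<le> p \<Longrightarrow> \<exists>y'. step T x Q y (p - 1 - 2 * i) p Q' U' y'"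
    by (rule gadget_exits[OF st size]) blast
  obtain i where i: "i \<notin> J" "18 * i \<le> p" using small_index_not_in[OF p(3,4)] by blast
  have ineq: "i < p" "2 * i + 1 \<le> p" "1 \<le> p - 1 - 2 * i" "p \<le> 3 * (p - 1 - 2 * i)" using i p by linarith+
  obtain y' where "step T x Q y (p - 1 - 2 * i) p Q' U' y'" using S[OF ineq(1) i(1) ineq(2)] by blast
  then show thesis using that ineq p(2) by (meson diff_le_self le_trans)
qed

text \<open>Two consecutive good exits of one cycle offer increments that differ by exactly 2. The
  exception \<open>p = 2\<close> is a triangle with increment 1.\<close>

lemma step_double:
  assumes st: "st T x Q U y" and size: "card (Q \<union> T) + lam \<le> b"
  obtains (one) Q' U' y' where "step T x Q y 1 lam Q' U' y'"
  | (two) d Q' U' y' Q'' U'' y'' where "d + 2 \<le> lam" "step T x Q y d lam Q' U' y'"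
      "step T x Q y (d + 2) lam Q'' U'' y''"
proof -
  obtain p J Q' U' where p: "2 \<le> p" "p \<le> lam" "finite J" "18 * card J < p"
    and S: "\<And>i. i < p \<Longrightarrow> i \<notin> J \<Longrightarrow> 2 * i + 1 \<le> p \<Longrightarrow> \<exists>y'. step T x Q y (p - 1 - 2 * i) p Q' U' y'"
    by (rule gadget_exits[OF st size]) blast
  have up: "step T x Q y d lam Q' U' y'" if "step T x Q y d p Q' U' y'" for d y'
    using that p(2) unfolding step_def by (meson add_left_mono le_trans)
  obtain i where i: "i \<notin> J" "Suc i \<notin> J" "9 * i \<le> p" using small_pair_not_in[OF p(3,4)] by blast
  show thesis
  proof (cases "p = 2")
    case True
    then have "i = 0" using i by simp
    then show thesis using S[of i] i True up one by fastforce
  next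
    case False
    have ineq: "i < p" "2 * i + 1 \<le> p" "Suc i < p" "2 * Suc i + 1 \<le> p"
      using i(3) p(1) False by (cases i; simp)+
    have e: "p - 1 - 2 * i = (p - 1 - 2 * Suc i) + 2" using ineq(4) by simp
    obtain y1 where "step T x Q y (p - 1 - 2 * i) p Q' U' y1" using S[OF ineq(1) i(1) ineq(2)] by blast
    then have 1: "step T x Q y ((p - 1 - 2 * Suc i) + 2) lam Q' U' y1" using up e by simp
    obtain y2 where "step T x Q y (p - 1 - 2 * Suc i) p Q' U' y2" using S[OF ineq(3) i(2) ineq(4)] by blast
    then have 2: "step T x Q y (p - 1 - 2 * Suc i) lam Q' U' y2" using up by simp
    have "(p - 1 - 2 * Suc i) + 2 \<le> lam" unfolding e[symmetric] using p(2) by simp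
    then show thesis using two 1 2 by blast
  qed
qed

section \<open>Pigeonhole on the increments\<close>

definition "pot K ds = (\<Sum>d\<le>lam. min (count_list ds d) K)"

lemma pot_Cons: "d \<le> lam \<Longrightarrow> count_list ds d < K \<Longrightarrow> pot K (d # ds) = Suc (pot K ds)"
proof -
  assume d: "d \<le> lam" "count_list ds d < K"
  have "pot K (d # ds) = (\<Sum>e\<in>{..lam}. min (count_list ds e) K + (if e = d then 1 else 0))"
    unfolding pot_def by (rule sum.cong) (use d in auto)
  also have "\<dots> = pot K ds + 1" unfolding pot_def sum.distrib using d by simp
  finally show ?thesis by simp
qed

lemma pot_le: "pot K ds \<le> K * (lam + 1)"
proof -
  have "pot K ds \<le> (\<Sum>d\<le>lam. K)" unfolding pot_def by (intro sum_mono) simp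
  then show ?thesis by (simp add: mult.commute)
qed

lemma ap_of_ones:
  assumes "K \<le> count_list ds 1" "\<forall>v\<in>subset_sums ds. a + v \<in> S"
  shows "has_ap S 2 K"
proof -
  have "a + t \<in> S" if "t \<le> K" for t
    using subset_sums_two[of 1 0 t ds 0] that assms by auto
  then show ?thesis unfolding has_ap_def by blast
qed

text \<open>Replacing \<open>d\<close> by \<open>d + 2\<close> in \<open>j\<close> of
  \<open>K\<close> chosen increments raises the sum by \<open>2 * j\<close>.\<close>

lemma ap_of_pairs:
  assumes "K \<le> count_list ds d" "K \<le> count_list ds (d + 2)" "\<forall>v\<in>subset_sums ds. a + v \<in> S"
  shows "has_ap S 2 K"
proof -
  have "a + K * d + t \<in> S" if t: "t \<le> K" "2 dvd t" for t
  proof -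
    obtain j where j: "t = 2 * j" using t(2) by blast
    have "(K - j) * d + j * (d + 2) \<in> subset_sums ds"
      using t j assms by (intro subset_sums_two) auto
    moreover have "(K - j) * d + j * (d + 2) = K * d + t"
      using t(1) unfolding j by (simp add: distrib_left diff_mult_distrib)
    ultimately show ?thesis using assms(3) by (metis add.assoc)
  qed
  then show ?thesis unfolding has_ap_def by blast
qed

lemma step_sums:
  assumes "step T x Q y d p Q' U' y'" "\<forall>v\<in>subset_sums ds. a + v \<in> Len x y Q"
  shows "\<exists>a'. \<forall>v\<in>subset_sums (d # ds). a' + v \<in> Len x y' Q'"
proof -
  obtain e where e: "\<And>l. l \<in> Len x y Q \<Longrightarrow> l + e \<in> Len x y' Q' \<and> l + e + d \<in> Len x y' Q'"
    using assms(1) unfolding step_def by blast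
  have "a + e + v \<in> Len x y' Q'" if "v \<in> subset_sums (d # ds)" for v
  proof -
    from that obtain w where w: "w \<in> subset_sums ds" "v = w \<or> v = d + w" by auto
    have "a + w + e \<in> Len x y' Q'" "a + w + e + d \<in> Len x y' Q'" using e[of "a + w"] assms(2) w(1) by auto
    then show ?thesis using w(2) by (auto simp: add_ac)
  qed
  then show ?thesis by blast
qed

text \<open>\<open>step_double\<close> offers 1, or a choice of \<open>d\<close> and
  \<open>d + 2\<close>. Unless the required copies are already present, which gives a progression of
  difference 2, some offered increment has occurred fewer than \<open>K\<close> times; taking it
  raises \<open>pot K ds\<close> by one.\<close>

lemma phase1_aux:
  assumes st0: "st T x Q0 U0 y0" and l0: "l0 \<in> Len x y0 Q0"
    and size: "card Q0 + j * lam + card T \<le> b"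
  shows "\<exists>Q U y. st T x Q U y \<and> card Q \<le> card Q0 + j * lam \<and>
    (has_ap (Len x y Q) 2 K \<or> (\<exists>ds a. j \<le> pot K ds \<and> (\<forall>v\<in>subset_sums ds. a + v \<in> Len x y Q)))"
  using size
proof (induction j)
  case 0
  have "\<forall>v\<in>subset_sums []. l0 + v \<in> Len x y0 Q0" using l0 by simp
  then show ?case using st0 by (metis le0 add_0_right mult_0 le_refl)
next
  case (Suc j)
  have "card Q0 + j * lam + card T \<le> b" using Suc.prems by simp
  from Suc.IH[OF this] obtain Q U y where IH: "st T x Q U y" "card Q \<le> card Q0 + j * lam"
    "has_ap (Len x y Q) 2 K \<or> (\<exists>ds a. j \<le> pot K ds \<and> (\<forall>v\<in>subset_sums ds. a + v \<in> Len x y Q))"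
    by (elim exE conjE)
  have le: "card Q \<le> card Q0 + Suc j * lam" using IH(2) by simp
  show ?case
  proof (cases "has_ap (Len x y Q) 2 K")
    case True
    then show ?thesis using IH le by blast
  next
    case False
    then obtain ds a where ds: "j \<le> pot K ds" "\<forall>v\<in>subset_sums ds. a + v \<in> Len x y Q" using IH(3) by blast
    have sz: "card (Q \<union> T) + lam \<le> b" using card_Un_le[of Q T] IH(2) Suc.prems by simp
    have extend: ?thesis if stp: "step T x Q y d lam Q' U' y'" "d \<le> lam" "count_list ds d < K" for d Q' U' y'
    proof -
      obtain a' where "\<forall>v\<in>subset_sums (d # ds). a' + v \<in> Len x y' Q'"
        using step_sums[OF stp(1) ds(2)] by blast
      moreover have "Suc j \<le> pot K (d # ds)" using pot_Cons that ds(1) by simp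
      moreover have "st T x Q' U' y'" "card Q' \<le> card Q0 + Suc j * lam"
        using that(1) IH(2) unfolding step_def by auto
      ultimately show ?thesis by blast
    qed
    from IH(1) sz show ?thesis
    proof (cases rule: step_double)
      case (one Q' U' y')
      have "count_list ds 1 < K" using ap_of_ones[OF _ ds(2), of K] False by (meson linorder_not_le)
      moreover have "1 \<le> lam" by (simp add: lam_def)
      ultimately show ?thesis using extend one by blast
    next
      case (two d Q' U' y' Q'' U'' y'')
      have "count_list ds d < K \<or> count_list ds (d + 2) < K"
        using ap_of_pairs[OF _ _ ds(2), of K d] False by (meson linorder_not_le)
      then show ?thesis using extend[OF two(2)] extend[OF two(3)] two(1) by auto
    qed
  qed
qed

text \<open>The number of steps is one more than \<open>pot\<close> can reach, so the first
  alternative of \<open>phase1_aux\<close> must occur.\<close>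

lemma phase1:
  assumes "st T x Q0 U0 y0" "l0 \<in> Len x y0 Q0" "card Q0 + Suc (K * (lam + 1)) * lam + card T \<le> b"
  obtains Q U y where "st T x Q U y" "card Q \<le> card Q0 + Suc (K * (lam + 1)) * lam" "has_ap (Len x y Q) 2 K"
  using phase1_aux[OF assms, of K] pot_le[of K] that by (meson not_less_eq_eq le_trans)

text \<open>The span is counted by \<open>v\<close>, at three vertices per unit beyond
  \<open>K\<close>. Passing from difference 2 to difference 1 costs up to \<open>lam\<close> in span
  and \<open>lam\<close> in vertices, and happens at most once.\<close>

definition phase2_inv :: "'a set \<Rightarrow> 'a \<Rightarrow> nat \<Rightarrow> nat \<Rightarrow> nat \<Rightarrow> nat \<Rightarrow> 'a set \<Rightarrow> 'a set \<Rightarrow> 'a \<Rightarrow> bool" where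
  "phase2_inv T x q K c v Q U y \<longleftrightarrow> st T x Q U y \<and> K \<le> v \<and>
     (c = 1 \<and> has_ap (Len x y Q) 1 (v - lam) \<and> card Q \<le> q + 3 * (v - K) + lam \<or>
      c = 2 \<and> has_ap (Len x y Q) 2 v \<and> card Q \<le> q + 3 * (v - K))"

text \<open>An increment compatible with the current difference lengthens the progression. An odd
  one met at difference 2 leaves \<open>v\<close> unchanged but changes the difference to 1. The
  bound \<open>3 * lam \<le> K\<close> keeps the span large enough to merge translates.\<close>

lemma phase2_step:
  assumes I: "phase2_inv T x q K c v Q U y" and K: "3 * lam \<le> K"
    and size: "q + 3 * (v - K) + 2 * lam + card T \<le> b"
  shows "(\<exists>c' d Q' U' y'. 1 \<le> d \<and> d \<le> lam \<and> phase2_inv T x q K c' (v + d) Q' U' y') \<or>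
         (c = 2 \<and> (\<exists>Q' U' y'. phase2_inv T x q K 1 v Q' U' y'))"
proof -
  have st: "st T x Q U y" and Kv: "K \<le> v" using I unfolding phase2_inv_def by auto
  have cQ: "card Q \<le> q + 3 * (v - K) + lam" using I unfolding phase2_inv_def by auto
  have "card (Q \<union> T) + lam \<le> b" using card_Un_le[of Q T] cQ size by linarith
  then obtain d p Q' U' y' where S: "step T x Q y d p Q' U' y'" "1 \<le> d" "d \<le> lam" "p \<le> 3 * d" "p \<le> lam"
    using step_single[OF st] by blast
  obtain e where e: "\<And>l. l \<in> Len x y Q \<Longrightarrow> l + e \<in> Len x y' Q' \<and> l + e + d \<in> Len x y' Q'"
    using S(1) unfolding step_def by blast
  have st': "st T x Q' U' y'" "card Q' \<le> card Q + p" using S(1) unfolding step_def by auto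
  consider (c1) "c = 1" "has_ap (Len x y Q) 1 (v - lam)" "card Q \<le> q + 3 * (v - K) + lam"
    | (c2e) "c = 2" "even d" "has_ap (Len x y Q) 2 v" "card Q \<le> q + 3 * (v - K)"
    | (c2o) "c = 2" "odd d" "has_ap (Len x y Q) 2 v" "card Q \<le> q + 3 * (v - K)"
    using I unfolding phase2_inv_def by blast
  then show ?thesis
  proof cases
    case c1
    have "has_ap (Len x y' Q') 1 (v - lam + d)"
      using c1 S(3) K Kv by (intro has_ap_shift[OF c1(2) e]) auto
    moreover have "v - lam + d = v + d - lam" using K Kv by linarith
    ultimately have "has_ap (Len x y' Q') 1 (v + d - lam)" by simp
    moreover have "card Q' \<le> q + 3 * (v + d - K) + lam" using st'(2) c1 S(4) Kv by linarith
    ultimately have "phase2_inv T x q K 1 (v + d) Q' U' y'" using st' Kv unfolding phase2_inv_def by simp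
    then show ?thesis using S by blast
  next
    case c2e
    have "has_ap (Len x y' Q') 2 (v + d)"
      using c2e S(3) K Kv by (intro has_ap_shift[OF c2e(3) e]) auto
    moreover have "card Q' \<le> q + 3 * (v + d - K)" using st'(2) c2e S(4) Kv by linarith
    ultimately have "phase2_inv T x q K 2 (v + d) Q' U' y'" using st' Kv unfolding phase2_inv_def by simp
    then show ?thesis using S by blast
  next
    case c2o
    have "has_ap (Len x y' Q') 1 (v - d)" by (rule has_ap_shift_odd[OF c2o(3) e c2o(2)])
    then have "has_ap (Len x y' Q') 1 (v - lam)" using S(3) by (rule_tac has_ap_mono) auto
    moreover have "card Q' \<le> q + 3 * (v - K) + lam" using st'(2) c2o S(5) by linarith
    ultimately have "phase2_inv T x q K 1 v Q' U' y'" using st' Kv unfolding phase2_inv_def by simp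
    then show ?thesis using c2o by blast
  qed
qed

text \<open>After a change of difference the next step must increase \<open>v\<close>, so at most
  two steps are needed for progress; each increase overshoots by at most \<open>lam\<close>.\<close>

lemma phase2:
  assumes "phase2_inv T x q K 2 K Q0 U0 y0" and K: "3 * lam \<le> K"
    and size: "q + 3 * (j + lam) + 2 * lam + card T \<le> b"
  shows "\<exists>c v Q U y. K + j \<le> v \<and> v \<le> K + j + lam \<and> phase2_inv T x q K c v Q U y"
  using size
proof (induction j)
  case 0
  then show ?case using assms(1) by (intro exI[of _ 2] exI[of _ K]) auto
next
  case (Suc j)
  then obtain c v Q U y where IH: "K + j \<le> v" "v \<le> K + j + lam" "phase2_inv T x q K c v Q U y" by auto
  show ?case
  proof (cases "v = K + j")
    case False
    then show ?thesis using IH by (intro exI[of _ c] exI[of _ v]) auto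
  next
    case True
    have sz: "q + 3 * (v - K) + 2 * lam + card T \<le> b" using True Suc.prems by simp
    have fin: ?thesis if "1 \<le> d" "d \<le> lam" "phase2_inv T x q K c' (v + d) Q' U' y'" for c' d Q' U' y'
      using that True by (intro exI[of _ c'] exI[of _ "v + d"]) auto
    from phase2_step[OF IH(3) K sz] show ?thesis
    proof
      assume "c = 2 \<and> (\<exists>Q' U' y'. phase2_inv T x q K 1 v Q' U' y')"
      then obtain Q' U' y' where "phase2_inv T x q K 1 v Q' U' y'" by blast
      from phase2_step[OF this K sz] show ?thesis using fin by auto
    qed (use fin in blast)
  qed
qed

section \<open>Assembling the chain and closing the cycle in a large cluster\<close>

definition "qmax m = 1 + Suc (3 * lam * (lam + 1)) * lam + 3 * (m + lam) + lam"

text \<open>The set of ends given by \<open>posa\<close> expands by a factor of at most 2, so it has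
  at least \<open>M\<close> vertices. Its closed neighbourhood in \<open>U\<close>, which is almost
  \<open>g\<close>, then lies on the path.\<close>

lemma inv_long_path:
  assumes "inv W U" "card W \<le> b" "u \<in> U"
  obtains P where "pth U P" "hd P = u" "g \<le> length P + b + M"
proof -
  have fU: "finite U" using inv_finite[OF assms(1)] by simp
  obtain P where P: "pth U P" "hd P = u" "\<And>Q. pth U Q \<Longrightarrow> hd Q = u \<Longrightarrow> length Q \<le> length P"
    by (rule longest_path_from[OF fU assms(3)]) blast
  obtain X where X: "X \<subseteq> set P" "X \<noteq> {}" "nb U X \<subseteq> set P" "card (nb U X) \<le> 2 * card X"
    by (rule posa[OF P(1)]) (use P in auto)
  have XU: "X \<subseteq> U" using X(1) P(1) by (auto simp: pth_def)
  have "M \<le> card X"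
  proof (rule ccontr)
    assume "\<not> ?thesis"
    then have "D * card X < card (nb U X)"
      using assms(1) XU X(2) DM(3) unfolding inv_def by simp
    moreover have "2 * card X \<le> D * card X" using k2 by (intro mult_le_mono1) simp
    ultimately show False using X(4) by linarith
  qed
  then have "g \<le> card (cnb U X) + b + M" using cnb_clean_large assms XU by blast
  moreover have "cnb U X \<subseteq> set P" using X unfolding cnb_eq[OF XU] by blast
  then have "card (cnb U X) \<le> length P" by (meson List.finite_set card_length card_mono le_trans)
  ultimately show thesis using that[of P] P by linarith
qed

text \<open>A path \<open>tx\<close> of \<open>M\<close> clean vertices is set aside first. Some
  vertex \<open>x\<close> on it keeps \<open>k\<close> neighbours in the clean part, and the chain
  grows from there; the rest \<open>T\<close> of the path ensures that \<open>x\<close> lies in a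
  component of at least \<open>M\<close> vertices outside the chain. \<open>qmax m\<close> adds the
  costs of both phases with \<open>K = 3 * lam\<close>.\<close>

lemma adjuster:
  assumes size: "qmax m + lam + M \<le> b"
  obtains T x Q U y a tx where "st T x Q U y" "card Q \<le> qmax m" "\<And>t. t \<le> m \<Longrightarrow> even t \<Longrightarrow> a + t \<in> Len x y Q"
    "pth A tx" "set tx = insert x T" "length tx = M"
proof -
  obtain U0 where U0: "inv {} U0" using inv_init by blast
  have "U0 \<noteq> {}"
  proof
    assume "U0 = {}"
    then have "card A < M" using U0 unfolding inv_def by simp
    then show False using gA budget2 by linarith
  qed
  then obtain s where s: "s \<in> U0" by blast
  obtain P where P: "pth U0 P" "hd P = s" "g \<le> length P + b + M"
    by (rule inv_long_path[OF U0 _ s]) (simp, blast)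
  have MP: "M \<le> length P" using P(3) budget' DM(2,3) by linarith
  define tx where "tx = take M P"
  have tx: "pth U0 tx" "length tx = M"
    using P(1) MP M1 unfolding tx_def pth_def
    by (auto intro: successively_take dest: in_set_takeD)
  let ?Z = "set tx"
  have ZU: "?Z \<subseteq> U0" and cZ: "card ?Z = M" using tx by (auto simp: pth_def distinct_card)
  obtain U1 where U1: "U1 \<subseteq> U0 - ?Z" "inv ({} \<union> ?Z) U1" "9 * k * card {z \<in> ?Z. deg U1 z < k} < card ?Z"
    by (rule inv_remove[OF U0 ZU]) (use tx cZ size in \<open>auto simp: pth_def Mp_def\<close>)
  have "\<exists>x\<in>?Z. k \<le> deg U1 x"
  proof (rule ccontr)
    assume "\<not> ?thesis"
    then have "{z \<in> ?Z. deg U1 z < k} = ?Z" by auto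
    then have "9 * k * M < M" using U1(3) cZ by metis
    then show False using k2 by simp
  qed
  then obtain x where x: "x \<in> ?Z" "k \<le> deg U1 x" by blast
  define T where "T = ?Z - {x}"
  have T: "{x} \<union> T = ?Z" using x(1) by (auto simp: T_def)
  have cT: "card T \<le> M" unfolding T_def using cZ by (metis List.finite_set card_Diff1_le)
  have st0: "st T x {x} U1 x" unfolding st_def T using U1(2) x by (auto simp: T_def)
  have len0: "0 \<in> Len x x {x}" unfolding Len_def by (intro CollectI exI[of _ "[x]"]) (simp add: pth_def)
  let ?K = "3 * lam"
  let ?q = "card {x} + Suc (?K * (lam + 1)) * lam"
  obtain Q1 V1 y1 where ph1: "st T x Q1 V1 y1" "card Q1 \<le> ?q" "has_ap (Len x y1 Q1) 2 ?K"
    by (rule phase1[OF st0 len0, of ?K]) (use size cT in \<open>auto simp: qmax_def\<close>)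
  have "phase2_inv T x ?q ?K 2 ?K Q1 V1 y1" using ph1 unfolding phase2_inv_def by simp
  moreover have "?q + 3 * (m + lam) + 2 * lam + card T \<le> b" using size cT by (simp add: qmax_def)
  ultimately obtain c v Q U y where ph2: "?K + m \<le> v" "v \<le> ?K + m + lam" "phase2_inv T x ?q ?K c v Q U y"
    using phase2[of T x ?q ?K Q1 V1 y1 m] by auto
  have st: "st T x Q U y" and "card Q \<le> ?q + 3 * (v - ?K) + lam"
    using ph2(3) unfolding phase2_inv_def by auto
  then have cQ: "card Q \<le> qmax m" using ph2(2) by (simp add: qmax_def)
  have "has_ap (Len x y Q) 2 m"
    using ph2(1,3) has_ap_mono[of "Len x y Q" 1 "v - lam" m 2] has_ap_mono[of "Len x y Q" 2 v m 2]
    unfolding phase2_inv_def by auto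
  then obtain a where a: "\<And>t. t \<le> m \<Longrightarrow> even t \<Longrightarrow> a + t \<in> Len x y Q" unfolding has_ap_def by blast
  have "U0 \<subseteq> A" using U0 unfolding inv_def by simp
  then have "pth A tx" by (rule pth_mono[OF tx(1)])
  moreover have "set tx = insert x T" using T by simp
  ultimately show thesis using that[OF st cQ a] tx(2) by blast
qed


lemma pth_reach:
  assumes "pth S xs" "u \<in> set xs" shows "set xs \<subseteq> reach S u"
proof
  fix v assume "v \<in> set xs"
  then obtain zs where "pth (reach S (hd xs)) zs" "hd zs = u" "last zs = v"
    using reach_path[of u S "hd xs" v] pth_subset_reach[OF assms(1)] assms(2) by blast
  then show "v \<in> reach S u" using pth_mono[OF _ reach_subset] unfolding reach_def by blast
qed

text \<open>Follow \<open>xs\<close> to its first vertex \<open>f\<close> beyond the first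
  \<open>c\<close> vertices of \<open>P\<close>, then return along \<open>P\<close> to
  \<open>y\<close>. Since \<open>S\<close> avoids those first \<open>c\<close> vertices, the return
  traverses all of them without collision.\<close>

lemma path_through_far_part:
  assumes "pth S xs" "hd xs = x" "last xs \<in> set (drop c P)" "c < length P"
    and P: "pth S' P" "S \<inter> set (take c P) = {}" "S \<subseteq> S'" and y: "E y (hd P)" "y \<in> S'" "y \<notin> S" "y \<notin> set P"
  obtains R where "pth S' R" "hd R = x" "last R = y" "c \<le> length R"
proof -
  have "\<exists>v\<in>set xs. v \<in> set (drop c P)" using assms(1,3) unfolding pth_def by (metis last_in_set)
  from split_list_first_prop[OF this] obtain as f bs where
    xs: "xs = as @ f # bs" "f \<in> set (drop c P)" "\<forall>v\<in>set as. v \<notin> set (drop c P)" by blast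
  obtain j where j: "c \<le> j" "j < length P" "P ! j = f"
  proof -
    obtain i where "i < length (drop c P)" "drop c P ! i = f" using xs(2) by (metis in_set_conv_nth)
    then show thesis using that[of "c + i"] by simp
  qed
  have dP: "distinct P" and sP: "successively E P" using P by (auto simp: pth_def)
  let ?ys = "y # take j P"
  have "take (Suc j) P = take j P @ [f]" using j by (simp add: take_Suc_conv_app_nth)
  then have tk: "distinct (take j P @ [f])" "successively E (take j P @ [f])"
    using dP successively_take[OF sP, of "Suc j"] distinct_take[OF dP, of "Suc j"] by auto
  have "hd (take j P) = hd P" if "0 < j" using that by (cases P; cases j) auto
  then have sy: "successively E (?ys @ [f])"
    using tk(2) y(1) j by (cases "j = 0") (auto simp: successively_Cons hd_append hd_conv_nth)
  have dy: "distinct (?ys @ [f])" using tk(1) y(4) j by (auto dest: in_set_takeD)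
  have ys: "distinct ?ys" "successively E ?ys" "E (last ?ys) f" "f \<notin> set ?ys"
    using sy dy unfolding successively_append_iff distinct_append by auto
  have as: "distinct (as @ [f])" "successively E (as @ [f])" "set (as @ [f]) \<subseteq> S"
    using assms(1) unfolding xs(1) by (auto simp: pth_def successively_append_iff)
  let ?R = "(as @ [f]) @ rev ?ys"
  have disj: "set (as @ [f]) \<inter> set ?ys = {}"
  proof -
    have "v \<notin> set as" if "v \<in> set (take j P)" for v
    proof (cases "v \<in> set (take c P)")
      case True
      then show ?thesis using P(2) as(3) by auto
    next
      case False
      have "v \<in> set P" using that by (rule in_set_takeD)
      then have "v \<in> set (drop c P)" using False by (metis Un_iff append_take_drop_id set_append)
      then show ?thesis using xs(3) by blast
    qed
    then show ?thesis using as(3) y(3) ys(4) by auto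
  qed
  have "successively E ?R"
    unfolding successively_append_iff[of E "as @ [f]"] successively_E_rev hd_rev
    using as(2) ys(2) E_sym[OF ys(3)] by simp
  moreover have "distinct ?R"
    unfolding distinct_append[of "as @ [f]"] distinct_rev set_rev using as(1) ys(1) disj by blast
  moreover have "set ?R \<subseteq> S'" using as(3) P y(2) by (auto simp: pth_def dest: in_set_takeD)
  ultimately have "pth S' ?R" unfolding pth_def by blast
  moreover have "hd ?R = x" using assms(2) xs(1) by (cases as) auto
  moreover have "c \<le> length ?R" using j by simp
  ultimately show thesis using that[of ?R] by simp
qed


abbreviation "m \<equiv> sum_list L"

lemma cycle_in_large_cluster:
  assumes conn: "\<And>Z. Z \<subseteq> A \<Longrightarrow> M \<le> card Z \<Longrightarrow> M \<le> card (A - cnb A Z) \<Longrightarrow> s < card (nb A Z)"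
    and Mm: "M \<le> m" "k * M \<le> 2 * m"
    and size: "qmax (4 * m) + 4 * m + lam + M + 2 \<le> b" "b \<le> s" "n + b \<le> card A" "b \<le> n" "b + 4 * m + M \<le> g"
  shows "has_cycle A n"
proof -
  obtain T x Q U y a tx where st: "st T x Q U y" and cQ: "card Q \<le> qmax (4 * m)"
    and a: "\<And>t. t \<le> 4 * m \<Longrightarrow> even t \<Longrightarrow> a + t \<in> Len x y Q"
    and tx: "pth A tx" "set tx = insert x T" "length tx = M"
  proof -
    have sz: "qmax (4 * m) + lam + M \<le> b" using size(1) by simp
    show thesis by (rule adjuster[OF sz]) (rule that)
  qed
  have inv: "inv (Q \<union> T) U" and QT: "Q \<inter> T = {}" "x \<in> Q" "y \<in> Q" "k \<le> deg U y"
    using st unfolding st_def by auto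
  have sub: "Q \<subseteq> A" "T \<subseteq> A" "U \<subseteq> A" "U \<inter> Q = {}" "U \<inter> T = {}" using inv unfolding inv_def by auto
  have fin: "finite Q" "finite T" "finite U" using sub finA finite_subset by blast+
  have m1: "1 \<le> m" using Mm(1) M1 by simp
  \<comment> \<open>The lengths \<open>a\<close> and \<open>a + 2\<close> both occur, so some path
    from \<open>x\<close> to \<open>y\<close> has at least three vertices.\<close>
  have xy: "x \<noteq> y"
  proof
    assume "x = y"
    moreover have "a + 2 \<in> Len x y Q" using a[of 2] m1 by simp
    ultimately obtain xs where xs: "pth Q xs" "hd xs = last xs" "length xs = Suc (a + 2)"
      unfolding Len_def by auto
    then obtain u w ws where "xs = u # w # ws" by (cases xs; cases "tl xs") auto
    then show False using xs(1,2) by (auto simp: pth_def split: if_splits)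
  qed
  have "card T \<le> M" using tx(2,3) by (metis card_length card_mono List.finite_set le_trans subset_insertI)
  then have cW: "card (Q \<union> T) \<le> b" using card_Un_le[of Q T] cQ size(1) by linarith
  have "{u \<in> U. E y u} \<noteq> {}" using QT(4) k2 unfolding deg_def by (metis card.empty le_zero_eq not_numeral_le_zero)
  then obtain u where u: "u \<in> U" "E y u" by blast
  obtain P where P: "pth U P" "hd P = u" "g \<le> length P + b + M" by (rule inv_long_path[OF inv cW u(1)]) blast
  define P0 where "P0 = take (4 * m) P"
  have lP0: "length P0 = 4 * m" using P(3) size(5) by (simp add: P0_def)
  have P0: "pth U P0" "hd P0 = u"
  proof -
    have pos: "0 < 4 * m" using m1 by linarith
    then have "P0 \<noteq> []" using lP0 by (metis length_greater_0_conv)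
    then show "pth U P0" using P(1)
      by (auto simp: P0_def pth_def intro: successively_take dest: in_set_takeD)
    show "hd P0 = u" unfolding P0_def hd_take[OF pos] by (rule P(2))
  qed
  \<comment> \<open>The first \<open>3 * m\<close> vertices guarantee the length of a starting path;
    the remaining \<open>m\<close>, at least \<open>M\<close>, serve as a target.\<close>
  let ?N0 = "set (take (3 * m) P0)" and ?F = "set (drop (3 * m) P0)"
  have dP0: "distinct P0" using P0(1) by (simp add: pth_def)
  have N0F: "?N0 \<subseteq> U" "?F \<subseteq> U" "card ?N0 \<le> 3 * m" "M \<le> card ?F"
    using P0(1) lP0 Mm(1) dP0 by (auto simp: pth_def distinct_card dest: in_set_takeD in_set_dropD intro: le_trans[OF card_length])
  have NFdisj: "?N0 \<inter> ?F = {}" using set_take_disj_set_drop_if_distinct[OF dP0] by simp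
  define S1 where "S1 = insert x (A - Q - ?N0)"
  define Zc where "Zc = reach S1 x"
  have S1A: "S1 \<subseteq> A" using QT sub by (auto simp: S1_def)
  have ZcS: "Zc \<subseteq> S1" unfolding Zc_def by (rule reach_subset)
  have Zcl: "w \<in> Zc" if "v \<in> Zc" "E v w" "w \<in> S1" for v w
    using that reach_trans_edge unfolding Zc_def by blast
  have "set tx \<subseteq> S1" using tx(2) QT sub N0F by (auto simp: S1_def)
  then have "pth S1 tx" using tx(1) by (auto simp: pth_def)
  then have "set tx \<subseteq> Zc" unfolding Zc_def using tx(2) by (intro pth_reach) auto
  then have "card (set tx) \<le> card Zc" using ZcS S1A finA finite_subset by (meson card_mono)
  then have cZ: "M \<le> card Zc" using tx(1,3) by (simp add: pth_def distinct_card)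
  have FS: "?F \<subseteq> S1" using N0F NFdisj sub by (auto simp: S1_def)
  \<comment> \<open>The component of \<open>x\<close> contains \<open>tx\<close>, hence at least
    \<open>M\<close> vertices. If it missed the target, it would be cut off by \<open>Q\<close> and
    \<open>?N0\<close> alone, fewer than \<open>conn\<close> demands.\<close>
  have "Zc \<inter> ?F \<noteq> {}"
  proof
    assume e: "Zc \<inter> ?F = {}"
    have "?F \<subseteq> A - cnb A Zc" using e FS S1A Zcl unfolding cnb_def by blast
    then have "M \<le> card (A - cnb A Zc)" using N0F(4) finA by (meson card_mono finite_Diff le_trans)
    then have "s < card (nb A Zc)" using ZcS S1A cZ by (intro conn) auto
    moreover have "nb A Zc \<subseteq> Q \<union> ?N0" using Zcl by (auto simp: nb_def S1_def)
    then have "card (nb A Zc) \<le> card Q + card ?N0"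
      using fin by (meson List.finite_set card_Un_le card_mono finite_UnI le_trans)
    ultimately show False using N0F(3) cQ size by linarith
  qed
  then obtain xs where xs: "pth S1 xs" "hd xs = x" "last xs \<in> ?F" unfolding Zc_def reach_def by auto
  define A' where "A' = (A - Q) \<union> {x, y}"
  have A'A: "A' \<subseteq> A" using QT sub by (auto simp: A'_def)
  have fA': "finite A'" using A'A finA finite_subset by blast
  obtain R0 where R0: "pth A' R0" "hd R0 = x" "last R0 = y" "3 * m \<le> length R0"
  proof (rule path_through_far_part[OF xs])
    show "pth A' P0" using P0 sub by (auto simp: pth_def A'_def)
    show "S1 \<inter> ?N0 = {}" using QT N0F sub by (auto simp: S1_def)
    show "y \<notin> S1" using QT xy by (auto simp: S1_def)
    show "y \<notin> set P0" using P0 sub QT by (auto simp: pth_def)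
    show "E y (hd P0)" using u P0 by simp
  qed (use that lP0 m1 in \<open>auto simp: S1_def A'_def\<close>)
  obtain R where R: "pth A' R \<and> hd R = x \<and> last R = y"
    and Rmax: "\<And>R'. pth A' R' \<and> hd R' = x \<and> last R' = y \<Longrightarrow> length R' \<le> length R"
    using finite_arg_max_exists[of "\<lambda>R. pth A' R \<and> hd R = x \<and> last R = y" R0 length "card A'"]
      R0 pth_length_le[OF _ fA'] by metis
  have lR: "3 * m \<le> length R" using Rmax[of R0] R0 by simp
  have RA: "set R \<subseteq> A'" "distinct R" using R by (auto simp: pth_def)
  have cR: "card (set R) = length R" using RA(2) by (rule distinct_card)
  let ?Y = "A' - set R"
  \<comment> \<open>A component with more than \<open>M\<close> vertices has at most
    \<open>m\<close> neighbours on \<open>R\<close>. The other vertices of \<open>R\<close>, at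
    least \<open>3 * m - m\<close>, form a second large side, so \<open>Q\<close> and those
    neighbours would be too small a separator.\<close>
  have comp: "card (reach ?Y v) \<le> M" if "v \<in> ?Y" for v
  proof (rule ccontr)
    assume big: "\<not> ?thesis"
    let ?Z = "reach ?Y v"
    have ZY: "?Z \<subseteq> ?Y" by (rule reach_subset)
    have nbR: "card (nb (set R) ?Z) \<le> m"
    proof (rule longest_path_component_nb[OF nosep A'A])
      show "pth A' R" using R by blast
      fix Q' assume "pth A' Q'" "hd Q' = hd R" "last Q' = last R"
      then show "length Q' \<le> length R" using Rmax R by simp
    qed
    have "nb A ?Z \<subseteq> Q \<union> nb (set R) ?Z"
    proof
      fix w assume w: "w \<in> nb A ?Z"
      then obtain z where z: "z \<in> ?Z" "E z w" "w \<in> A" "w \<notin> ?Z" by (auto simp: nb_def)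
      then have "w \<notin> ?Y" using reach_trans_edge by blast
      then show "w \<in> Q \<union> nb (set R) ?Z" using z by (auto simp: nb_def A'_def)
    qed
    then have "card (nb A ?Z) \<le> card (Q \<union> nb (set R) ?Z)" using fin by (intro card_mono) auto
    also have "\<dots> \<le> card Q + card (nb (set R) ?Z)" by (rule card_Un_le)
    finally have up: "card (nb A ?Z) \<le> qmax (4 * m) + m" using nbR cQ by linarith
    have "set R - nb (set R) ?Z \<subseteq> A - cnb A ?Z" using RA A'A ZY by (auto simp: nb_def cnb_def)
    then have "card (set R - nb (set R) ?Z) \<le> card (A - cnb A ?Z)" using finA by (intro card_mono) auto
    moreover have "card (set R) - card (nb (set R) ?Z) \<le> card (set R - nb (set R) ?Z)"
      by (rule diff_card_le_card_Diff) simp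
    ultimately have "M \<le> card (A - cnb A ?Z)" using cR lR nbR Mm(1) by linarith
    moreover have "?Z \<subseteq> A" using ZY A'A by blast
    ultimately have "s < card (nb A ?Z)" using big by (intro conn) auto
    then show False using up size by linarith
  qed
  \<comment> \<open>\<open>3 * m\<close> covers the part sizes, of total \<open>m\<close>, and the
    waste \<open>k * M \<le> 2 * m\<close> of packing small components.\<close>
  have "card ?Y < 3 * m"
  proof (rule ccontr)
    assume "\<not> ?thesis"
    then have "sep ?Y L" using fA' comp Mm(2) by (intro sep_small_components[of _ M]) auto
    then show False using nosep sep_mono A'A by blast
  qed
  moreover have "card A \<le> card A' + card Q"
  proof -
    have "A \<subseteq> A' \<union> Q" by (auto simp: A'_def)
    then show ?thesis using fA' fin by (meson card_Un_le card_mono finite_UnI le_trans)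
  qed
  moreover have "card A' = card ?Y + length R"
    using RA fA' cR by (metis List.finite_set card_Diff_subset card_mono le_add_diff_inverse2)
  ultimately have longR: "n + 1 \<le> length R" using cQ size by linarith
  have a0: "a \<in> Len x y Q" using a[of 0] by simp
  then have "Suc a \<le> card Q" using pth_length_le[OF _ fin(1)] unfolding Len_def by fastforce
  \<comment> \<open>A chain path with \<open>Suc (a + t)\<close> vertices contributes
    \<open>a + t - 1\<close> inner vertices. Length \<open>n\<close> therefore requires
    \<open>length R' + t = n + 1 - a\<close>.\<close>
  then have q: "4 * m \<le> n + 1 - a" "n + 1 - a \<le> length R" "a \<le> n" using longR cQ size by linarith+
  have RinA: "pth A R" using R A'A pth_mono by blast
  obtain R' where R': "pth (set R) R'" "hd R' = hd R" "last R' = last R" "length R' \<le> n + 1 - a"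
    "n + 1 - a \<le> length R' + 4 * m" "even (n + 1 - a - length R')"
    by (rule shorten_path_even[OF nosep RinA q(1,2)]) blast
  define t where "t = n + 1 - a - length R'"
  have "a + t \<in> Len x y Q" using a R'(5,6) by (simp add: t_def)
  then obtain ps where ps: "pth Q ps" "hd ps = x" "last ps = y" "length ps = Suc (a + t)"
    unfolding Len_def by blast
  obtain ws where ws: "ps = x # ws @ [y]"
  proof -
    obtain p1 where p1: "ps = x # p1" using ps(1,2) by (cases ps) (auto simp: pth_def)
    then have "p1 \<noteq> []" using ps(3) xy by auto
    then show thesis using that[of "butlast p1"] p1 ps(3) by (metis append_butlast_last_id last_ConsR)
  qed
  have wsQ: "set ws \<subseteq> Q - {x, y}" "distinct ws" using ps(1) unfolding ws by (auto simp: pth_def)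
  have R'A: "set R' \<subseteq> A'" using R'(1) RA by (auto simp: pth_def)
  have sps: "successively E (x # ws @ [y])" using ps(1) ws by (simp add: pth_def)
  have R'e: "R' \<noteq> []" "hd R' = x" "last R' = y" "distinct R'" "successively E R'"
    using R' R by (auto simp: pth_def)
  let ?C = "R' @ rev ws"
  have "successively E ?C"
    using R'e sps unfolding successively_append_iff successively_E_rev
    by (auto simp: successively_Cons successively_append_iff hd_rev intro: E_sym)
  moreover have "E (last ?C) (hd ?C)"
    using R'e sps by (cases ws) (auto simp: successively_Cons last_rev intro: E_sym)
  moreover have "distinct ?C" using R'e wsQ R'A by (auto simp: A'_def)
  moreover have "set ?C \<subseteq> A" using R'A A'A wsQ sub by auto
  moreover have "length ?C = n" using ps(4) ws R'(4) q(3) R'e(1) by (auto simp: t_def)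
  ultimately show ?thesis unfolding has_cycle_def by blast
qed

end

section \<open>Paths of prescribed length\<close>

context sgraph begin

text \<open>The factor 4 beats the factor 3 that Posa ends satisfy for closed neighbourhoods. The
  range \<open>2 * x\<close> admits the union of two tight sets with fewer than \<open>x\<close>
  vertices each.\<close>

definition expands :: "nat \<Rightarrow> 'a set \<Rightarrow> bool" where
  "expands x S \<longleftrightarrow> (\<forall>X\<subseteq>S. card X \<le> 2 * x \<longrightarrow> 4 * card X \<le> card (cnb S X))"

lemma cnb_submodular:
  assumes "finite S"
  shows "card (cnb S (X \<union> Y)) + card (cnb S (X \<inter> Y)) \<le> card (cnb S X) + card (cnb S Y)"
proof -
  have "cnb S (X \<inter> Y) \<subseteq> cnb S X \<inter> cnb S Y" by (auto simp: cnb_def)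
  then have "card (cnb S (X \<inter> Y)) \<le> card (cnb S X \<inter> cnb S Y)" using assms by (intro card_mono) auto
  then show ?thesis unfolding cnb_Un
    using card_Un_Int[of "cnb S X" "cnb S Y"] assms by simp
qed

text \<open>Sets with equality in the expansion condition are closed under union, so that a vertex
  outside the neighbourhood of the largest one can be deleted without destroying the condition.\<close>
lemma safe_deletion:
  assumes fin: "finite S" and ex: "expands x S"
    and big: "\<And>X. X \<subseteq> S \<Longrightarrow> x \<le> card X \<Longrightarrow> card X \<le> 2 * x \<Longrightarrow> 4 * card X < card (cnb S X)"
  obtains Z where "Z \<subseteq> S" "card Z \<le> 4 * x" "\<And>e. e \<in> S - Z \<Longrightarrow> expands x (S - {e})"
proof -
  let ?t = "\<lambda>X. X \<subseteq> S \<and> card X \<le> 2 * x \<and> card (cnb S X) = 4 * card X"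
  have "?t {}" by (simp add: cnb_def)
  then obtain X where X: "?t X" and max: "\<And>Y. ?t Y \<Longrightarrow> card Y \<le> card X"
    using finite_arg_max_exists[of ?t "{}" card "2 * x"] by blast
  have small: "card Y < x" if "?t Y" for Y
    by (rule ccontr) (use big[of Y] that in simp)
  have sub: "Y \<subseteq> X" if Y: "?t Y" for Y
  proof -
    have fs: "finite X" "finite Y" using X Y fin finite_subset by auto
    have u: "card (X \<union> Y) \<le> 2 * x" using card_Un_le[of X Y] small[OF X] small[OF Y] by linarith
    have i: "card (X \<inter> Y) \<le> 2 * x" using u fs by (meson Un_upper1 Int_lower1 card_mono finite_UnI le_trans)
    have "4 * card (X \<union> Y) \<le> card (cnb S (X \<union> Y))" "4 * card (X \<inter> Y) \<le> card (cnb S (X \<inter> Y))"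
      using ex u i X Y unfolding expands_def by (meson Un_least Int_lower1 order_trans)+
    moreover have "card (X \<union> Y) + card (X \<inter> Y) = card X + card Y" using card_Un_Int[OF fs] by simp
    ultimately have "card (cnb S (X \<union> Y)) = 4 * card (X \<union> Y)"
      using cnb_submodular[OF fin, of X Y] X Y by linarith
    then have "card (X \<union> Y) \<le> card X" using max u X Y by (meson Un_least)
    then have "X \<union> Y = X" using fs by (metis Un_upper1 card_seteq finite_UnI)
    then show ?thesis by blast
  qed
  have "expands x (S - {e})" if e: "e \<in> S - cnb S X" for e
    unfolding expands_def
  proof (intro allI impI)
    fix Y assume Y: "Y \<subseteq> S - {e}" "card Y \<le> 2 * x"
    have YS: "Y \<subseteq> S" using Y by blast
    have ge: "4 * card Y \<le> card (cnb S Y)" using ex Y YS unfolding expands_def by blast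
    have eq: "cnb (S - {e}) Y = cnb S Y - {e}" by (auto simp: cnb_def)
    show "4 * card Y \<le> card (cnb (S - {e}) Y)"
    proof (cases "e \<in> cnb S Y")
      case False
      then show ?thesis using ge eq by simp
    next
      case True
      have "\<not> ?t Y"
      proof
        assume "?t Y"
        then have "cnb S Y \<subseteq> cnb S X" using sub by (intro cnb_mono) auto
        then show False using True e by blast
      qed
      then have "4 * card Y < card (cnb S Y)" using ge YS Y(2) by linarith
      then show ?thesis using True fin unfolding eq by (simp add: card_Diff_singleton)
    qed
  qed
  moreover have "card (cnb S X) \<le> 4 * x" using X small[OF X] by simp
  ultimately show thesis using that[OF cnb_subset] by blast
qed

text \<open>The ends of the rotations satisfy \<open>card (cnb S X) \<le> 3 * card X\<close>, which
  the expansion rules out up to size \<open>2 * x\<close>. So \<open>X\<close> is large, its closed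
  neighbourhood has almost \<open>c\<close> vertices, and \<open>X\<close> has about a third of
  that.\<close>

lemma ends_large:
  assumes fin: "finite W" and S: "S \<subseteq> W" "s \<in> S" "expands x S" "card (W - S) \<le> x"
    and big: "\<And>X. X \<subseteq> W \<Longrightarrow> x \<le> card X \<Longrightarrow> c \<le> card (cnb W X)"
    and P: "pth S P" "hd P = s" "\<And>Q. pth S Q \<Longrightarrow> hd Q = s \<Longrightarrow> length Q \<le> length P"
  obtains X where "X \<subseteq> set P" "c \<le> 3 * card X + x" "nb S X \<subseteq> set P"
    "\<And>e. e \<in> X \<Longrightarrow> \<exists>Q. pth S Q \<and> hd Q = s \<and> last Q = e \<and> length Q = length P"
proof -
  obtain X where X: "X \<subseteq> set P" "X \<noteq> {}" "nb S X \<subseteq> set P" "card (nb S X) \<le> 2 * card X"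
    "\<And>e. e \<in> X \<Longrightarrow> \<exists>Q. pth S Q \<and> hd Q = hd P \<and> last Q = e \<and> set Q = set P \<and> length Q = length P"
  proof (rule posa[OF P(1)])
    show "length Q \<le> length P" if "pth S Q" "hd Q = hd P" for Q using P(2,3) that by simp
  qed (rule that)
  have XS: "X \<subseteq> S" using X(1) P(1) by (auto simp: pth_def)
  have fS: "finite S" using S fin finite_subset by blast
  have cc: "card (cnb S X) \<le> 3 * card X" using card_cnb[OF fS XS] X(4) by simp
  have pos: "0 < card X" using X(2) XS fS by (meson card_gt_0_iff finite_subset)
  have "2 * x < card X"
  proof (rule ccontr)
    assume "\<not> ?thesis"
    then have "4 * card X \<le> card (cnb S X)" using S(3) XS unfolding expands_def by simp
    then show False using cc pos by linarith
  qed
  then have "c \<le> card (cnb W X)" using XS S by (intro big) auto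
  also have "cnb W X \<subseteq> cnb S X \<union> (W - S)" by (auto simp: cnb_def)
  then have "card (cnb W X) \<le> card (cnb S X) + card (W - S)"
    using fin fS by (meson card_Un_le card_mono finite_Diff finite_UnI finite_cnb le_trans)
  finally have "c \<le> 3 * card X + x" using cc S(4) by linarith
  then show thesis using that[of X] X(1,3,5) P(2) by blast
qed

text \<open>While the longest path from \<open>s\<close> is longer than \<open>p\<close>, rotate it
  to end in a vertex \<open>e\<close> that can be deleted safely, and delete \<open>e\<close> from
  both path and graph. When its length is exactly \<open>p\<close>, its rotations supply the many
  ends.\<close>

lemma exact_length_ends:
  assumes fin: "finite W" and x1: "1 \<le> x"
    and big: "\<And>X. X \<subseteq> W \<Longrightarrow> x \<le> card X \<Longrightarrow> c \<le> card (cnb W X)" and c: "20 * x \<le> c"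
    and p: "p + x = card W + 1"
    and S: "S \<subseteq> W" "s \<in> S" "expands x S" and P: "pth S P" "hd P = s" "p \<le> length P"
  shows "\<exists>X\<subseteq>W. c \<le> 3 * card X + x \<and> (\<forall>e\<in>X. \<exists>Q. pth W Q \<and> hd Q = s \<and> last Q = e \<and> length Q = p)"
  using S P
proof (induction "card S" arbitrary: S P rule: less_induct)
  case less
  have fS: "finite S" using less.prems(1) fin finite_subset by blast
  obtain R where R: "pth S R" "hd R = s" "\<And>Q. pth S Q \<Longrightarrow> hd Q = s \<Longrightarrow> length Q \<le> length R"
    by (rule longest_path_from[OF fS less.prems(2)]) blast
  have pR: "p \<le> length R" using R(3)[OF less.prems(4,5)] less.prems(6) by simp
  have "p \<le> card S" using pR pth_length_le[OF R(1) fS] by simp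
  then have WS: "card (W - S) \<le> x"
    using p card_Diff_subset[OF fS less.prems(1)] by linarith
  obtain X where X: "X \<subseteq> set R" "c \<le> 3 * card X + x" "nb S X \<subseteq> set R"
    "\<And>e. e \<in> X \<Longrightarrow> \<exists>Q. pth S Q \<and> hd Q = s \<and> last Q = e \<and> length Q = length R"
    by (rule ends_large[OF fin less.prems(1-3) WS big R]) (assumption, assumption, assumption, assumption, rule that)
  have XS: "X \<subseteq> S" using X(1) R(1) by (auto simp: pth_def)
  show ?case
  proof (cases "length R = p")
    case True
    have "\<exists>Q. pth W Q \<and> hd Q = s \<and> last Q = e \<and> length Q = p" if e: "e \<in> X" for e
    proof -
      obtain Q where Q: "pth S Q" "hd Q = s" "last Q = e" "length Q = length R" using X(4)[OF e] by blast
      then show ?thesis using True pth_mono[OF Q(1) less.prems(1)] by auto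
    qed
    moreover have "X \<subseteq> W" using XS less.prems(1) by blast
    ultimately show ?thesis using X(2) by auto
  next
    case False
    have bigS: "4 * card Y < card (cnb S Y)" if Y: "Y \<subseteq> S" "x \<le> card Y" "card Y \<le> 2 * x" for Y
    proof -
      have "c \<le> card (cnb W Y)" using Y less.prems(1) by (intro big) auto
      also have "cnb W Y \<subseteq> cnb S Y \<union> (W - S)" by (auto simp: cnb_def)
      then have "card (cnb W Y) \<le> card (cnb S Y) + card (W - S)"
        using fin fS by (meson card_Un_le card_mono finite_Diff finite_UnI finite_cnb le_trans)
      finally show ?thesis using c WS Y(3) x1 by linarith
    qed
    obtain Z where Z: "Z \<subseteq> S" "card Z \<le> 4 * x" "\<And>e. e \<in> S - Z \<Longrightarrow> expands x (S - {e})"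
      by (rule safe_deletion[OF fS less.prems(3) bigS]) (assumption, assumption, assumption, rule that)
    have fZ: "finite Z" using Z(1) fS finite_subset by blast
    \<comment> \<open>At most \<open>4 * x + 1\<close> vertices are forbidden, while
      \<open>20 * x \<le> c\<close> gives \<open>X\<close> at least \<open>19 * x / 3\<close>
      vertices.\<close>
    have "\<not> X \<subseteq> insert s Z"
    proof
      assume "X \<subseteq> insert s Z"
      then have "card X \<le> card (insert s Z)" using fZ by (intro card_mono) auto
      moreover have "card (insert s Z) \<le> 4 * x + 1" using fZ Z(2) by (simp add: card_insert_if)
      ultimately show False using X(2) c x1 by linarith
    qed
    then obtain e where e: "e \<in> X" "e \<noteq> s" "e \<in> S - Z" using XS by blast
    obtain Q where Q: "pth S Q" "hd Q = s" "last Q = e" "length Q = length R" using X(4)[OF e(1)] by blast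
    obtain Q' where Q': "Q = Q' @ [e]" using Q(1,3) by (metis append_butlast_last_id pth_def)
    have "Q' \<noteq> []" using Q' Q(2) e(2) by auto
    then have "pth (S - {e}) Q'" "hd Q' = s" using Q(1,2) unfolding Q' by (auto simp: pth_def successively_append_iff)
    moreover have "p \<le> length Q'" using Q(4) Q' pR False by simp
    moreover have "card (S - {e}) < card S" using e(3) fS by (meson DiffD1 card_Diff1_less)
    ultimately show ?thesis
      using less.hyps[of "S - {e}" Q'] less.prems(1,2) Z(3)[OF e(3)] e(2) by blast
  qed
qed

text \<open>Rotating a longest path keeps its vertex set \<open>T'\<close>. One end is rotated to
  any \<open>q\<close> in \<open>E1\<close>; after reversing the path, the other end is rotated with
  \<open>q\<close> fixed.\<close>

lemma flexible_path:
  assumes "finite T" "T \<noteq> {}"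
    and ex: "\<And>X. X \<subseteq> T \<Longrightarrow> X \<noteq> {} \<Longrightarrow> card X \<le> M \<Longrightarrow> 2 * card X < card (nb T X)"
  obtains T' E1 where "T' \<subseteq> T" "E1 \<subseteq> T'" "M \<le> card E1"
    "\<And>q. q \<in> E1 \<Longrightarrow> \<exists>E2\<subseteq>T'. M \<le> card E2 \<and>
       (\<forall>e\<in>E2. \<exists>Q. pth T Q \<and> hd Q = q \<and> last Q = e \<and> set Q = T')"
proof -
  obtain v where "v \<in> T" using assms(2) by blast
  then have "pth T [v]" by (simp add: pth_def)
  then obtain P where P: "pth T P" and max: "\<And>Q. pth T Q \<Longrightarrow> length Q \<le> length P"
    using finite_arg_max_exists[of "pth T" "[v]" length "card T"] pth_length_le[OF _ assms(1)] by metis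
  have ends: "\<exists>X\<subseteq>set P. M \<le> card X \<and>
      (\<forall>e\<in>X. \<exists>Q. pth T Q \<and> hd Q = hd R \<and> last Q = e \<and> set Q = set P \<and> length Q = length P)"
    if R: "pth T R" "length R = length P" "set R = set P" for R
  proof -
    obtain X where X: "X \<subseteq> set R" "X \<noteq> {}" "nb T X \<subseteq> set R" "card (nb T X) \<le> 2 * card X"
      "\<And>e. e \<in> X \<Longrightarrow> \<exists>Q. pth T Q \<and> hd Q = hd R \<and> last Q = e \<and> set Q = set R \<and> length Q = length R"
    proof (rule posa[OF R(1)])
      show "length Q \<le> length R" if "pth T Q" for Q using max[OF that] R(2) by simp
    qed (rule that)
    have "X \<subseteq> T" using X(1) R(1) by (auto simp: pth_def)
    then have "M < card X" using ex[of X] X(2,4) by (meson linorder_not_le)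
    then show ?thesis using X(1,5) R by (intro exI[of _ X]) auto
  qed
  obtain E1 where E1: "E1 \<subseteq> set P" "M \<le> card E1"
    "\<forall>e\<in>E1. \<exists>Q. pth T Q \<and> hd Q = hd P \<and> last Q = e \<and> set Q = set P \<and> length Q = length P"
    using ends[OF P] by blast
  have "\<exists>E2\<subseteq>set P. M \<le> card E2 \<and> (\<forall>e\<in>E2. \<exists>Q. pth T Q \<and> hd Q = q \<and> last Q = e \<and> set Q = set P)"
    if q: "q \<in> E1" for q
  proof -
    obtain Q where Q: "pth T Q" "last Q = q" "set Q = set P" "length Q = length P"
      using bspec[OF E1(3) q] by blast
    have "pth T (rev Q)" using Q(1) unfolding pth_rev .
    moreover have "hd (rev Q) = q" using Q(2) by (simp add: hd_rev)
    ultimately show ?thesis using ends[of "rev Q"] Q(3,4) by (metis length_rev set_rev)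
  qed
  moreover have "set P \<subseteq> T" using P by (simp add: pth_def)
  ultimately show thesis using that[of "set P" E1] E1 by blast
qed


section \<open>The cycle in a small cluster\<close>

lemma cycle_in_small_cluster:
  assumes finV: "finite V" and AV: "A \<subseteq> V" and nosep: "\<not> sep V (M # L')"
    and expand: "\<And>X. X \<subseteq> A \<Longrightarrow> M \<le> card X \<Longrightarrow> n \<le> card (cnb A X) + t"
    and IH: "\<And>S. S \<subseteq> V \<Longrightarrow> K0 \<le> card S \<Longrightarrow> sep S L'"
    and cV: "card V = K0 + (n - 1)"
    and cA: "n \<le> card A + t" "card A \<le> n + t" "card (nb V A) \<le> t" "1000 * t \<le> n" "M \<le> t" "1 \<le> M"
  shows "has_cycle V n"
proof -
  have finA: "finite A" using AV finV finite_subset by blast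
  have t1: "1 \<le> t" using cA by linarith
  have "100 * t \<le> card A" using cA by linarith
  \<comment> \<open>A reserve inside \<open>A\<close>, small against \<open>n\<close>. Once cleaned
    it carries the path with vertex set \<open>T'\<close> and variable ends that closes the
    cycle.\<close>
  then obtain T0 where T0: "T0 \<subseteq> A" "card T0 = 100 * t" "finite T0"
    using subset_with_card[OF finA] by metis
  have missA: "card (A - cnb A X) \<le> 2 * t" if "X \<subseteq> A" "M \<le> card X" for X
  proof -
    have "card (A - cnb A X) = card A - card (cnb A X)"
      using finA cnb_subset by (intro card_Diff_subset) auto
    then show ?thesis using expand[OF that] cA(2) by linarith
  qed
  have "2 * card X < card (nb T0 X)" if X: "X \<subseteq> T0" "M \<le> card X" "card X \<le> 2 * M" for X
  proof -
    have "T0 \<subseteq> cnb T0 X \<union> (A - cnb A X)" using T0(1) by (auto simp: cnb_def)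
    then have "card T0 \<le> card (cnb T0 X) + card (A - cnb A X)"
      using finA T0(3) by (meson card_Un_le card_mono finite_Diff finite_UnI finite_cnb le_trans)
    moreover have "card (A - cnb A X) \<le> 2 * t" using X T0(1) by (intro missA) auto
    moreover have "card (cnb T0 X) = card X + card (nb T0 X)" by (rule card_cnb[OF T0(3) X(1)])
    ultimately show ?thesis using X(3) cA T0(2) by linarith
  qed
  then obtain B where B: "B \<subseteq> T0" "card B < M"
    "\<forall>X. X \<subseteq> T0 - B \<longrightarrow> X \<noteq> {} \<longrightarrow> card X \<le> M \<longrightarrow> 2 * card X < card (nb (T0 - B) X)"
    using clean[OF T0(3) le_refl[of M], of 2] by auto
  define T where "T = T0 - B"
  have TA: "T \<subseteq> A" and finT: "finite T" and cT: "card T \<le> 100 * t" and Tne: "T \<noteq> {}"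
  proof -
    show "T \<subseteq> A" "finite T" using T0 by (auto simp: T_def)
    show "card T \<le> 100 * t" unfolding T_def using T0 by (metis Diff_subset card_mono)
    show "T \<noteq> {}" unfolding T_def using T0 B cA t1
      by (metis Diff_eq_empty_iff card_mono finite_subset le_trans linorder_not_le mult_le_mono1 one_le_numeral mult_1)
  qed
  obtain T' E1 where T': "T' \<subseteq> T" "E1 \<subseteq> T'" "M \<le> card E1"
    and flex: "\<And>q. q \<in> E1 \<Longrightarrow> \<exists>E2\<subseteq>T'. M \<le> card E2 \<and>
       (\<forall>e\<in>E2. \<exists>Q. pth T Q \<and> hd Q = q \<and> last Q = e \<and> set Q = T')"
    by (rule flexible_path[OF finT Tne, of M]) (use B(3) in \<open>auto simp: T_def\<close>)
  have T'A: "T' \<subseteq> A" and finT': "finite T'" and cT': "card T' \<le> 100 * t"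
    using T'(1) TA finT cT by (auto intro: finite_subset order_trans[OF card_mono])
  define A1 where "A1 = A - T'"
  define V1 where "V1 = V - T'"
  have fin: "finite A1" "finite V1" using finA finV by (auto simp: A1_def V1_def)
  have T'V: "T' \<subseteq> V" using T'A AV by blast
  have A1V: "A1 \<subseteq> V1" using AV by (auto simp: A1_def V1_def)
  have cA1: "card A1 = card A - card T'" "899 * t \<le> card A1"
  proof -
    show "card A1 = card A - card T'" unfolding A1_def using finT' T'A by (rule card_Diff_subset)
    then show "899 * t \<le> card A1" using cA cT' by linarith
  qed
  have cV1: "card V = card V1 + card T'"
    unfolding V1_def using finT' T'V finV by (metis card_Diff_subset card_mono le_add_diff_inverse2)
  have far: "card A1 < card (cnb A1 R) + M" if R: "R \<subseteq> V1" "K0 \<le> card R" for R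
  proof (rule ccontr)
    assume "\<not> ?thesis"
    moreover have "card (A1 - cnb A1 R) = card A1 - card (cnb A1 R)"
      using fin cnb_subset by (intro card_Diff_subset) auto
    ultimately have c: "M \<le> card (A1 - cnb A1 R)" by linarith
    have RV: "R \<subseteq> V" using R(1) by (auto simp: V1_def)
    have sR: "sep R L'" by (rule IH[OF RV R(2)])
    have disj: "R \<inter> cnb R (A1 - cnb A1 R) = {}" using E_sym by (auto simp: cnb_def)
    have sub: "A1 - cnb A1 R \<subseteq> V" using A1V by (auto simp: V1_def)
    have "sep V (M # L')" by (rule sep_Cons_I[OF sub _ c sR RV disj]) (use fin in simp)
    then show False using nosep by blast
  qed
  let ?ok = "\<lambda>R. R \<subseteq> V1 \<and> card (cnb A1 R) \<le> 100 * t"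
  \<comment> \<open>The weight is \<open>5 * card R\<close> minus the neighbourhood;
    \<open>card A1\<close> is added first so that the subtraction never truncates.\<close>
  let ?f = "\<lambda>R. 5 * card R + card A1 - card (cnb A1 R)"
  have le: "card (cnb A1 R) \<le> card A1" for R using fin cnb_subset by (intro card_mono) auto
  obtain R where R': "?ok R" and Rmax: "\<And>R'. ?ok R' \<Longrightarrow> ?f R' \<le> ?f R"
  proof (rule finite_arg_max_exists[of ?ok "{}" ?f "5 * card V1 + card A1"])
    show "?ok {}" by (simp add: cnb_def)
    show "?f R \<le> 5 * card V1 + card A1" if "?ok R" for R
      using card_mono[OF fin(2), of R] that by simp
  qed (rule that)
  have R: "R \<subseteq> V1" "card (cnb A1 R) \<le> 100 * t" using R' by auto
  have opt: "5 * card R' + card (cnb A1 R) \<le> 5 * card R + card (cnb A1 R')" if "?ok R'" for R'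
    using Rmax[OF that] le[of R] le[of R'] by linarith
  have finR: "finite R" using R(1) fin finite_subset by blast
  have cR: "card R < K0" using far[OF R(1)] R(2) cA1(2) cA(5) t1 by (cases "card R < K0") auto
  define W where "W = V1 - R"
  have finW: "finite W" using fin by (simp add: W_def)
  have cW: "card V1 = card W + card R"
    unfolding W_def using R(1) finR fin by (metis card_Diff_subset card_mono le_add_diff_inverse2)
  \<comment> \<open>These vertices see nothing of \<open>A1\<close>, so the optimal \<open>R\<close>
    contains them all. Hence \<open>W\<close> lies in \<open>A1\<close> and the outer neighbourhood
    of \<open>A\<close>, which bounds its size.\<close>
  define R0 where "R0 = V1 - (A \<union> nb V A)"
  have R0: "cnb A1 R0 = {}"
    using E_sym by (auto simp: cnb_def R0_def A1_def V1_def nb_def)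
  have finR0: "finite R0" using fin by (simp add: R0_def)
  have R0R: "R0 \<subseteq> R"
  proof -
    have e: "cnb A1 (R \<union> R0) = cnb A1 R" using R0 by (simp add: cnb_Un)
    have "?ok (R \<union> R0)" using R e by (auto simp: R0_def)
    from opt[OF this] have "card (R \<union> R0) \<le> card R" unfolding e by linarith
    then have "R \<union> R0 = R" using finR finR0 by (metis Un_upper1 card_seteq finite_UnI)
    then show ?thesis by blast
  qed
  have WA: "W \<subseteq> A1 \<union> nb V A" using R0R by (auto simp: W_def R0_def A1_def V1_def)
  have finN: "finite (nb V A)" using finV by simp
  have cN: "card (A1 \<union> nb V A) + card T' \<le> n + 2 * t"
  proof -
    have "card (A1 \<union> nb V A) \<le> card A1 + t" using card_Un_le[of A1 "nb V A"] cA(3) by linarith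
    moreover have "card A1 + card T' = card A"
      using cA1(1) card_mono[OF finA T'A] by linarith
    ultimately show ?thesis using cA(2) by linarith
  qed
  have W1: "card W + card T' \<le> n + 2 * t"
    using card_mono[OF _ WA] fin finN cN by (metis add_le_mono1 finite_UnI le_trans)
  have W2: "n \<le> card W + card T'" using cR cV cV1 cW by linarith
  \<comment> \<open>The vertices outside \<open>R\<close> number \<open>n - 1 + x\<close>,
    equivalently \<open>card R + x = K0\<close>. Adding any \<open>x\<close> vertices of
    \<open>W\<close> to \<open>R\<close> therefore reaches the size needed for
    \<open>far\<close>.\<close>
  define x where "x = card W + card T' + 1 - n"
  have x: "1 \<le> x" "x \<le> 3 * t" "card R + x = K0"
    using W1 W2 cV cV1 cW t1 cA(4) unfolding x_def by linarith+
  \<comment> \<open>Comparison with \<open>R0\<close>: the two sets differ by at most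
    \<open>2 * t\<close> vertices, each of weight 5.\<close>
  have cNR: "card (cnb A1 R) \<le> 10 * t"
  proof -
    have "?ok R0" using R0 by (auto simp: R0_def)
    from opt[OF this] have 1: "5 * card R0 + card (cnb A1 R) \<le> 5 * card R" using R0 by simp
    have "V1 \<subseteq> R0 \<union> (A1 \<union> nb V A)" by (auto simp: R0_def A1_def V1_def)
    then have "card V1 \<le> card R0 + card (A1 \<union> nb V A)"
      using finR0 fin finN by (meson card_Un_le card_mono finite_UnI le_trans)
    then show ?thesis using 1 cN cW W2 by linarith
  qed
  have new: "cnb A1 (R \<union> X) \<subseteq> cnb A1 R \<union> cnb W X" if "X \<subseteq> W" for X
  proof
    fix v assume v: "v \<in> cnb A1 (R \<union> X)"
    show "v \<in> cnb A1 R \<union> cnb W X"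
    proof (cases "v \<in> cnb A1 R")
      case False
      then have "v \<notin> R" "v \<in> A1" "v \<in> cnb A1 X" using v unfolding cnb_Un by (auto simp: cnb_def)
      then show ?thesis using A1V by (auto simp: cnb_def W_def)
    qed simp
  qed
  have cnew: "card (cnb A1 (R \<union> X)) \<le> card (cnb A1 R) + card (cnb W X)" if "X \<subseteq> W" for X
    using card_mono[OF _ new[OF that]] fin finW card_Un_le[of "cnb A1 R" "cnb W X"]
    by (meson finite_UnI finite_cnb le_trans)
  have cRX: "card (R \<union> X) = card R + card X" if "X \<subseteq> W" for X
    using that finR finW by (intro card_Un_disjoint) (auto simp: W_def intro: finite_subset)
  have exW: "expands x W"
    unfolding expands_def
  proof (intro allI impI)
    fix X assume X: "X \<subseteq> W" "card X \<le> 2 * x"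
    have RX: "R \<union> X \<subseteq> V1" using R(1) X(1) by (auto simp: W_def)
    show "4 * card X \<le> card (cnb W X)"
    proof (cases "card (cnb A1 (R \<union> X)) \<le> 100 * t")
      case True
      then show ?thesis using opt[of "R \<union> X"] RX cnew[OF X(1)] cRX[OF X(1)] by linarith
    next
      \<comment> \<open>If the cap is exceeded, \<open>X\<close> itself contributes more than
        \<open>90 * t\<close>, well above \<open>4 * card X \<le> 24 * t\<close>.\<close>
      case False
      then show ?thesis using cnew[OF X(1)] cNR X(2) x(2) by linarith
    qed
  qed
  have big0: "card A1 < card (cnb A1 (R \<union> X)) + M" if X: "X \<subseteq> W" "x \<le> card X" for X
    using cRX[OF X(1)] X(2) x(3) R(1) X(1) by (intro far) (auto simp: W_def)
  have bigW: "card A1 - 11 * t \<le> card (cnb W X)" if X: "X \<subseteq> W" "x \<le> card X" for X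
    using big0[OF X] cnew[OF X(1)] cNR cA(5) by linarith
  have bigA: "card A1 \<le> card (cnb A1 X) + 11 * t" if X: "X \<subseteq> W" "x \<le> card X" for X
  proof -
    have "card (cnb A1 (R \<union> X)) \<le> card (cnb A1 R) + card (cnb A1 X)" unfolding cnb_Un by (rule card_Un_le)
    then show ?thesis using big0[OF X] cNR cA(5) by linarith
  qed
  have meet: "S \<inter> C \<noteq> {}" if "S \<subseteq> D" "finite D" "card (D - C) < card S" for S C D :: "'a set"
  proof
    assume "S \<inter> C = {}"
    then have "S \<subseteq> D - C" using that(1) by blast
    then show False using that(2,3) card_mono[of "D - C" S] by simp
  qed
  have E1A: "E1 \<subseteq> A" using T'(2) T'A by blast
  obtain s q where sq: "s \<in> W" "s \<in> A1" "q \<in> E1" "E q s"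
  proof -
    have "card (R \<inter> A1) \<le> card (cnb A1 R)" using fin by (intro card_mono) (auto simp: cnb_def)
    moreover have "card A1 - card (R \<inter> A1) = card (A1 - R)"
      using fin by (metis Int_commute card_Diff_subset_Int finite_Int)
    ultimately have "2 * t < card (A1 - R)" using cNR cA1(2) t1 by linarith
    then have "(A1 - R) \<inter> cnb A E1 \<noteq> {}"
      using missA[OF E1A T'(3)] finA by (intro meet[of _ A]) (auto simp: A1_def)
    then obtain s where s: "s \<in> A1 - R" "s \<in> cnb A E1" by blast
    have "s \<notin> E1" using s(1) T'(2) by (auto simp: A1_def)
    then obtain q where "q \<in> E1" "E q s" using s(2) by (auto simp: cnb_def)
    moreover have "s \<in> W" using s(1) A1V by (auto simp: W_def)
    ultimately show thesis using that s by blast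
  qed
  define p where "p = n - card T'"
  have p: "p + x = card W + 1" "p + card T' = n" using W2 cT' cA(4) unfolding p_def x_def by linarith+
  obtain P where P: "pth W P" "hd P = s" "\<And>Q. pth W Q \<Longrightarrow> hd Q = s \<Longrightarrow> length Q \<le> length P"
    by (rule longest_path_from[OF finW sq(1)]) blast
  have WWx: "card (W - W) \<le> x" by simp
  obtain X where X: "X \<subseteq> set P" "card A1 - 11 * t \<le> 3 * card X + x" "nb W X \<subseteq> set P"
    by (rule ends_large[OF finW order_refl sq(1) exW WWx bigW P]) blast
  have XW: "X \<subseteq> W" using X(1) P(1) by (auto simp: pth_def)
  have inA1: "card X \<le> card (X \<inter> A1) + t" if "X \<subseteq> W" for X
  proof -
    have "X \<subseteq> (X \<inter> A1) \<union> nb V A" using that WA by blast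
    then have "card X \<le> card (X \<inter> A1) + card (nb V A)"
      using fin finN by (meson card_Un_le card_mono finite_Int finite_UnI le_trans)
    then show ?thesis using cA(3) by linarith
  qed
  \<comment> \<open>A path missing at least \<open>x\<close> vertices of \<open>W\<close> would have
    almost all of \<open>A1\<close> adjacent to or among the missed vertices. Some rotation end in
    \<open>A1\<close> would then have a neighbour off the path, against
    \<open>nb W X \<subseteq> set P\<close>.\<close>
  have pP: "p \<le> length P"
  proof (rule ccontr)
    assume short: "\<not> ?thesis"
    let ?Y = "W - set P"
    have "set P \<subseteq> W" "card (set P) = length P" using P(1) by (auto simp: pth_def distinct_card)
    then have "card ?Y = card W - length P" by (metis List.finite_set card_Diff_subset)
    then have "x \<le> card ?Y" using short p(1) by linarith
    then have "card A1 \<le> card (cnb A1 ?Y) + 11 * t" by (intro bigA) auto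
    moreover have "card (A1 - cnb A1 ?Y) = card A1 - card (cnb A1 ?Y)"
      using fin cnb_subset by (intro card_Diff_subset) auto
    ultimately have "card (A1 - cnb A1 ?Y) \<le> 11 * t" by linarith
    moreover have "12 * t \<le> card (X \<inter> A1)" using inA1[OF XW] X(2) cA1(2) x(2) by linarith
    ultimately have "(X \<inter> A1) \<inter> cnb A1 ?Y \<noteq> {}" using t1 fin by (intro meet[of _ A1]) auto
    then obtain e where e: "e \<in> X" "e \<in> cnb A1 ?Y" by blast
    then obtain y where y: "y \<in> ?Y" "E y e" using X(1) by (auto simp: cnb_def)
    then have "y \<in> nb W X" using e X(1) E_sym by (auto simp: nb_def)
    then show False using X(3) y by blast
  qed
  have "20 * x \<le> card A1 - 11 * t" using x(2) cA1(2) by linarith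
  from exact_length_ends[OF finW x(1) bigW this p(1) order_refl sq(1) exW P(1,2) pP]
  obtain X' where X': "X' \<subseteq> W" "card A1 - 11 * t \<le> 3 * card X' + x"
    "\<forall>e\<in>X'. \<exists>Q. pth W Q \<and> hd Q = s \<and> last Q = e \<and> length Q = p" by blast
  obtain E2 where E2: "E2 \<subseteq> T'" "M \<le> card E2"
    "\<forall>e\<in>E2. \<exists>Q. pth T Q \<and> hd Q = q \<and> last Q = e \<and> set Q = T'" using flex[OF sq(3)] by blast
  have E2A: "E2 \<subseteq> A" using E2(1) T'A by blast
  have "3 * t \<le> card (X' \<inter> A1)" using inA1[OF X'(1)] X'(2) cA1(2) x(2) by linarith
  then have "(X' \<inter> A1) \<inter> cnb A E2 \<noteq> {}"
    using missA[OF E2A E2(2)] t1 finA by (intro meet[of _ A]) (auto simp: A1_def)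
  then obtain e where e: "e \<in> X'" "e \<in> A1" "e \<in> cnb A E2" by blast
  have "e \<notin> E2" using e(2) E2(1) by (auto simp: A1_def)
  then obtain f where f: "f \<in> E2" "E f e" using e(3) by (auto simp: cnb_def)
  obtain Qs where Qs: "pth W Qs" "hd Qs = s" "last Qs = e" "length Qs = p" using X'(3) e(1) by blast
  obtain Qt where Qt: "pth T Qt" "hd Qt = q" "last Qt = f" "set Qt = T'" using E2(3) f(1) by blast
  let ?C = "Qt @ rev Qs"
  have ne: "Qs \<noteq> []" "Qt \<noteq> []" using Qs Qt by (auto simp: pth_def)
  have "successively E ?C"
    unfolding successively_append_iff successively_E_rev hd_rev using Qs Qt f(2) by (simp add: pth_def)
  moreover have "distinct ?C" using Qs(1) Qt(1,4) by (auto simp: pth_def W_def V1_def)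
  moreover have "set ?C \<subseteq> V" using Qs(1) Qt(4) T'V by (auto simp: pth_def W_def V1_def)
  moreover have "length ?C = n"
  proof -
    have "length Qt = card T'" using Qt(1,4) by (metis distinct_card pth_def)
    then show ?thesis using Qs(4) p(2) by simp
  qed
  moreover have "E (last ?C) (hd ?C)" using ne Qs(2) Qt(2) sq(4) E_sym by (simp add: last_rev)
  ultimately show ?thesis unfolding has_cycle_def by blast
qed

end

section \<open>The induction\<close>

lemma pow2_above:
  fixes a :: nat assumes "1 \<le> a"
  obtains r where "a \<le> 2 ^ r" "2 ^ r \<le> 2 * a"
proof -
  define r where "r = (LEAST r. a \<le> 2 ^ r)"
  have "a \<le> 2 ^ a" by (simp add: less_imp_le)
  then have 1: "a \<le> 2 ^ r" unfolding r_def by (rule LeastI)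
  have "(2::nat) ^ r \<le> 2 * a"
  proof (cases r)
    case 0
    then show ?thesis using assms by simp
  next
    case (Suc q)
    then have "\<not> a \<le> 2 ^ q" using not_less_Least[of q "\<lambda>r. a \<le> 2 ^ r"] unfolding r_def by simp
    then show ?thesis using Suc by simp
  qed
  then show thesis using that 1 by blast
qed

text \<open>The chain spends on the order of \<open>lam ^ 3\<close> vertices in its first phase;
  this makes that linear in \<open>M\<close>.\<close>

lemma cube_le_pow2: "(r + 2) ^ 3 \<le> 16 * 2 ^ r" for r :: nat
proof (induction r)
  case (Suc r)
  show ?case
  proof (cases "r \<le> 1")
    case True
    then have "r = 0 \<or> r = 1" by linarith
    then show ?thesis by (auto simp: power3_eq_cube)
  next
    case False
    define a where "a = r + 2"
    have a: "4 \<le> a" using False by (simp add: a_def)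
    have "3 * a ^ 2 + 3 * a + 1 \<le> a ^ 3"
    proof -
      have "4 * a ^ 2 \<le> a * a ^ 2" using a by (rule mult_le_mono1)
      moreover have "4 * a \<le> a * a" using a by (rule mult_le_mono1)
      moreover have "a ^ 3 = a * a ^ 2" "a * a = a ^ 2" by (simp_all add: power3_eq_cube power2_eq_square)
      ultimately show ?thesis using a by linarith
    qed
    moreover have "(a + 1) ^ 3 = a ^ 3 + 3 * a ^ 2 + 3 * a + 1"
      by (simp add: power3_eq_cube power2_eq_square algebra_simps)
    ultimately have "(a + 1) ^ 3 \<le> 2 * a ^ 3" by linarith
    also have "\<dots> \<le> 2 * (16 * 2 ^ r)" using Suc.IH by (simp add: a_def)
    finally show ?thesis by (simp add: a_def)
  qed
qed (simp add: power3_eq_cube)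

text \<open>The first bound is the size condition of the large cluster with \<open>qmax\<close>
  unfolded at \<open>4 * m\<close> and \<open>b = 2000 * m\<close>.\<close>

lemma large_cluster_sizes:
  fixes M m r :: nat
  assumes "2 ^ r \<le> 2 * M" "1 \<le> M" "M \<le> m"
  defines "lam \<equiv> 2 * r + 4"
  shows "1 + Suc (3 * lam * (lam + 1)) * lam + 3 * (4 * m + lam) + lam + 4 * m + lam + M + 2 \<le> 2000 * m"
    and "lam \<le> 6 * M"
proof -
  have e: "lam = 2 * (r + 2)" by (simp add: lam_def)
  have "lam ^ 3 = 2 ^ 3 * (r + 2) ^ 3" unfolding e by (rule power_mult_distrib)
  then have c: "lam ^ 3 \<le> 256 * M" using cube_le_pow2[of r] assms(1) by simp
  have l4: "4 \<le> lam" by (simp add: lam_def)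
  have sq: "4 * lam ^ 2 \<le> lam ^ 3" using mult_le_mono1[OF l4, of "lam ^ 2"]
    by (simp add: power3_eq_cube power2_eq_square algebra_simps)
  have "4 * lam \<le> lam ^ 2" using mult_le_mono1[OF l4, of lam] by (simp add: power2_eq_square)
  then have ll: "16 * lam \<le> lam ^ 3" using sq by linarith
  have "Suc (3 * lam * (lam + 1)) * lam = 3 * lam ^ 3 + 3 * lam ^ 2 + lam"
    by (simp add: power3_eq_cube power2_eq_square algebra_simps)
  then have z: "Suc (3 * lam * (lam + 1)) * lam \<le> 4 * lam ^ 3 + lam" using sq by linarith
  have aux: "1 + z + 3 * (4 * m + v) + v + 4 * m + v + M + 2 \<le> 2000 * m"
    if zw: "z \<le> 4 * w + v" "w \<le> 256 * M" "16 * v \<le> w" for z v w :: nat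
  proof -
    have "z + 5 * v \<le> 5 * w" using zw by linarith
    then have "z + 5 * v \<le> 1280 * m" using zw(2) assms(3) by linarith
    moreover have "1 + z + 3 * (4 * m + v) + v + 4 * m + v + M + 2 = (z + 5 * v) + 16 * m + M + 3" by simp
    ultimately show ?thesis using assms(2,3) by linarith
  qed
  show "1 + Suc (3 * lam * (lam + 1)) * lam + 3 * (4 * m + lam) + lam + 4 * m + lam + M + 2 \<le> 2000 * m"
    by (rule aux[OF z c ll])
  have "r < 2 ^ r" by simp
  then show "lam \<le> 6 * M" unfolding lam_def using assms(1,2) by linarith
qed

context sgraph begin

text \<open>The induction splits off the smallest size \<open>M\<close> of \<open>ms\<close>, while
  the overall smallest size \<open>m1\<close> stays last and is the base case. \<open>s\<close> is
  the separator threshold and \<open>l\<close> bounds the number of halvings.\<close>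

theorem separated_or_cycle:
  assumes "2000 * mm \<le> s" "1000 * (l * s) \<le> n"
    and "sorted ms" "\<forall>a\<in>set ms. m1 \<le> a" "1 \<le> m1" "sum_list ms + m1 \<le> mm" "2 * (length ms + 1) \<le> 2 ^ l"
    and "finite V" "card V = length ms * (n - 1) + m1"
  shows "sep V (ms @ [m1]) \<or> has_cycle V n"
  using assms(3-)
proof (induction ms arbitrary: V)
  case Nil
  then show ?case by auto
next
  case (Cons M ms)
  define L' where "L' = ms @ [m1]"
  define K0 where "K0 = length ms * (n - 1) + m1"
  let ?L = "M # L'"
  let ?k = "length ms + 2"
  show ?case
  proof (rule ccontr)
    assume neg: "\<not> ?case"
    have nosep: "\<not> sep V ?L" and nocyc: "\<not> has_cycle V n" using neg by (auto simp: L'_def)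
    have finV: "finite V" and cV: "card V = K0 + (n - 1)" using Cons.prems by (auto simp: K0_def)
    have M1: "1 \<le> M" "m1 \<le> M" using Cons.prems by auto
    have m: "sum_list ?L \<le> mm" "1 \<le> sum_list ?L" using Cons.prems by (auto simp: L'_def)
    have Mm: "M \<le> sum_list ?L" by simp
    have kM: "?k * M \<le> 2 * sum_list ?L"
    proof -
      have "\<forall>a\<in>set ms. M \<le> a" using Cons.prems(1) by simp
      then have "length ms * M \<le> sum_list ms" by (induction ms) auto
      then show ?thesis by (simp add: L'_def)
    qed
    have l1: "1 \<le> l"
    proof (rule ccontr)
      assume "\<not> ?thesis"
      then have "l = 0" by simp
      then show False using Cons.prems(5) by simp
    qed
    define t where "t = l * s"
    have st: "s \<le> t" using l1 by (simp add: t_def)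
    have nt: "1000 * t \<le> n" using assms(2) by (simp add: t_def)
    have s2: "2000 * sum_list ?L \<le> s" using assms(1) m(1) by linarith
    have IH: "sep S L'" if S: "S \<subseteq> V" "K0 \<le> card S" for S
    proof -
      have "finite S" using S(1) finV finite_subset by blast
      then obtain S' where S': "S' \<subseteq> S" "card S' = K0" "finite S'" using subset_with_card S(2) by metis
      have "sep S' (ms @ [m1]) \<or> has_cycle S' n"
        using Cons.prems S' by (intro Cons.IH) (auto simp: K0_def)
      moreover have "\<not> has_cycle S' n" using nocyc has_cycle_mono S' S by blast
      ultimately show ?thesis using sep_mono S'(1) by (auto simp: L'_def)
    qed
    \<comment> \<open>Otherwise deleting the closed neighbourhood leaves \<open>K0\<close> vertices,
      and \<open>X\<close> joins the family that \<open>IH\<close> finds there.\<close>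
    have F1: "n \<le> card (cnb V X)" if X: "X \<subseteq> V" "M \<le> card X" for X
    proof (rule ccontr)
      assume "\<not> ?thesis"
      moreover have "card (V - cnb V X) = card V - card (cnb V X)"
        using finV cnb_subset by (intro card_Diff_subset) auto
      ultimately have "K0 \<le> card (V - cnb V X)" using cV by linarith
      then have "sep (V - cnb V X) L'" by (intro IH) auto
      moreover have "finite X" using X finV finite_subset by blast
      ultimately have "sep V ?L" using X by (intro sep_Cons_I[of X V M "V - cnb V X"]) (auto simp: cnb_def)
      then show False using nosep by blast
    qed
    \<comment> \<open>\<open>i\<close> halvings have been made, each adding at most \<open>s\<close>
      outer neighbours. A maximal \<open>i\<close> means that no further halving is
      possible.\<close>
    let ?ok = "\<lambda>i. i \<le> l \<and> (\<exists>A\<subseteq>V. M \<le> card A \<and> card A * 2 ^ i \<le> card V \<and> card (nb V A) \<le> i * s)"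
    have ok0: "?ok 0"
    proof -
      have "M \<le> card V" using cV s2 st nt Mm M1(1) by linarith
      moreover have "nb V V = {}" by (auto simp: nb_def)
      ultimately show ?thesis by (intro conjI exI[of _ V]) auto
    qed
    obtain i where i: "?ok i" and imax: "\<And>j. ?ok j \<Longrightarrow> j \<le> i"
      using finite_arg_max_exists[of ?ok 0 "\<lambda>i. i" l] ok0 by blast
    obtain A where A: "A \<subseteq> V" "M \<le> card A" "card A * 2 ^ i \<le> card V" "card (nb V A) \<le> i * s"
      using i by blast
    have finA: "finite A" using A(1) finV finite_subset by blast
    have il: "i * s \<le> t" using i by (simp add: t_def)
    have nA: "n \<le> card A + card (nb V A)"
    proof -
      have "cnb V A = A \<union> nb V A" by (rule cnb_eq[OF A(1)])
      then show ?thesis using F1[OF A(1,2)] card_Un_le[of A "nb V A"] by simp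
    qed
    have i_less: "i < l"
    proof (rule ccontr)
      assume "\<not> ?thesis"
      then have "i = l" using i by simp
      have "n \<le> 2 * card A" using nA A(4) il nt by linarith
      then have "n * ?k \<le> 2 * card A * ?k" by (rule mult_le_mono1)
      also have "\<dots> = card A * (2 * ?k)" by simp
      also have "\<dots> \<le> card A * 2 ^ l" using Cons.prems(5) by (intro mult_le_mono2) simp
      also have "\<dots> \<le> card V" using A(3) \<open>i = l\<close> by simp
      finally have le: "n * ?k \<le> card V" .
      have "card V \<le> (length ms + 1) * n + m1" unfolding cV K0_def by (simp add: algebra_simps diff_mult_distrib2)
      moreover have "m1 < n" using M1 Mm s2 st nt by linarith
      ultimately show False using le by (simp add: algebra_simps)
    qed
    have key: "card (nb V A) + s < card (nb V X)" if X: "X \<subseteq> A" "M \<le> card X" "2 * card X \<le> card A" for X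
    proof (rule ccontr)
      assume "\<not> ?thesis"
      then have "card (nb V X) \<le> Suc i * s" using A(4) by simp
      moreover have "card X * 2 ^ Suc i \<le> card V"
      proof -
        have "card X * 2 ^ Suc i = (2 * card X) * 2 ^ i" by simp
        also have "\<dots> \<le> card A * 2 ^ i" using X(3) by (rule mult_le_mono1)
        finally show ?thesis using A(3) by linarith
      qed
      ultimately have "?ok (Suc i)" using i_less X A(1) by (intro conjI exI[of _ X]) auto
      then show False using imax[of "Suc i"] by simp
    qed
    have expand: "n \<le> card (cnb A X) + t" if X: "X \<subseteq> A" "M \<le> card X" for X
    proof -
      have "cnb V X \<subseteq> cnb A X \<union> nb V A" using X(1) by (auto simp: cnb_def nb_def)
      then have "card (cnb V X) \<le> card (cnb A X) + card (nb V A)"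
        using finA finV by (meson card_Un_le card_mono finite_UnI finite_cnb finite_nb le_trans)
      moreover have "n \<le> card (cnb V X)" using X A(1) by (intro F1) auto
      ultimately show ?thesis using A(4) il by linarith
    qed
    define b where "b = 2000 * sum_list ?L"
    have bs: "b \<le> s" using s2 by (simp add: b_def)
    show False
    proof (cases "n + b \<le> card A")
      case False
      have "has_cycle V n"
      proof (rule cycle_in_small_cluster[OF finV A(1) nosep expand IH cV])
        show "n \<le> card A + t" using nA A(4) il by linarith
        show "card A \<le> n + t" using False bs st by linarith
        show "card (nb V A) \<le> t" using A(4) il by linarith
        show "M \<le> t" using Mm s2 st by linarith
      qed (use nt M1 in auto)
      then show False using nocyc by blast
    next
      case True
      obtain r where r: "M \<le> 2 ^ r" "2 ^ r \<le> 2 * M" using pow2_above[OF M1(1)] by blast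
      note sizes = large_cluster_sizes[OF r(2) M1(1) Mm]
      have len: "length ?L = ?k" by (simp add: L'_def)
      have nosepA: "\<not> sep A ?L" using nosep sep_mono A(1) by blast
      \<comment> \<open>\<open>C.lam \<le> 6 * M\<close> bounds the last factor by
        \<open>8 * M\<close>, and \<open>kM\<close> turns the product into
        \<open>40 * 16 = 640\<close> times the sum.\<close>
      have bud: "b + 4 * (10 * length ?L) * (2 * M + (2 * r + 4)) < n - t"
      proof -
        have "?k * (2 * M + (2 * r + 4)) \<le> ?k * (8 * M)" using sizes(2) by (intro mult_le_mono2) simp
        also have "\<dots> = 8 * (?k * M)" by simp
        finally have "?k * (2 * M + (2 * r + 4)) \<le> 16 * sum_list ?L" using kM by linarith
        then have "4 * (10 * length ?L) * (2 * M + (2 * r + 4)) \<le> 640 * sum_list ?L"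
          unfolding len by (simp only: mult.assoc)
        then show ?thesis using s2 st nt m(2) unfolding b_def by linarith
      qed
      interpret C: cluster E A ?L M r b "n - t"
      proof (unfold_locales)
        show "n - t \<le> card (cnb A X)" if "X \<subseteq> A" "M \<le> card X" for X
          using expand[OF that] by linarith
        show "sum_list ?L + b + M \<le> n - t" using Mm s2 st nt m(2) unfolding b_def by linarith
        show "n - t \<le> card A" using nA A(4) il by linarith
        show "2 \<le> length ?L" by (simp add: L'_def)
      qed (use finA nosepA M1 r bud in auto)
      have conn: "s < card (nb A Z)" if Z: "Z \<subseteq> A" "M \<le> card Z" "M \<le> card (A - cnb A Z)" for Z
      proof -
        have gen: "s < card (nb A X)" if X: "X \<subseteq> A" "M \<le> card X" "2 * card X \<le> card A" for X
        proof -
          have "nb V X \<subseteq> nb A X \<union> nb V A" using X(1) by (auto simp: nb_def)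
          then have "card (nb V X) \<le> card (nb A X) + card (nb V A)"
            using finA finV by (meson card_Un_le card_mono finite_UnI finite_nb le_trans)
          then show ?thesis using key[OF X] by linarith
        qed
        \<comment> \<open>Of two separated sides one has at most half of \<open>A\<close>, and the
          outer neighbours of either are bounded by those of \<open>Z\<close>.\<close>
        let ?Y = "A - cnb A Z"
        have "card Z + card ?Y \<le> card A"
        proof -
          have "card (Z \<union> ?Y) = card Z + card ?Y"
            using Z(1) finA by (intro card_Un_disjoint) (auto simp: cnb_def intro: finite_subset)
          moreover have "card (Z \<union> ?Y) \<le> card A" using Z(1) finA by (intro card_mono) auto
          ultimately show ?thesis by simp
        qed
        then consider "2 * card Z \<le> card A" | "2 * card ?Y \<le> card A" by linarith
        then show ?thesis
        proof cases
          case 1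
          then show ?thesis using gen Z by blast
        next
          case 2
          have "s < card (nb A ?Y)" using gen[of ?Y] Z(3) 2 by blast
          moreover have "nb A ?Y \<subseteq> nb A Z" using E_sym by (auto simp: nb_def cnb_def)
          then have "card (nb A ?Y) \<le> card (nb A Z)" using finA by (intro card_mono) auto
          ultimately show ?thesis by linarith
        qed
      qed
      have "has_cycle A n"
      proof (rule C.cycle_in_large_cluster[of s, OF conn])
        show "C.qmax (4 * sum_list ?L) + 4 * sum_list ?L + C.lam + M + 2 \<le> b"
          using sizes(1) unfolding C.qmax_def C.lam_def b_def by linarith
        show "length ?L * M \<le> 2 * sum_list ?L" using kM unfolding len .
        show "b \<le> n" using bs st nt by linarith
        show "b + 4 * sum_list ?L + M \<le> n - t" using Mm s2 st nt m(2) unfolding b_def by linarith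
      qed (use Mm bs True in auto)
      then show False using nocyc has_cycle_mono A(1) by blast
    qed
  qed
qed

end

section \<open>Ramsey numbers\<close>

lemma proper_colouring_exists:
  assumes "graph V E" obtains c where "proper_colouring V E (chromatic_number V E) c"
proof -
  have fin: "finite V" and irr: "\<And>u v. E u v \<Longrightarrow> u \<noteq> v" using assms unfolding graph_def by blast+
  have "proper_colouring V E (Suc (Max (insert 0 V))) (\<lambda>v. v)"
    unfolding proper_colouring_def using fin irr by (auto simp: less_Suc_eq_le)
  then have "\<exists>k c. proper_colouring V E k c" by blast
  then have "\<exists>c. proper_colouring V E (chromatic_number V E) c"
    unfolding chromatic_number_def by (rule LeastI_ex)
  then show thesis using that by blast
qed

lemma colour_class_nonempty:
  assumes G: "graph V E" and c: "proper_colouring V E (chromatic_number V E) c"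
    and i: "i < chromatic_number V E"
  shows "\<exists>v\<in>V. c v = i"
proof (rule ccontr)
  assume none: "\<not> ?thesis"
  let ?k = "chromatic_number V E"
  let ?c = "\<lambda>v. if c v = ?k - 1 then i else c v"
  have VE: "u \<in> V" "v \<in> V" if "E u v" for u v using G that unfolding graph_def by blast+
  have "proper_colouring V E (?k - 1) ?c"
    unfolding proper_colouring_def
  proof (intro conjI ballI allI impI)
    fix v assume v: "v \<in> V"
    then have "c v < ?k" "c v \<noteq> i" using c none unfolding proper_colouring_def by auto
    then show "?c v < ?k - 1" using i by auto
  next
    fix u v assume e: "E u v"
    then have "c u \<noteq> c v" "c u \<noteq> i" "c v \<noteq> i" using c none VE unfolding proper_colouring_def by auto
    then show "?c u \<noteq> ?c v" by auto
  qed
  then have "?k \<le> ?k - 1" unfolding chromatic_number_def[of V E] by (intro Least_le) blast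
  then show False using i by simp
qed

lemma chromatic_number_pos:
  assumes "graph V E" "V \<noteq> {}" shows "0 < chromatic_number V E"
proof -
  obtain c where "proper_colouring V E (chromatic_number V E) c" using proper_colouring_exists assms(1) by blast
  then show ?thesis using assms(2) unfolding proper_colouring_def by fastforce
qed

lemma sigma_colouring:
  assumes "graph V E" "V \<noteq> {}"
  obtains c i where "proper_colouring V E (chromatic_number V E) c" "i < chromatic_number V E"
    "card {v\<in>V. c v = i} = sigma V E"
proof -
  obtain c where "proper_colouring V E (chromatic_number V E) c" using proper_colouring_exists assms(1) by blast
  then have "\<exists>s c. proper_colouring V E (chromatic_number V E) c \<and>
      (\<exists>i < chromatic_number V E. card {v\<in>V. c v = i} = s)"
    using chromatic_number_pos[OF assms] by blast
  then have "\<exists>c. proper_colouring V E (chromatic_number V E) c \<and>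
      (\<exists>i < chromatic_number V E. card {v\<in>V. c v = i} = sigma V E)"
    unfolding sigma_def by (rule LeastI_ex)
  then show thesis using that by blast
qed

lemma sigma_le:
  assumes "proper_colouring V E (chromatic_number V E) c" "i < chromatic_number V E"
  shows "sigma V E \<le> card {v\<in>V. c v = i}"
  unfolding sigma_def using assms by (intro Least_le) blast

text \<open>Each colour class is mapped bijectively onto the part of its size; differently coloured
  vertices land in different, hence non-adjacent, parts.\<close>

lemma (in sgraph) sep_imp_embedding:
  assumes sep: "sep S (map (\<lambda>i. card {v\<in>V. c v = i}) cs)" and cs: "distinct cs" "c ` V \<subseteq> set cs" and "finite V"
  obtains f where "inj_on f V" "f ` V \<subseteq> S" "\<And>u v. u \<in> V \<Longrightarrow> v \<in> V \<Longrightarrow> c u \<noteq> c v \<Longrightarrow> \<not> E (f u) (f v)"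
proof -
  let ?L = "map (\<lambda>i. card {v\<in>V. c v = i}) cs"
  obtain B where Ba: "\<forall>i<length ?L. B i \<subseteq> S \<and> finite (B i) \<and> card (B i) = ?L ! i"
    and Bb: "\<forall>i<length ?L. \<forall>j<length ?L. i \<noteq> j \<longrightarrow> B i \<inter> B j = {} \<and> (\<forall>u\<in>B i. \<forall>v\<in>B j. \<not> E u v)"
    using sep_family[OF sep] by (elim exE conjE)
  have "\<exists>h. bij_betw h {v\<in>V. c v = cs ! i} (B i)" if "i < length cs" for i
    using Ba that assms(4) by (intro finite_same_card_bij) auto
  then obtain h where h: "\<And>i. i < length cs \<Longrightarrow> bij_betw (h i) {v\<in>V. c v = cs ! i} (B i)" by metis
  have "\<exists>j. j < length cs \<and> cs ! j = c v" if "v \<in> V" for v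
    using cs(2) that by (metis image_subset_iff in_set_conv_nth)
  then obtain ix where ix: "\<And>v. v \<in> V \<Longrightarrow> ix v < length cs \<and> cs ! ix v = c v" by metis
  define f where "f v = h (ix v) v" for v
  have fB: "f v \<in> B (ix v)" if "v \<in> V" for v
    using bij_betwE[OF h[of "ix v"]] ix[OF that] that unfolding f_def by auto
  have ixc: "ix u = ix v \<longleftrightarrow> c u = c v" if "u \<in> V" "v \<in> V" for u v
    using ix[OF that(1)] ix[OF that(2)] cs(1) by (metis nth_eq_iff_index_eq)
  have "inj_on f V"
  proof (rule inj_onI)
    fix u v assume uv: "u \<in> V" "v \<in> V" "f u = f v"
    have "ix u = ix v"
    proof (rule ccontr)
      assume "ix u \<noteq> ix v"
      then have "B (ix u) \<inter> B (ix v) = {}" using Bb ix[OF uv(1)] ix[OF uv(2)] by simp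
      then show False using fB[OF uv(1)] fB[OF uv(2)] uv(3) by auto
    qed
    then have "h (ix u) u = h (ix u) v" "c u = c v"
      using uv(3) ixc[OF uv(1,2)] by (simp_all add: f_def)
    moreover have "inj_on (h (ix u)) {v\<in>V. c v = cs ! ix u}"
      using h[of "ix u"] ix[OF uv(1)] by (auto simp: bij_betw_def)
    ultimately show "u = v" using uv ix[OF uv(1)] by (auto simp: inj_on_def)
  qed
  moreover have "f ` V \<subseteq> S" using fB Ba ix by fastforce
  moreover have "\<not> E (f u) (f v)" if "u \<in> V" "v \<in> V" "c u \<noteq> c v" for u v
  proof -
    have "ix u \<noteq> ix v" using ixc that by blast
    then have "\<forall>a\<in>B (ix u). \<forall>b\<in>B (ix v). \<not> E a b" using Bb ix[OF that(1)] ix[OF that(2)] unfolding length_map by blast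
    then show ?thesis using fB[OF that(1)] fB[OF that(2)] by blast
  qed
  ultimately show thesis using that by blast
qed

lemma (in sgraph) has_cycle_nth:
  assumes "has_cycle S n"
  obtains f where "inj_on f {0..<n}" "f ` {0..<n} \<subseteq> S" "\<And>i. i < n \<Longrightarrow> E (f i) (f ((i + 1) mod n))"
proof -
  obtain xs where xs: "length xs = n" "distinct xs" "set xs \<subseteq> S" "successively E xs" "E (last xs) (hd xs)"
    using assms unfolding has_cycle_def by blast
  have "inj_on (\<lambda>i. xs ! i) {0..<n}" using xs(1,2) by (auto simp: inj_on_def nth_eq_iff_index_eq)
  moreover have "(\<lambda>i. xs ! i) ` {0..<n} \<subseteq> S" using xs(1,3) by (auto simp: subset_iff)
  moreover have "E (xs ! i) (xs ! ((i + 1) mod n))" if i: "i < n" for i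
  proof (cases "Suc i < n")
    case True
    then show ?thesis using successively_nth[OF xs(4)] xs(1) by simp
  next
    case False
    then have "i = n - 1" "xs \<noteq> []" using i xs(1) by auto
    then show ?thesis using xs(1,5) i by (simp add: last_conv_nth hd_conv_nth)
  qed
  ultimately show thesis using that by blast
qed

lemma ramsey_upper:
  assumes H: "graph V E" "V \<noteq> {}" and n: "3 \<le> n"
    and large: "2000000 * l * card V \<le> n" and l: "2 * chromatic_number V E \<le> 2 ^ l"
    and G: "graph {0..<N} F" and N: "N = (chromatic_number V E - 1) * (n - 1) + sigma V E"
  shows "contains_copy {0..<N} F {0..<n} (cycle_edges n) \<or> contains_copy {0..<N} (compl_graph {0..<N} F) V E"
proof -
  interpret sgraph F by unfold_locales (use G in \<open>auto simp: graph_def\<close>)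
  let ?k = "chromatic_number V E"
  obtain c i0 where c: "proper_colouring V E ?k c" and i0: "i0 < ?k" "card {v\<in>V. c v = i0} = sigma V E"
    using sigma_colouring[OF H] by blast
  have finV: "finite V" using H by (simp add: graph_def)
  let ?sz = "\<lambda>i. card {v\<in>V. c v = i}"
  \<comment> \<open>The remaining colours by increasing class size, as the induction requires; the
    smallest class \<open>i0\<close> is appended last.\<close>
  define cs where "cs = sort_key ?sz (filter (\<lambda>i. i \<noteq> i0) [0..<?k])"
  have cs: "set cs = {..<?k} - {i0}" "distinct cs" by (auto simp: cs_def)
  have lcs: "length cs = ?k - 1" using cs i0(1) by (metis card_Diff_singleton card_lessThan distinct_card finite_lessThan lessThan_iff)
  have sum: "sum_list (map ?sz cs) + sigma V E = card V"
  proof -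
    have "sum_list (map ?sz cs) = (\<Sum>i\<in>{..<?k} - {i0}. ?sz i)"
      using cs by (simp add: sum_list_distinct_conv_sum_set)
    then have "sum_list (map ?sz cs) + ?sz i0 = (\<Sum>i<?k. ?sz i)"
      using i0(1) by (subst sum.remove[of _ i0]) auto
    also have "\<dots> = card (\<Union>i<?k. {v\<in>V. c v = i})"
      using finV by (subst card_UN_disjoint) auto
    also have "(\<Union>i<?k. {v\<in>V. c v = i}) = V" using c by (auto simp: proper_colouring_def)
    finally show ?thesis using i0(2) by simp
  qed
  have pos: "1 \<le> sigma V E"
  proof -
    have "{v\<in>V. c v = i0} \<noteq> {}" using colour_class_nonempty[OF H(1) c i0(1)] by blast
    then have "0 < card {v\<in>V. c v = i0}" using finV by (simp add: card_gt_0_iff)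
    then show ?thesis using i0(2) by simp
  qed
  have "sep {0..<N} (map ?sz cs @ [sigma V E]) \<or> has_cycle {0..<N} n"
  proof (rule separated_or_cycle[of "card V" "2000 * card V" l])
    show "1000 * (l * (2000 * card V)) \<le> n" using large by (simp add: algebra_simps)
    show "sorted (map ?sz cs)" unfolding cs_def by (rule sorted_sort_key)
    show "\<forall>a\<in>set (map ?sz cs). sigma V E \<le> a" using sigma_le[OF c] cs(1) by auto
    show "2 * (length (map ?sz cs) + 1) \<le> 2 ^ l" using l lcs i0(1) by simp
    show "card {0..<N} = length (map ?sz cs) * (n - 1) + sigma V E" using N lcs by simp
  qed (use sum pos in auto)
  then show ?thesis
  proof
    assume "has_cycle {0..<N} n"
    from this obtain f where f: "inj_on f {0..<n}" "f ` {0..<n} \<subseteq> {0..<N}" "\<And>i. i < n \<Longrightarrow> F (f i) (f ((i + 1) mod n))"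
      by (rule has_cycle_nth) (rule that)
    have "F (f u) (f v)" if "cycle_edges n u v" for u v
      using that f(3)[of u] f(3)[of v] E_sym unfolding cycle_edges_def by metis
    then show ?thesis using f(1,2) unfolding contains_copy_def by blast
  next
    assume "sep {0..<N} (map ?sz cs @ [sigma V E])"
    then have s: "sep {0..<N} (map ?sz (cs @ [i0]))" using i0(2) by simp
    have d: "distinct (cs @ [i0])" using cs by simp
    have cV: "c ` V \<subseteq> set (cs @ [i0])" using c cs(1) by (auto simp: proper_colouring_def)
    obtain f where f: "inj_on f V" "f ` V \<subseteq> {0..<N}"
      "\<And>u v. u \<in> V \<Longrightarrow> v \<in> V \<Longrightarrow> c u \<noteq> c v \<Longrightarrow> \<not> F (f u) (f v)"
      by (rule sep_imp_embedding[OF s d cV finV]) (rule that)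
    have "compl_graph {0..<N} F (f u) (f v)" if e: "E u v" for u v
    proof -
      have uv: "u \<in> V" "v \<in> V" "u \<noteq> v" using H(1) e unfolding graph_def by blast+
      moreover have "c u \<noteq> c v" using c e by (auto simp: proper_colouring_def)
      ultimately show ?thesis using f unfolding compl_graph_def by (auto simp: inj_on_def)
    qed
    then show ?thesis using f(1,2) unfolding contains_copy_def by blast
  qed
qed

section \<open>The lower bound\<close>

lemma cycle_in_blocks:
  fixes f :: "nat \<Rightarrow> nat" and col :: "nat \<Rightarrow> nat"
  assumes "\<And>i j. cycle_edges n i j \<Longrightarrow> col (f i) = col (f j)" "i < n" "2 \<le> n"
  shows "col (f i) = col (f 0)"
  using assms(2)
proof (induction i)
  case (Suc i)
  have "cycle_edges n i (Suc i)" using Suc.prems unfolding cycle_edges_def by simp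
  then show ?case using Suc assms(1) by (metis Suc_lessD)
qed simp

text \<open>For one colour, too few vertices are available. Otherwise take disjoint cliques on
  consecutive blocks of \<open>n - 1\<close> vertices, the last with fewer than
  \<open>sigma V E\<close>. No block holds the cycle, and a copy of \<open>H\<close> in the
  complement would be coloured by its blocks with too small a last class.\<close>

lemma ramsey_lower:
  assumes H: "graph V E" "V \<noteq> {}" and n: "3 \<le> n" and small: "chromatic_number V E = 1 \<or> card V \<le> n"
    and N: "N < (chromatic_number V E - 1) * (n - 1) + sigma V E"
  shows "\<exists>F. graph {0..<N} F \<and> \<not> contains_copy {0..<N} F {0..<n} (cycle_edges n) \<and>
    \<not> contains_copy {0..<N} (compl_graph {0..<N} F) V E"
proof -
  let ?k = "chromatic_number V E"
  have finV: "finite V" using H by (simp add: graph_def)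
  obtain c i0 where c: "proper_colouring V E ?k c" "i0 < ?k" "card {v\<in>V. c v = i0} = sigma V E"
    using sigma_colouring[OF H] by blast
  have sV: "sigma V E \<le> card V" using c(3) finV by (metis (no_types, lifting) card_mono mem_Collect_eq subsetI)
  show ?thesis
  proof (cases "?k = 1")
    case True
    have NV: "N < card V" using N True sV by simp
    have "cycle_edges n 0 1" using n by (simp add: cycle_edges_def)
    then have "\<not> contains_copy {0..<N} (\<lambda>_ _. False) {0..<n} (cycle_edges n)"
      unfolding contains_copy_def by blast
    moreover have "\<not> contains_copy {0..<N} F V E" for F
    proof
      assume "contains_copy {0..<N} F V E"
      then obtain f where "inj_on f V" "f ` V \<subseteq> {0..<N}" unfolding contains_copy_def by blast
      then have "card V \<le> card {0..<N}" by (rule card_inj_on_le) simp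
      then show False using NV by simp
    qed
    ultimately show ?thesis by (intro exI[of _ "\<lambda>_ _. False"]) (auto simp: graph_def)
  next
    case False
    then have k2: "2 \<le> ?k" using c(2) by simp
    let ?b = "\<lambda>v. v div (n - 1)"
    let ?F = "\<lambda>u v. u < N \<and> v < N \<and> u \<noteq> v \<and> ?b u = ?b v"
    have n1: "0 < n - 1" using n by simp
    \<comment> \<open>\<open>sigma V E \<le> card V \<le> n\<close> ensures that \<open>?k\<close>
      blocks of size \<open>n - 1\<close> cover all vertices.\<close>
    have "N < (?k - 1) * (n - 1) + (n - 1) + 1" using N sV small False by linarith
    then have "N \<le> (?k - 1) * (n - 1) + (n - 1)" by simp
    also have "\<dots> = ?k * (n - 1)" using k2 by (cases ?k) auto
    finally have Nk: "N \<le> ?k * (n - 1)" .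
    have bk: "?b v < ?k" if "v < N" for v
      using that Nk n1 by (meson div_less_iff_less_mult less_le_trans)
    have "graph {0..<N} ?F" by (auto simp: graph_def)
    moreover have "\<not> contains_copy {0..<N} ?F {0..<n} (cycle_edges n)"
    proof
      assume "contains_copy {0..<N} ?F {0..<n} (cycle_edges n)"
      then obtain f where f: "inj_on f {0..<n}" "\<And>u v. cycle_edges n u v \<Longrightarrow> ?F (f u) (f v)"
        unfolding contains_copy_def by blast
      have same: "?b (f i) = ?b (f 0)" if "i < n" for i
        using f(2) that n by (intro cycle_in_blocks[where n = n and col = ?b]) auto
      have blk: "?b w = ?b (f 0)" if w: "w \<in> f ` {0..<n}" for w
      proof -
        obtain i where "i < n" "w = f i" using w by auto
        then show ?thesis using same[of i] by blast
      qed
      let ?m = "?b (f 0) * (n - 1)"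
      have "w \<in> {?m..<?m + (n - 1)}" if "w \<in> f ` {0..<n}" for w
        using div_times_less_eq_dividend[of w "n - 1"] dividend_less_div_times[OF n1, of w]
        unfolding blk[OF that] by simp
      then have "f ` {0..<n} \<subseteq> {?m..<?m + (n - 1)}" by blast
      then have "card (f ` {0..<n}) \<le> card {?m..<?m + (n - 1)}" by (rule card_mono[OF finite_atLeastLessThan])
      then have "card (f ` {0..<n}) \<le> n - 1" by simp
      then show False using f(1) n by (simp add: card_image)
    qed
    moreover have "\<not> contains_copy {0..<N} (compl_graph {0..<N} ?F) V E"
    proof
      assume "contains_copy {0..<N} (compl_graph {0..<N} ?F) V E"
      then obtain f where f: "inj_on f V" "f ` V \<subseteq> {0..<N}" "\<And>u v. E u v \<Longrightarrow> compl_graph {0..<N} ?F (f u) (f v)"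
        unfolding contains_copy_def by blast
      have "?b (f u) \<noteq> ?b (f v)" if "E u v" for u v
        using f(3)[OF that] unfolding compl_graph_def by auto
      then have pc: "proper_colouring V E ?k (\<lambda>v. ?b (f v))"
        unfolding proper_colouring_def using bk f(2) by auto
      let ?C = "{v\<in>V. ?b (f v) = ?k - 1}"
      have "f ` ?C \<subseteq> {(?k - 1) * (n - 1)..<N}"
      proof
        fix w assume "w \<in> f ` ?C"
        then obtain v where v: "v \<in> V" "?b (f v) = ?k - 1" "w = f v" by blast
        have "(?k - 1) * (n - 1) \<le> f v" using v(2) by (metis div_times_less_eq_dividend)
        then show "w \<in> {(?k - 1) * (n - 1)..<N}" using v f(2) by auto
      qed
      then have "card (f ` ?C) \<le> N - (?k - 1) * (n - 1)" using card_mono[of "{(?k - 1) * (n - 1)..<N}"] by simp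
      moreover have "card (f ` ?C) = card ?C" using f(1) by (intro card_image) (auto simp: inj_on_def)
      moreover have "sigma V E \<le> card ?C" using sigma_le[OF pc] k2 by simp
      \<comment> \<open>If the last block is empty the difference truncates to 0; nonemptiness of
        the class excludes this case.\<close>
      moreover have "0 < card ?C"
      proof -
        have "?C \<noteq> {}" using colour_class_nonempty[OF H(1) pc, of "?k - 1"] k2 by auto
        then show ?thesis using finV by (simp add: card_gt_0_iff)
      qed
      ultimately show False using N by linarith
    qed
    ultimately show ?thesis by blast
  qed
qed

section \<open>The logarithmic estimate and the Ramsey number\<close>

lemma ln_two_ge_half: "1 / 2 \<le> ln (2::real)"
proof -
  have "exp 1 \<le> (4::real)" using exp_le by linarith
  then have "1 \<le> ln (4::real)" by (subst ln_ge_iff) auto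
  also have "ln (4::real) = ln (2 ^ 2)" by simp
  also have "\<dots> = 2 * ln 2" by (subst ln_realpow) auto
  finally show ?thesis by simp
qed

text \<open>The number of halvings is at most \<open>6 * ln k\<close>. Since
  \<open>ln k \<ge> 1 / 2\<close>, one has \<open>ln k \<le> 8 * ln k ^ 4\<close>, which gives
  \<open>6 * 8 = 48\<close>.\<close>

lemma log_bound:
  assumes "2 \<le> k" obtains l :: nat where "2 * k \<le> 2 ^ l" "real l \<le> 48 * ln (real k) ^ 4"
proof -
  obtain l where l: "2 * k \<le> 2 ^ l" "2 ^ l \<le> 2 * (2 * k)" using pow2_above[of "2 * k"] assms by auto
  have lk: "ln 2 \<le> ln (real k)" using assms by simp
  have "real (2 ^ l) \<le> real (2 * (2 * k))" using l(2) of_nat_mono by blast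
  then have "ln ((2::real) ^ l) \<le> ln (4 * real k)" using assms by (subst ln_le_cancel_iff) auto
  then have "real l * ln 2 \<le> ln (2 ^ 2) + ln (real k)" using assms by (simp add: ln_mult ln_realpow)
  also have "ln (2 ^ 2) = 2 * ln (2::real)" by (subst ln_realpow) auto
  finally have "real l * ln 2 \<le> 3 * ln (real k)" using lk by linarith
  moreover have "real l * (1 / 2) \<le> real l * ln 2" using ln_two_ge_half by (intro mult_left_mono) auto
  ultimately have a: "real l \<le> 6 * ln (real k)" by linarith
  have h: "1 / 2 \<le> ln (real k)" using lk ln_two_ge_half by linarith
  have "(1 / 2) ^ 3 \<le> ln (real k) ^ 3" using h by (intro power_mono) auto
  then have "(1 / 8) * ln (real k) \<le> ln (real k) ^ 3 * ln (real k)" using h by (intro mult_right_mono) (auto simp: power3_eq_cube)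
  also have "\<dots> = ln (real k) ^ 4" by (simp add: power4_eq_xxxx power3_eq_cube)
  finally show thesis using that[OF l(1)] a by linarith
qed

theorem theorem1p2:
  shows "\<exists>C::real. C > 0 \<and>
    (\<forall>(V::nat set) E (n::nat).
       graph V E \<longrightarrow> V \<noteq> {} \<longrightarrow> 3 \<le> n \<longrightarrow>
       real n \<ge> C * real (card V) * (ln (real (chromatic_number V E))) ^ 4 \<longrightarrow>
       ramsey_number {0..<n} (cycle_edges n) V E
         = (chromatic_number V E - 1) * (n - 1) + sigma V E)"
\<comment> \<open>\<open>10 ^ 8\<close> exceeds \<open>2000000 * 48\<close>, the product of the
  constants of \<open>ramsey_upper\<close> and \<open>log_bound\<close>.\<close>
proof (intro exI[of _ "10 ^ 8"] conjI allI impI)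
  fix V :: "nat set" and E and n :: nat
  assume H: "graph V E" "V \<noteq> {}" and n: "3 \<le> n"
    and big: "10 ^ 8 * real (card V) * (ln (real (chromatic_number V E))) ^ 4 \<le> real n"
  let ?k = "chromatic_number V E"
  let ?N = "(?k - 1) * (n - 1) + sigma V E"
  let ?P = "\<lambda>N. \<forall>F. graph {0..<N} F \<longrightarrow>
      contains_copy {0..<N} F {0..<n} (cycle_edges n) \<or> contains_copy {0..<N} (compl_graph {0..<N} F) V E"
  have k1: "1 \<le> ?k" using chromatic_number_pos[OF H] by simp
  have "?P ?N \<and> (?k = 1 \<or> card V \<le> n)"
  proof (cases "?k = 1")
    \<comment> \<open>Here \<open>ln 1 = 0\<close>, so the size hypothesis says nothing about
      \<open>card V\<close>. But \<open>H\<close> has no edges and fits into any graph on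
      \<open>card V\<close> vertices.\<close>
    case True
    obtain c i where c: "proper_colouring V E ?k c" "i < ?k" "card {v\<in>V. c v = i} = sigma V E"
      using sigma_colouring[OF H] by blast
    have "{v\<in>V. c v = i} = V" using c(1,2) True by (auto simp: proper_colouring_def)
    then have N: "?N = card V" using c(3) True by simp
    have noE: "\<not> E u v" for u v using c(1) True H(1) unfolding proper_colouring_def graph_def by force
    have "finite V" using H(1) by (simp add: graph_def)
    then obtain f where "bij_betw f V {0..<card V}" using ex_bij_betw_finite_nat by blast
    then have "contains_copy {0..<?N} F V E" for F
      unfolding contains_copy_def N bij_betw_def using noE by blast
    then show ?thesis using True by blast
  next
    case False
    then obtain l where l: "2 * ?k \<le> 2 ^ l" "real l \<le> 48 * ln (real ?k) ^ 4" using log_bound[of ?k] k1 by auto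
    have "2000000 * real l * real (card V) \<le> 2000000 * (48 * ln (real ?k) ^ 4) * real (card V)"
      using l(2) by (intro mult_right_mono mult_left_mono) auto
    also have "\<dots> = (96000000 * real (card V)) * ln (real ?k) ^ 4" by simp
    also have "\<dots> \<le> (10 ^ 8 * real (card V)) * ln (real ?k) ^ 4" by (intro mult_right_mono) auto
    also have "\<dots> \<le> real n" using big .
    finally have "real (2000000 * l * card V) \<le> real n" by simp
    then have large: "2000000 * l * card V \<le> n" by (simp only: of_nat_le_iff)
    have "1 \<le> l" using l(1) k1 by (cases l) auto
    then have "card V \<le> 2000000 * l * card V" by simp
    then have "card V \<le> n" using large by (rule le_trans)
    moreover have "?P ?N" using ramsey_upper[OF H n large l(1) _ refl] by blast
    ultimately show ?thesis by blast
  qed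
  then have P: "?P ?N" and small: "?k = 1 \<or> card V \<le> n" by auto
  have "?N \<le> N" if "?P N" for N
    using ramsey_lower[OF H n small, of N] that by (meson linorder_not_le)
  then show "ramsey_number {0..<n} (cycle_edges n) V E = ?N"
    unfolding ramsey_number_def using P by (intro Least_equality) auto
qed simp

end
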